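(* Assume $0\notin\Gamma_\mu$, let $s\in(I_\mu^+)^\circ\cup(I_\mu^-)^\circ$, and assume either (i) $s\in I_\mu^-$ and there is $\varkappa_0>1$ such that for $\mu$-a.e. $g$: $g>0$ and $\max_{i,j}g^{i,j}\le\varkappa_0\min_{i,j}g^{i,j}$; or (ii) $s\in I_\mu^+$ and there is $\varkappa>1$ such that for $\mu$-a.e. $g$: $g>0$ and $\max_ig^{i,j}\le\varkappa\min_ig^{i,j}$ for all $1\le j\le d$. Then, for any $0<\gamma\le\min\{|s|,1\}$, we have $P_s\in\mathscr L(\mathscr B_\gamma,\mathscr B_\gamma)$ and, for any $n\ge1$, $$P_s^n=\kappa(s)^nM_s+L_s^n,$$ where $M_s$ is the rank-one projection on $\mathscr B_\gamma$ defined by $M_s\varphi=\frac{\nu_s(\varphi)}{\nu_s(r_s)}r_s$ for $\varphi\in\mathscr B_\gamma$, and $L_s\in\mathscr L(\mathscr B_\gamma,\mathscr B_\gamma)$ satisfies $M_sL_s=L_sM_s=0$ and $\rho(L_s)<\kappa(s)$.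
   Context: Let $d\ge2$. $\mathbb R^d$ carries the standard scalar product and the norm $\|v\|=\sum_i|v_i|$; $\mathbb R^d_+$ is the set of vectors with non-negative coordinates; $\mathcal S=\{v\in\mathbb R^d_+:\|v\|=1\}$. $\mathbb G$ is the semigroup of non-negative $d\times d$ matrices, $\|g\|=\sum_{i,j}g^{i,j}$, $g>0$ means all entries strictly positive, $g^{\mathrm T}$ the transpose, $g\cdot v=gv/\|gv\|$. $(g_n)$ are i.i.d. in $\mathbb G$ with law $\mu$, $G_n=g_n\cdots g_1$; $\Gamma_\mu$ is the closed semigroup spanned by $\operatorname{supp}\mu$. $I_\mu^+=\{s\ge0:\mathbb E\|g_1\|^s<\infty\}$, $I_\mu^-=\{s\le0:\mathbb E\|g_1\|^s<\infty\}$; $^\circ$ denotes interior in $\mathbb R$. $\kappa(s)=\lim_n(\mathbb E\|G_n\|^s)^{1/n}$. $P_s\varphi(v)=\int\|gv\|^s\varphi(g\cdot v)\mu(dg)$, $P_s^*\varphi(v)=\int\|g^{\mathrm T}v\|^s\varphi(g^{\mathrm T}\cdot v)\mu(dg)$, and on measures $(P_s\eta)\varphi=\eta(P_s\varphi)$ (likewise $P_s^*$). Under the hypotheses there are unique probability measures $\nu_s,\nu_s^*$ on $\mathcal S$ with $P_s\nu_s=\kappa(s)\nu_s$, $P_s^*\nu_s^*=\kappa(s)\nu_s^*$, and $r_s(v)=\int\langle v,u\rangle^s\nu_s^*(du)$ is strictly positive, continuous and satisfies $P_sr_s=\kappa(s)r_s$. The space $\mathcal S$ is equipped with the Hilbert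 cross-ratio metric $\mathbf d(u,v)=\frac{1-m(u,v)m(v,u)}{1+m(u,v)m(v,u)}$, $m(u,v)=\sup\{\lambda\ge0:\lambda v_i\le u_i\ \forall i\}$. $\mathscr B_\gamma$ is the Banach space of complex-valued continuous $\varphi$ on $\mathcal S$ with $\|\varphi\|_\gamma=\sup|\varphi|+\sup_{u\ne v}|\varphi(u)-\varphi(v)|/\mathbf d(u,v)^\gamma<\infty$; $\mathscr L(\mathscr B_\gamma,\mathscr B_\gamma)$ is the set of bounded linear operators on it and $\rho$ the spectral radius. *)

theory Defs
  imports "HOL-Probability.Probability"
begin

text \<open>The norms used here are entrywise sums, so the library's Euclidean \<open>norm\<close> on
  \<open>real ^ 'd\<close> is not used. Matrices are \<open>g :: real ^ 'd ^ 'd\<close> with \<open>g $ i $ j\<close> the entry in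
  row \<open>i\<close> and column \<open>j\<close>.\<close>

definition vnorm :: "real ^ 'd \<Rightarrow> real" where
  "vnorm v = (\<Sum>i\<in>UNIV. \<bar>v $ i\<bar>)"

definition mnorm :: "real ^ 'd ^ 'd \<Rightarrow> real" where
  "mnorm g = (\<Sum>i\<in>UNIV. \<Sum>j\<in>UNIV. g $ i $ j)"

definition nonneg_matrices :: "(real ^ 'd ^ 'd) set" where
  "nonneg_matrices = {g. \<forall>i j. 0 \<le> g $ i $ j}"

definition pos_matrix :: "real ^ 'd ^ 'd \<Rightarrow> bool" where
  "pos_matrix g \<longleftrightarrow> (\<forall>i j. 0 < g $ i $ j)"

definition simplex_S :: "(real ^ 'd) set" where
  "simplex_S = {v. (\<forall>i. 0 \<le> v $ i) \<and> vnorm v = 1}"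

definition act :: "real ^ 'd ^ 'd \<Rightarrow> real ^ 'd \<Rightarrow> real ^ 'd" where
  "act g v = (1 / vnorm (g *v v)) *\<^sub>R (g *v v)"

definition msupp :: "'a::topological_space measure \<Rightarrow> 'a set" where
  "msupp \<mu> = {x. \<forall>U. open U \<longrightarrow> x \<in> U \<longrightarrow> 0 < emeasure \<mu> U}"

definition closed_semigroup_span :: "(real ^ 'd ^ 'd) set \<Rightarrow> (real ^ 'd ^ 'd) set" where
  "closed_semigroup_span A = (\<lambda>T. closed T \<and> (\<forall>a\<in>T. \<forall>b\<in>T. a ** b \<in> T)) hull A"

definition Gamma_mu :: "(real ^ 'd ^ 'd) measure \<Rightarrow> (real ^ 'd ^ 'd) set" where
  "Gamma_mu \<mu> = closed_semigroup_span (msupp \<mu>)"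

text \<open>Moments are written with \<open>powr\<close>, for which \<open>0 powr s = 0\<close>. Whenever \<open>0 \<notin> Gamma_mu \<mu>\<close>,
  the zero matrix has a \<open>\<mu>\<close>-null neighbourhood, so this convention does not affect
  the moments of negative order.\<close>

definition I_plus :: "(real ^ 'd ^ 'd) measure \<Rightarrow> real set" where
  "I_plus \<mu> = {s. 0 \<le> s \<and> (\<integral>\<^sup>+ g. ennreal (mnorm g powr s) \<partial>\<mu>) < \<infinity>}"

definition I_minus :: "(real ^ 'd ^ 'd) measure \<Rightarrow> real set" where
  "I_minus \<mu> = {s. s \<le> 0 \<and> (\<integral>\<^sup>+ g. ennreal (mnorm g powr s) \<partial>\<mu>) < \<infinity>}"

definition iid_with_law ::
    "'w measure \<Rightarrow> (nat \<Rightarrow> 'w \<Rightarrow> real ^ 'd ^ 'd) \<Rightarrow> (real ^ 'd ^ 'd) measure \<Rightarrow> bool" where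
  "iid_with_law W g \<mu> \<longleftrightarrow>
     prob_space W \<and> prob_space.indep_vars W (\<lambda>_. borel) g {1..} \<and>
     (\<forall>n\<ge>1. distr W borel (g n) = \<mu>)"

text \<open>The sequence is indexed from 1; the value \<open>g 0\<close> is never used.\<close>

primrec Gprod :: "(nat \<Rightarrow> 'w \<Rightarrow> real ^ 'd ^ 'd) \<Rightarrow> nat \<Rightarrow> 'w \<Rightarrow> real ^ 'd ^ 'd" where
  "Gprod g 0 \<omega> = mat 1"
| "Gprod g (Suc n) \<omega> = g (Suc n) \<omega> ** Gprod g n \<omega>"

definition kappa :: "'w measure \<Rightarrow> (nat \<Rightarrow> 'w \<Rightarrow> real ^ 'd ^ 'd) \<Rightarrow> real \<Rightarrow> real" where
  "kappa W g s = lim (\<lambda>n. (\<integral>\<omega>. mnorm (Gprod g n \<omega>) powr s \<partial>W) powr (1 / real n))"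

text \<open>A complex function on the simplex is represented by a function on \<open>real ^ 'd\<close> which
  vanishes off the simplex, so that equality of functions is equality on the simplex.\<close>

definition P_op :: "(real ^ 'd ^ 'd) measure \<Rightarrow> real \<Rightarrow>
    (real ^ 'd \<Rightarrow> complex) \<Rightarrow> real ^ 'd \<Rightarrow> complex" where
  "P_op \<mu> s \<phi> = (\<lambda>v. if v \<in> simplex_S
     then (\<integral>g. complex_of_real (vnorm (g *v v) powr s) * \<phi> (act g v) \<partial>\<mu>) else 0)"

definition P_star :: "(real ^ 'd ^ 'd) measure \<Rightarrow> real \<Rightarrow>
    (real ^ 'd \<Rightarrow> complex) \<Rightarrow> real ^ 'd \<Rightarrow> complex" where
  "P_star \<mu> s \<phi> = (\<lambda>v. if v \<in> simplex_S
     then (\<integral>g. complex_of_real (vnorm (transpose g *v v) powr s) * \<phi> (act (transpose g) v) \<partial>\<mu>)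
     else 0)"

text \<open>The relation \<open>P \<eta> = k \<eta>\<close> for a Borel probability measure \<open>\<eta>\<close> on the simplex,
  where \<open>P \<eta>\<close> is given by \<open>(P \<eta>) \<phi> = \<eta> (P \<phi>)\<close>, tested on all continuous
  functions \<open>\<phi>\<close> on the simplex (extended by 0 as above, which makes them Borel on \<open>real ^ 'd\<close>).\<close>

definition prob_eigenmeasure ::
    "((real ^ 'd \<Rightarrow> complex) \<Rightarrow> real ^ 'd \<Rightarrow> complex) \<Rightarrow> real \<Rightarrow> (real ^ 'd) measure \<Rightarrow> bool" where
  "prob_eigenmeasure P k \<eta> \<longleftrightarrow>
     prob_space \<eta> \<and> sets \<eta> = sets (restrict_space borel simplex_S) \<and>
     (\<forall>\<phi>. continuous_on simplex_S \<phi> \<and> (\<forall>v. v \<notin> simplex_S \<longrightarrow> \<phi> v = 0) \<longrightarrow>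
        (\<integral>v. P \<phi> v \<partial>\<eta>) = complex_of_real k * (\<integral>v. \<phi> v \<partial>\<eta>))"

definition nu :: "(real ^ 'd ^ 'd) measure \<Rightarrow> real \<Rightarrow> real \<Rightarrow> (real ^ 'd) measure" where
  "nu \<mu> k s = (THE \<eta>. prob_eigenmeasure (P_op \<mu> s) k \<eta>)"

definition nu_star :: "(real ^ 'd ^ 'd) measure \<Rightarrow> real \<Rightarrow> real \<Rightarrow> (real ^ 'd) measure" where
  "nu_star \<mu> k s = (THE \<eta>. prob_eigenmeasure (P_star \<mu> s) k \<eta>)"

definition r_fun :: "(real ^ 'd ^ 'd) measure \<Rightarrow> real \<Rightarrow> real \<Rightarrow> real ^ 'd \<Rightarrow> complex" where
  "r_fun \<mu> k s = (\<lambda>v. if v \<in> simplex_S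
     then complex_of_real (\<integral>u. (v \<bullet> u) powr s \<partial>nu_star \<mu> k s) else 0)"

definition M_op :: "(real ^ 'd ^ 'd) measure \<Rightarrow> real \<Rightarrow> real \<Rightarrow>
    (real ^ 'd \<Rightarrow> complex) \<Rightarrow> real ^ 'd \<Rightarrow> complex" where
  "M_op \<mu> k s \<phi> = (\<lambda>v.
     (\<integral>u. \<phi> u \<partial>nu \<mu> k s) / (\<integral>u. r_fun \<mu> k s u \<partial>nu \<mu> k s) * r_fun \<mu> k s v)"

definition m_ratio :: "real ^ 'd \<Rightarrow> real ^ 'd \<Rightarrow> real" where
  "m_ratio u v = Sup {l. 0 \<le> l \<and> (\<forall>i. l * v $ i \<le> u $ i)}"

definition d_hilbert :: "real ^ 'd \<Rightarrow> real ^ 'd \<Rightarrow> real" where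
  "d_hilbert u v = (1 - m_ratio u v * m_ratio v u) / (1 + m_ratio u v * m_ratio v u)"

definition hoelder_quotients :: "real \<Rightarrow> (real ^ 'd \<Rightarrow> complex) \<Rightarrow> real set" where
  "hoelder_quotients \<gamma> \<phi> =
     {cmod (\<phi> u - \<phi> v) / d_hilbert u v powr \<gamma> | u v. u \<in> simplex_S \<and> v \<in> simplex_S \<and> u \<noteq> v}"

definition B_norm :: "real \<Rightarrow> (real ^ 'd \<Rightarrow> complex) \<Rightarrow> real" where
  "B_norm \<gamma> \<phi> = (SUP v\<in>simplex_S. cmod (\<phi> v)) + Sup (hoelder_quotients \<gamma> \<phi>)"

text \<open>Continuity refers to the topology of the simplex as a subspace of \<open>real ^ 'd\<close>. It is not
  implied by the Hoelder bound, since two points of the simplex with different sets of vanishing coordinates are at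
  \<open>d_hilbert\<close>-distance 1. The \<open>bdd_above\<close> conditions say that both suprema in the norm are
  finite.\<close>

definition B_space :: "real \<Rightarrow> (real ^ 'd \<Rightarrow> complex) set" where
  "B_space \<gamma> = {\<phi>. (\<forall>v. v \<notin> simplex_S \<longrightarrow> \<phi> v = 0) \<and> continuous_on simplex_S \<phi> \<and>
     bdd_above ((\<lambda>v. cmod (\<phi> v)) ` simplex_S) \<and> bdd_above (hoelder_quotients \<gamma> \<phi>)}"

text \<open>Operators are functions on all of \<open>real ^ 'd \<Rightarrow> complex\<close>; only their restriction to
  \<open>B_space \<gamma>\<close> matters.\<close>

definition bounded_ops ::
    "real \<Rightarrow> ((real ^ 'd \<Rightarrow> complex) \<Rightarrow> real ^ 'd \<Rightarrow> complex) set" where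
  "bounded_ops \<gamma> = {T.
     (\<forall>\<phi>\<in>B_space \<gamma>. T \<phi> \<in> B_space \<gamma>) \<and>
     (\<forall>\<phi>\<in>B_space \<gamma>. \<forall>\<psi>\<in>B_space \<gamma>. T (\<lambda>v. \<phi> v + \<psi> v) = (\<lambda>v. T \<phi> v + T \<psi> v)) \<and>
     (\<forall>c. \<forall>\<phi>\<in>B_space \<gamma>. T (\<lambda>v. c * \<phi> v) = (\<lambda>v. c * T \<phi> v)) \<and>
     (\<exists>C. \<forall>\<phi>\<in>B_space \<gamma>. B_norm \<gamma> (T \<phi>) \<le> C * B_norm \<gamma> \<phi>)}"

definition op_spectrum ::
    "real \<Rightarrow> ((real ^ 'd \<Rightarrow> complex) \<Rightarrow> real ^ 'd \<Rightarrow> complex) \<Rightarrow> complex set" where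
  "op_spectrum \<gamma> T = {z. \<not> (\<exists>R\<in>bounded_ops \<gamma>. \<forall>\<phi>\<in>B_space \<gamma>.
     R (\<lambda>v. z * \<phi> v - T \<phi> v) = \<phi> \<and> (\<lambda>v. z * R \<phi> v - T (R \<phi>) v) = \<phi>)}"

definition spec_radius ::
    "real \<Rightarrow> ((real ^ 'd \<Rightarrow> complex) \<Rightarrow> real ^ 'd \<Rightarrow> complex) \<Rightarrow> real" where
  "spec_radius \<gamma> T = (SUP z\<in>op_spectrum \<gamma> T. cmod z)"

definition rank_one_projection ::
    "real \<Rightarrow> ((real ^ 'd \<Rightarrow> complex) \<Rightarrow> real ^ 'd \<Rightarrow> complex) \<Rightarrow> bool" where
  "rank_one_projection \<gamma> T \<longleftrightarrow>
     T \<in> bounded_ops \<gamma> \<and> (\<forall>\<phi>\<in>B_space \<gamma>. T (T \<phi>) = T \<phi>) \<and>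
     (\<exists>\<psi>\<in>B_space \<gamma>. \<psi> \<noteq> (\<lambda>v. 0) \<and> T ` B_space \<gamma> = range (\<lambda>c v. c * \<psi> v))"

end

theory Submission
  imports Defs
begin

text \<open>A positive matrix with comparable entries contracts \<open>d_hilbert\<close> by a factor that depends only on
  the comparability constant. Hence the transfer operator \<open>P\<close> maps a cone of log-Lipschitz functions
  into a strictly smaller one. Comparing \<open>(P ^^ n) f\<close> with \<open>(P ^^ n) one\<close> inside this cone gives upper
  and lower ratios whose gap shrinks geometrically; their common limit is a positive functional, which
  a Riesz argument turns into the eigenmeasure, and the normalised iterates converge geometrically to
  the positive eigenfunction \<open>r\<close>.
  The same argument applies to the transposed matrices. By Fubini, \<open>v \<mapsto> \<integral> \<langle>v, u\<rangle> powr s d\<nu>*(u)\<close> is an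
  eigenfunction of \<open>P\<close> for the eigenvalue of the transposed operator, so both eigenvalues agree, and by
  uniqueness this function is a multiple of \<open>r\<close>. The iterates of \<open>L = P - \<kappa> M\<close> then decay faster
  than \<open>\<kappa> ^ n\<close>, both in the supremum norm and in the Hoelder seminorm, and a Neumann series
  bounds the spectral radius.\<close>

subsection \<open>Contraction of the Hilbert metric\<close>

text \<open>Under (ii) only entries within a column are comparable, so \<open>vnorm (g *v u)\<close>
  and \<open>vnorm (g *v v)\<close> need not be comparable uniformly in \<open>g\<close> for
  \<open>u\<close>, \<open>v\<close> on different faces of the simplex. Logarithmic control of the
  weights is available only on the set \<open>simplex_K\<close> which the matrices enter after one
  step, while the Hoelder space lives on the whole simplex. Estimates are therefore made on an
  attracting set and carried to the simplex by one further application of \<open>P\<close>, at the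
  price of an index shift. Transposition turns column comparability into row comparability, so under
  (ii) the dual system is of a different kind: it is log-Lipschitz on the whole simplex but has no
  smaller attracting set. Both systems are made instances of one abstract locale. The distance is
  \<open>d_hilbert\<close> raised to the power \<open>\<gamma>\<close> from the start, so that cone
  estimates already are Hoelder estimates; as \<open>d_hilbert\<close> and \<open>\<gamma>\<close>
  are at most 1, Lipschitz bounds for \<open>d_hilbert\<close> survive. Cones need real functions;
  complex ones are split into real and imaginary parts.\<close>

lemma simplex_D:
  assumes "v \<in> simplex_S"
  shows "0 \<le> v $ i" "(\<Sum>i\<in>UNIV. v $ i) = 1" "v $ i \<le> 1"
proof -
  show *: "0 \<le> v $ i" for i using assms by (auto simp: simplex_S_def)
  show s: "(\<Sum>i\<in>UNIV. v $ i) = 1"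
    using assms * by (simp add: simplex_S_def vnorm_def)
  show "v $ i \<le> 1"
    using member_le_sum[of i UNIV "\<lambda>i. v $ i"] * s by auto
qed

lemma vnorm_nonneg: "0 \<le> vnorm v"
  by (simp add: vnorm_def sum_nonneg)

lemma vnorm_eq_sum: "(\<And>i. 0 \<le> v $ i) \<Longrightarrow> vnorm v = (\<Sum>i\<in>UNIV. v $ i)"
  by (simp add: vnorm_def)

text \<open>Both coordinate sums are 1, so summing the inequalities caps every admissible factor at
  1. This is the upper bound that gives the \<open>Sup\<close> in \<open>m_ratio\<close> a meaning;
  the factor 0 is always admissible.\<close>

lemma m_ratio_bdd:
  assumes "u \<in> simplex_S" "v \<in> simplex_S" "0 \<le> l" "\<And>i. l * v $ i \<le> u $ i"
  shows "l \<le> 1"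
  using sum_mono[of UNIV "\<lambda>i. l * v $ i" "\<lambda>i. u $ i"] assms
  by (simp add: simplex_D sum_distrib_left[symmetric])

lemma m_ratio_nonneg:
  assumes "u \<in> simplex_S" "v \<in> simplex_S"
  shows "0 \<le> m_ratio u v"
  unfolding m_ratio_def
  by (rule cSup_upper) (use assms m_ratio_bdd[OF assms] simplex_D(1) in \<open>auto intro!: bdd_aboveI[of _ 1]\<close>)

lemma m_ratio_ge:
  assumes "u \<in> simplex_S" "v \<in> simplex_S" "0 \<le> l" "\<And>i. l * v $ i \<le> u $ i"
  shows "l \<le> m_ratio u v"
  unfolding m_ratio_def
  by (rule cSup_upper) (use assms m_ratio_bdd[OF assms(1,2)] in \<open>auto intro!: bdd_aboveI[of _ 1]\<close>)

lemma m_ratio_le_1: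
  assumes "u \<in> simplex_S" "v \<in> simplex_S"
  shows "m_ratio u v \<le> 1"
  unfolding m_ratio_def
  by (rule cSup_least)
    (use assms m_ratio_bdd[OF assms] simplex_D(1) in \<open>auto intro!: exI[of _ 0]\<close>)

text \<open>The supremum is attained: in each coordinate with \<open>v $ i > 0\<close> every
  admissible factor is at most \<open>u $ i / v $ i\<close>, and the coordinates with
  \<open>v $ i = 0\<close> impose nothing.\<close>

lemma m_ratio_mult_le:
  assumes "u \<in> simplex_S" "v \<in> simplex_S"
  shows "m_ratio u v * v $ i \<le> u $ i"
proof (cases "v $ i = 0")
  case True then show ?thesis using simplex_D[OF assms(1)] by simp
next
  case False
  then have p: "0 < v $ i" using simplex_D(1)[OF assms(2), of i] by simp
  have "m_ratio u v \<le> u $ i / v $ i"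
    unfolding m_ratio_def
    by (rule cSup_least) (use assms p simplex_D(1) in \<open>auto simp: field_simps intro!: exI[of _ 0]\<close>)
  then show ?thesis using p by (simp add: field_simps)
qed

lemma m_ratio_prod:
  assumes "u \<in> simplex_S" "v \<in> simplex_S"
  shows "0 \<le> m_ratio u v * m_ratio v u" "m_ratio u v * m_ratio v u \<le> 1"
    "m_ratio u v * m_ratio v u \<le> m_ratio u v" "m_ratio u v * m_ratio v u \<le> m_ratio v u"
  using m_ratio_nonneg[OF assms] m_ratio_nonneg[OF assms(2,1)] m_ratio_le_1[OF assms] m_ratio_le_1[OF assms(2,1)]
  by (auto simp: mult_le_one mult_left_le mult_left_le_one_le)

lemma d_hilbert_commute: "d_hilbert u v = d_hilbert v u"
  by (simp add: d_hilbert_def mult.commute)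

lemma d_hilbert_nonneg:
  assumes "u \<in> simplex_S" "v \<in> simplex_S"
  shows "0 \<le> d_hilbert u v"
  using m_ratio_prod[OF assms] by (simp add: d_hilbert_def)

lemma d_hilbert_le_1:
  assumes "u \<in> simplex_S" "v \<in> simplex_S"
  shows "d_hilbert u v \<le> 1"
  using m_ratio_prod[OF assms] by (simp add: d_hilbert_def divide_le_eq)

text \<open>The estimates for powers of norms produce \<open>1 - m_ratio u v * m_ratio v u\<close>;
  the denominator of \<open>d_hilbert\<close> is at most 2, which converts this quantity into a
  distance.\<close>

lemma one_minus_m_ratio_prod_le:
  assumes "u \<in> simplex_S" "v \<in> simplex_S"
  shows "1 - m_ratio u v * m_ratio v u \<le> 2 * d_hilbert u v"
proof -
  let ?x = "m_ratio u v * m_ratio v u"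
  have x: "0 \<le> ?x" "?x \<le> 1" using m_ratio_prod[OF assms] by auto
  have "(1 - ?x) * (1 + ?x) \<le> (1 - ?x) * 2" using x by (intro mult_left_mono) auto
  then show ?thesis using x unfolding d_hilbert_def by (simp add: field_simps)
qed

lemma abs_diff_le_d_hilbert:
  fixes u v :: "real^'d"
  assumes "u \<in> simplex_S" "v \<in> simplex_S"
  shows "\<bar>u $ i - v $ i\<bar> \<le> 2 * d_hilbert u v"
proof -
  have *: "u $ i - v $ i \<le> 2 * d_hilbert u v" if "u \<in> simplex_S" "v \<in> simplex_S" for u v :: "real^'d"
  proof -
    have "u $ i - v $ i \<le> u $ i - m_ratio v u * u $ i"
      using m_ratio_mult_le[OF that(2,1), of i] by simp
    also have "\<dots> = (1 - m_ratio v u) * u $ i" by (simp add: algebra_simps)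
    also have "\<dots> \<le> (1 - m_ratio v u) * 1"
      using simplex_D[OF that(1)] m_ratio_le_1[OF that(2,1)] by (intro mult_left_mono) auto
    also have "\<dots> \<le> 2 * d_hilbert u v"
      using one_minus_m_ratio_prod_le[OF that] m_ratio_prod(4)[OF that] by simp
    finally show ?thesis .
  qed
  from *[OF assms] *[OF assms(2,1)] show ?thesis by (simp add: d_hilbert_commute abs_le_iff)
qed

text \<open>Domination of the Euclidean distance serves twice: it makes \<open>d_hilbert\<close>
  separate points, and it makes \<open>infdist\<close> Lipschitz, so that there are enough Lipschitz
  functions to represent a functional by a measure.\<close>

lemma norm_diff_le_d_hilbert:
  fixes u v :: "real^'d"
  assumes "u \<in> simplex_S" "v \<in> simplex_S"
  shows "dist u v \<le> 2 * real CARD('d) * d_hilbert u v"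
proof -
  have "dist u v \<le> (\<Sum>i\<in>UNIV. \<bar>(u - v) $ i\<bar>)" unfolding dist_norm by (rule norm_le_l1_cart)
  also have "\<dots> \<le> (\<Sum>i\<in>(UNIV::'d set). 2 * d_hilbert u v)"
    using abs_diff_le_d_hilbert[OF assms] by (intro sum_mono) auto
  finally show ?thesis by simp
qed

lemma d_hilbert_pos:
  assumes "u \<in> simplex_S" "v \<in> simplex_S" "u \<noteq> v"
  shows "0 < d_hilbert u v"
proof -
  have "0 < dist u v" using assms by simp
  with norm_diff_le_d_hilbert[OF assms(1,2)] have "d_hilbert u v \<noteq> 0" by auto
  then show ?thesis using d_hilbert_nonneg[OF assms(1,2)] by simp
qed

section \<open>Positive matrices acting on the simplex\<close>

lemma matrix_vector_mult_nonneg: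
  fixes h :: "real^'d^'d"
  assumes "\<And>i j. 0 \<le> h $ i $ j" "\<And>i. 0 \<le> x $ i"
  shows "0 \<le> (h *v x) $ i"
  using assms by (simp add: matrix_vector_mult_def sum_nonneg)

lemma pos_matrix_mult_pos:
  fixes h :: "real^'d^'d"
  assumes "pos_matrix h" "v \<in> simplex_S"
  shows "0 < (h *v v) $ i" "0 < vnorm (h *v v)"
proof -
  obtain j where j: "0 < v $ j"
    using simplex_D[OF assms(2)] by (metis less_eq_real_def sum.neutral zero_neq_one)
  show *: "0 < (h *v v) $ i" for i
    unfolding matrix_vector_mult_def
    using assms simplex_D(1)[OF assms(2)] j
    by (auto intro!: sum_pos2[of UNIV j] simp: pos_matrix_def less_imp_le)
  have "0 < (\<Sum>i\<in>UNIV. (h *v v) $ i)" using * by (intro sum_pos) auto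
  then show "0 < vnorm (h *v v)" using * by (simp add: vnorm_eq_sum less_imp_le)
qed

lemma act_nth: "act h v $ i = (h *v v) $ i / vnorm (h *v v)"
  by (simp add: act_def)

lemma act_in_simplex:
  assumes "pos_matrix h" "v \<in> simplex_S"
  shows "act h v \<in> simplex_S"
proof -
  have n: "0 \<le> act h v $ i" for i
    using pos_matrix_mult_pos[OF assms] by (simp add: act_nth less_imp_le)
  have "vnorm (act h v) = (\<Sum>i\<in>UNIV. (h *v v) $ i) / vnorm (h *v v)"
    using n by (simp add: vnorm_eq_sum act_nth sum_divide_distrib)
  also have "\<dots> = 1"
    using pos_matrix_mult_pos[OF assms] vnorm_eq_sum[of "h *v v"] by (simp add: less_imp_le)
  finally show ?thesis using n by (simp add: simplex_S_def)
qed

text \<open>The comparison functional \<open>l\<close> will be \<open>\<lambda>x. vnorm (h *v x)\<close> for matrices with comparable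
  entries in each column and \<open>vnorm\<close> for matrices with comparable entries in each row.\<close>

lemma d_hilbert_contraction:
  fixes h :: "real^'d^'d" and l :: "real^'d \<Rightarrow> real"
  assumes h: "pos_matrix h" and eta: "0 < \<eta>" "\<eta> \<le> 1"
    and l: "\<And>v. v \<in> simplex_S \<Longrightarrow> 0 < l v"
      "\<And>x y c. (\<And>i. 0 \<le> x $ i) \<Longrightarrow> (\<And>i. 0 \<le> y $ i) \<Longrightarrow> 0 \<le> c \<Longrightarrow> l (x + c *\<^sub>R y) = l x + c * l y"
    and cmp: "\<And>x y i. (\<And>i. 0 \<le> x $ i) \<Longrightarrow> y \<in> simplex_S \<Longrightarrow> \<eta> * l x * (h *v y) $ i \<le> (h *v x) $ i * l y"
    and u: "u \<in> simplex_S" and v: "v \<in> simplex_S"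
  shows "d_hilbert (act h u) (act h v) \<le> (1 - \<eta>\<^sup>2) * d_hilbert u v"
proof -
  \<comment> \<open>Split \<open>u = p + a v\<close> with \<open>a = m_ratio u v\<close> the largest
    multiple of \<open>v\<close> below \<open>u\<close>. The comparison hypothesis bounds
    \<open>h *v p\<close> from below by a multiple of \<open>h *v v\<close>, which replaces the
    factor \<open>a\<close> by a convex combination of \<open>a\<close> and
    \<open>l u / l v\<close>.\<close>
  have gen: "((1 - \<eta>) * m_ratio u v + \<eta> * (l u / l v)) * (h *v v) $ i \<le> (h *v u) $ i"
    if u: "u \<in> simplex_S" and v: "v \<in> simplex_S" for u v i
  proof -
    define a where "a = m_ratio u v"
    define p where "p = u - a *\<^sub>R v"
    have a: "0 \<le> a" using m_ratio_nonneg[OF u v] by (simp add: a_def)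
    have p: "0 \<le> p $ i" for i using m_ratio_mult_le[OF u v, of i] by (simp add: p_def a_def)
    have up: "u = p + a *\<^sub>R v" by (simp add: p_def)
    have lu: "l u = l p + a * l v" unfolding up using a p simplex_D(1)[OF v] by (intro l)
    have hu: "(h *v u) $ i = (h *v p) $ i + a * (h *v v) $ i" for i
      unfolding up by (simp add: matrix_vector_right_distrib matrix_vector_mult_scaleR)
    have "\<eta> * l p * (h *v v) $ i \<le> (h *v p) $ i * l v" using cmp p v by blast
    then have "\<eta> * (l p / l v) * (h *v v) $ i \<le> (h *v p) $ i"
      using l(1)[OF v] by (simp add: field_simps)
    moreover have "l p / l v = l u / l v - a" using lu l(1)[OF v] by (simp add: field_simps)
    ultimately have "\<eta> * (l u / l v - a) * (h *v v) $ i \<le> (h *v p) $ i" by simp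
    then show ?thesis unfolding hu a_def[symmetric] by (simp add: algebra_simps)
  qed
  have U: "act h u \<in> simplex_S" and V: "act h v \<in> simplex_S" using act_in_simplex h u v by auto
  define nu' nv where "nu' = vnorm (h *v u)" and "nv = vnorm (h *v v)"
  have np: "0 < nu'" "0 < nv" using pos_matrix_mult_pos h u v by (auto simp: nu'_def nv_def)
  define t where "t = l u / l v"
  have t: "0 < t" using l(1) u v by (simp add: t_def)
  define a b where "a = m_ratio u v" and "b = m_ratio v u"
  have ab: "0 \<le> a" "0 \<le> b" "a * b \<le> 1"
    using m_ratio_nonneg m_ratio_prod[OF u v] u v by (auto simp: a_def b_def)
  have A: "((1 - \<eta>) * a + \<eta> * t) * (nv / nu') \<le> m_ratio (act h u) (act h v)"
  proof (rule m_ratio_ge[OF U V])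
    show "0 \<le> ((1 - \<eta>) * a + \<eta> * t) * (nv / nu')" using ab t eta np by simp
    fix i
    show "((1 - \<eta>) * a + \<eta> * t) * (nv / nu') * act h v $ i \<le> act h u $ i"
      using gen[OF u v, of i] np unfolding act_nth nu'_def[symmetric] nv_def[symmetric] a_def t_def
      by (simp add: divide_right_mono)
  qed
  have B: "((1 - \<eta>) * b + \<eta> / t) * (nu' / nv) \<le> m_ratio (act h v) (act h u)"
  proof (rule m_ratio_ge[OF V U])
    show "0 \<le> ((1 - \<eta>) * b + \<eta> / t) * (nu' / nv)" using ab t eta np by simp
    fix i
    show "((1 - \<eta>) * b + \<eta> / t) * (nu' / nv) * act h u $ i \<le> act h v $ i"
      using gen[OF v u, of i] np unfolding act_nth nu'_def[symmetric] nv_def[symmetric] b_def t_def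
      by (simp add: divide_right_mono)
  qed
  define x x1 where "x = a * b" and "x1 = m_ratio (act h u) (act h v) * m_ratio (act h v) (act h u)"
  have x: "0 \<le> x" "x \<le> 1" using ab by (auto simp: x_def)
  have x1: "0 \<le> x1" "x1 \<le> 1" using m_ratio_prod[OF U V] by (auto simp: x1_def)
  \<comment> \<open>The product of \<open>a / t\<close> and \<open>b * t\<close> is \<open>x\<close>
    whatever \<open>t\<close> is, so AM-GM removes the unknown \<open>t\<close>;
    \<open>x \<le> 1\<close> then replaces the square root of \<open>x\<close> by
    \<open>x\<close>.\<close>
  have amgm: "2 * x \<le> a / t + b * t"
  proof -
    have "0 \<le> (a / t - b * t)\<^sup>2" by simp
    then have "4 * x \<le> (a / t + b * t)\<^sup>2" using t by (simp add: x_def power2_eq_square field_simps)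
    moreover have "4 * x\<^sup>2 \<le> 4 * x" using x by (simp add: power2_eq_square mult_left_le)
    ultimately have "(2 * x)\<^sup>2 \<le> (a / t + b * t)\<^sup>2" by (simp add: power_mult_distrib)
    then show ?thesis by (rule power2_le_imp_le) (use ab t in auto)
  qed
  \<comment> \<open>Multiplying the two lower bounds cancels the norms \<open>nu'\<close> and
    \<open>nv\<close>. The outcome is equivalent to
    \<open>1 - x1 \<le> (1 - \<eta>\<^sup>2) * (1 - x)\<close>, and it also gives
    \<open>x \<le> x1\<close>, which takes care of the denominators.\<close>
  have "(1 - \<eta>\<^sup>2) * x + \<eta>\<^sup>2 = (1 - \<eta>)\<^sup>2 * x + \<eta>\<^sup>2 + \<eta> * (1 - \<eta>) * (2 * x)"
    by (simp add: power2_eq_square algebra_simps)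
  also have "\<dots> \<le> (1 - \<eta>)\<^sup>2 * x + \<eta>\<^sup>2 + \<eta> * (1 - \<eta>) * (a / t + b * t)"
    using amgm eta by (intro add_left_mono mult_left_mono) auto
  also have "\<dots> = ((1 - \<eta>) * a + \<eta> * t) * ((1 - \<eta>) * b + \<eta> / t)"
    using t by (simp add: x_def power2_eq_square field_simps)
  also have "\<dots> = (((1 - \<eta>) * a + \<eta> * t) * (nv / nu')) * (((1 - \<eta>) * b + \<eta> / t) * (nu' / nv))"
    using np by simp
  also have "\<dots> \<le> x1"
    unfolding x1_def using A B ab t eta np m_ratio_nonneg[OF U V] by (intro mult_mono) auto
  finally have step: "(1 - \<eta>\<^sup>2) * x + \<eta>\<^sup>2 \<le> x1" .
  have e2: "0 \<le> \<eta>\<^sup>2" "\<eta>\<^sup>2 \<le> 1" using eta by (auto simp: power_le_one)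
  have "x \<le> (1 - \<eta>\<^sup>2) * x + \<eta>\<^sup>2"
    using mult_left_mono[OF x(2) e2(1)] by (simp add: algebra_simps)
  then have xx1: "x \<le> x1" using step by simp
  have "(1 - x1) / (1 + x1) \<le> (1 - \<eta>\<^sup>2) * (1 - x) / (1 + x)"
    using step xx1 x x1 e2 by (intro frac_le) (auto simp: algebra_simps)
  then show ?thesis
    by (simp add: d_hilbert_def x_def x1_def a_def b_def)
qed

subsection \<open>Representation of positive functionals on a lattice of continuous functions\<close>

text \<open>A Riesz representation for functionals given only on a lattice \<open>F\<close> of
  functions instead of all continuous ones: the limit functional to be represented is constructed on
  Lipschitz functions. Having \<open>infdist\<close> to every set in \<open>F\<close> replaces
  Urysohn's lemma. By \<open>L_mono\<close> only values on \<open>X\<close> matter, although open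
  sets are taken in the whole type.\<close>

locale positive_functional =
  fixes X :: "'a::metric_space set" and F :: "('a \<Rightarrow> real) set" and \<Lambda> :: "('a \<Rightarrow> real) \<Rightarrow> real"
  assumes compact_X: "compact X" and X_ne: "X \<noteq> {}"
    and F_cont: "f \<in> F \<Longrightarrow> continuous_on X f"
    and F_add: "f \<in> F \<Longrightarrow> g \<in> F \<Longrightarrow> (\<lambda>x. f x + g x) \<in> F"
    and F_scale: "f \<in> F \<Longrightarrow> (\<lambda>x. c * f x) \<in> F"
    and F_const: "(\<lambda>x. c) \<in> F"
    and F_max: "f \<in> F \<Longrightarrow> (\<lambda>x. max 0 (f x)) \<in> F"
    and F_infdist: "(\<lambda>x. infdist x S) \<in> F"
    and L_add: "f \<in> F \<Longrightarrow> g \<in> F \<Longrightarrow> \<Lambda> (\<lambda>x. f x + g x) = \<Lambda> f + \<Lambda> g"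
    and L_scale: "f \<in> F \<Longrightarrow> \<Lambda> (\<lambda>x. c * f x) = c * \<Lambda> f"
    and L_mono: "f \<in> F \<Longrightarrow> g \<in> F \<Longrightarrow> (\<And>x. x \<in> X \<Longrightarrow> f x \<le> g x) \<Longrightarrow> \<Lambda> f \<le> \<Lambda> g"
    and L_one: "\<Lambda> (\<lambda>x. 1) = 1"
begin

lemma F_diff: "f \<in> F \<Longrightarrow> g \<in> F \<Longrightarrow> (\<lambda>x. f x - g x) \<in> F"
  using F_add[of f "\<lambda>x. -1 * g x"] F_scale[of g "-1"] by simp

lemma F_min: assumes "f \<in> F" shows "(\<lambda>x. min 1 (f x)) \<in> F"
proof -
  have "(\<lambda>x. 1 - max 0 (1 - f x)) \<in> F" by (intro F_diff F_const F_max assms)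
  also have "(\<lambda>x. 1 - max 0 (1 - f x)) = (\<lambda>x. min 1 (f x))" by (auto simp: max_def min_def fun_eq_iff)
  finally show ?thesis .
qed

lemma L_diff: "f \<in> F \<Longrightarrow> g \<in> F \<Longrightarrow> \<Lambda> (\<lambda>x. f x - g x) = \<Lambda> f - \<Lambda> g"
  using L_add[of f "\<lambda>x. -1 * g x"] F_scale[of g "-1"] L_scale[of g "-1"] by simp

lemma L_const: "\<Lambda> (\<lambda>x. c) = c"
  using L_scale[OF F_const[of 1], of c] L_one by simp

lemma F_sum: "finite I \<Longrightarrow> (\<And>i. i \<in> I \<Longrightarrow> f i \<in> F) \<Longrightarrow> (\<lambda>x. \<Sum>i\<in>I. f i x) \<in> F"
  by (induction I rule: finite_induct) (auto simp: F_const F_add)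

lemma L_sum: "finite I \<Longrightarrow> (\<And>i. i \<in> I \<Longrightarrow> f i \<in> F) \<Longrightarrow> \<Lambda> (\<lambda>x. \<Sum>i\<in>I. f i x) = (\<Sum>i\<in>I. \<Lambda> (f i))"
  by (induction I rule: finite_induct) (auto simp: L_const F_sum L_add)

definition tests :: "'a set \<Rightarrow> ('a \<Rightarrow> real) set" where
  "tests U = {f \<in> F. (\<forall>x\<in>X. 0 \<le> f x \<and> f x \<le> 1) \<and> (\<forall>x\<in>X - U. f x = 0)}"

text \<open>The Riesz content of an open set; \<open>m_outer\<close> extends it to all sets as an
  outer measure, to which Caratheodory's construction applies.\<close>

definition m_open :: "'a set \<Rightarrow> ennreal" where
  "m_open U = (SUP f\<in>tests U. ennreal (\<Lambda> f))"

definition m_outer :: "'a set \<Rightarrow> ennreal" where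
  "m_outer A = (INF U\<in>{U. open U \<and> A \<subseteq> U}. m_open U)"

lemma tests_nonneg: "f \<in> tests U \<Longrightarrow> 0 \<le> \<Lambda> f"
  using L_mono[OF F_const[of 0], of f] by (auto simp: tests_def L_const)

lemma m_open_ge: "f \<in> tests U \<Longrightarrow> ennreal (\<Lambda> f) \<le> m_open U"
  unfolding m_open_def by (rule SUP_upper)

lemma m_open_mono: "U \<subseteq> V \<Longrightarrow> m_open U \<le> m_open V"
  unfolding m_open_def by (rule SUP_subset_mono) (auto simp: tests_def)

lemma m_outer_open: "open U \<Longrightarrow> m_outer U = m_open U"
  unfolding m_outer_def
  by (rule antisym) (auto intro!: INF_lower INF_greatest m_open_mono)

lemma m_outer_mono: "A \<subseteq> B \<Longrightarrow> m_outer A \<le> m_outer B"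
  unfolding m_outer_def by (rule INF_superset_mono) auto

lemma m_open_le_1: "m_open U \<le> 1"
  unfolding m_open_def
proof (rule SUP_least)
  fix f assume "f \<in> tests U"
  then have "\<Lambda> f \<le> 1" using L_mono[OF _ F_const[of 1], of f] by (auto simp: tests_def L_one)
  then show "ennreal (\<Lambda> f) \<le> 1" by simp
qed

lemma m_open_UNIV: "m_open UNIV = 1"
  using m_open_ge[of "\<lambda>x. 1" UNIV] m_open_le_1[of UNIV]
  by (auto simp: tests_def F_const L_one)

lemma m_open_compl: "m_open (- X) = 0"
proof -
  have "\<Lambda> f = 0" if "f \<in> tests (-X)" for f
    using that tests_nonneg[OF that] L_mono[OF _ F_const[of 0], of f] by (force simp: tests_def L_const)
  then have "m_open (-X) \<le> 0" unfolding m_open_def by (intro SUP_least) auto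
  then show ?thesis by simp
qed

lemma m_outer_empty: "m_outer {} = 0"
  using m_outer_mono[of "{}" "-X"] m_open_compl m_outer_open[of "-X"] compact_X
  by (simp add: compact_imp_closed open_Compl)

text \<open>For open \<open>U\<close> these functions increase to its indicator. The case
  \<open>UNIV\<close> is separate because \<open>infdist x {}\<close> is 0.\<close>

definition bump :: "'a set \<Rightarrow> nat \<Rightarrow> 'a \<Rightarrow> real" where
  "bump U N x = (if U = UNIV then 1 else min 1 (real N * infdist x (- U)))"

lemma bump_tests: "bump U N \<in> tests U"
proof (cases "U = UNIV")
  case True then show ?thesis by (auto simp: tests_def bump_def[abs_def] F_const)
next
  case False
  then show ?thesis
    unfolding tests_def bump_def[abs_def]
    by (auto simp: infdist_nonneg intro!: F_min F_scale F_infdist)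
qed

lemma bump_mono: assumes "N \<le> M" shows "bump U N x \<le> bump U M x"
proof -
  have "real N * infdist x (- U) \<le> real M * infdist x (- U)"
    using assms by (intro mult_right_mono infdist_nonneg) auto
  then show ?thesis by (simp add: bump_def min.coboundedI2)
qed

lemma bump_tendsto:
  assumes "open U" "x \<in> U" shows "\<exists>N. bump U N x = 1"
proof (cases "U = UNIV")
  case False
  then have "infdist x (-U) > 0"
    using assms infdist_pos_not_in_closed[of "-U" x] by (auto simp: closed_Compl)
  then obtain N where "1 < real N * infdist x (-U)" using reals_Archimedean3 by blast
  then show ?thesis using False by (auto simp: bump_def intro!: exI[of _ N])
qed (auto simp: bump_def)

text \<open>A Dini argument takes the place of a partition of unity. The sums \<open>p N\<close> of
  the first \<open>N\<close> bumps increase with \<open>N\<close> and eventually exceed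
  \<open>f x - e\<close> at each point of \<open>X\<close>; by compactness a single
  \<open>p N\<close> exceeds \<open>f - e\<close> on all of \<open>X\<close>.\<close>

lemma m_open_subadditive:
  assumes U: "\<And>i::nat. open (U i)"
  shows "m_open (\<Union>i. U i) \<le> (\<Sum>i. m_open (U i))"
  unfolding m_open_def[of "\<Union>i. U i"]
proof (rule SUP_least)
  fix f assume f: "f \<in> tests (\<Union>i. U i)"
  show "ennreal (\<Lambda> f) \<le> (\<Sum>i. m_open (U i))"
  proof (rule ennreal_le_epsilon)
    fix e :: real assume e: "0 < e"
    define p where "p N = (\<lambda>x. \<Sum>i<N. bump (U i) N x)" for N
    have pF: "p N \<in> F" for N
      unfolding p_def using bump_tests by (intro F_sum) (auto simp: tests_def)
    have pm: "p N x \<le> p M x" if "N \<le> M" "x \<in> X" for N M x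
    proof -
      have "p N x \<le> (\<Sum>i<N. bump (U i) M x)"
        unfolding p_def by (intro sum_mono bump_mono that)
      also have "\<dots> \<le> p M x" unfolding p_def
        using bump_tests that by (intro sum_mono2) (auto simp: tests_def)
      finally show ?thesis .
    qed
    have ex: "\<exists>N. f x < p N x + e" if x: "x \<in> X" for x
    proof (cases "x \<in> (\<Union>i. U i)")
      case True
      then obtain i where i: "x \<in> U i" by auto
      obtain N where N: "bump (U i) N x = 1" using bump_tendsto[OF U i] by auto
      define M where "M = max N (Suc i)"
      have "1 \<le> bump (U i) M x" using bump_mono[of N M "U i" x] N by (simp add: M_def)
      also have "\<dots> \<le> p M x" unfolding p_def
        using bump_tests x by (intro member_le_sum) (auto simp: tests_def M_def)
      finally show ?thesis using f x e by (intro exI[of _ M]) (force simp: tests_def)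
    next
      case False
      then have "f x = 0" using f x by (auto simp: tests_def)
      then show ?thesis using e by (intro exI[of _ 0]) (simp add: p_def)
    qed
    have "\<exists>N. \<forall>x\<in>X. f x < p N x + e"
    proof -
      have "\<exists>O'. open O' \<and> O' \<inter> X = {x\<in>X. f x - p N x < e}" for N
      proof -
        have "continuous_on X (\<lambda>x. f x - p N x)"
          using f by (intro F_cont F_diff pF) (auto simp: tests_def)
        from continuous_on_open_invariant[THEN iffD1, rule_format, OF this open_lessThan[of e]]
        obtain A where "open A" "A \<inter> X = (\<lambda>x. f x - p N x) -` {..<e} \<inter> X" by blast
        then show ?thesis by (intro exI[of _ A]) auto
      qed
      then obtain V where V: "\<And>N. open (V N)" "\<And>N. V N \<inter> X = {x\<in>X. f x - p N x < e}"
        by metis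
      have "X \<subseteq> (\<Union>N\<in>UNIV. V N)" using ex V(2) by (fastforce simp: algebra_simps)
      then obtain C where C: "finite C" "X \<subseteq> (\<Union>N\<in>C. V N)"
        using compactE_image[OF compact_X, of UNIV V] V(1) by metis
      define N where "N = Max (insert 0 C)"
      have "f x < p N x + e" if x: "x \<in> X" for x
      proof -
        obtain M where M: "M \<in> C" "x \<in> V M" using C x by blast
        have "M \<le> N" using M C by (simp add: N_def)
        moreover have "x \<in> {x\<in>X. f x - p M x < e}" using V(2)[of M] M(2) x by blast
        ultimately show ?thesis using pm[of M N x] x by auto
      qed
      then show ?thesis by auto
    qed
    then obtain N where N: "\<And>x. x \<in> X \<Longrightarrow> f x < p N x + e" by auto
    have "\<Lambda> f \<le> \<Lambda> (\<lambda>x. p N x + e)"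
      using f N by (intro L_mono F_add pF F_const) (auto simp: tests_def less_imp_le)
    also have "\<dots> = \<Lambda> (p N) + e" by (simp add: L_add pF F_const L_const)
    also have "\<Lambda> (p N) = (\<Sum>i<N. \<Lambda> (bump (U i) N))"
      unfolding p_def using bump_tests by (intro L_sum) (auto simp: tests_def)
    finally have "ennreal (\<Lambda> f) \<le> ennreal ((\<Sum>i<N. \<Lambda> (bump (U i) N)) + e)" by (rule ennreal_leI)
    also have "\<dots> = (\<Sum>i<N. ennreal (\<Lambda> (bump (U i) N))) + ennreal e"
      using tests_nonneg[OF bump_tests] e by (subst ennreal_plus) (auto simp: sum_nonneg)
    also have "(\<Sum>i<N. ennreal (\<Lambda> (bump (U i) N))) \<le> (\<Sum>i<N. m_open (U i))"
      by (intro sum_mono m_open_ge bump_tests)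
    also have "(\<Sum>i<N. m_open (U i)) \<le> (\<Sum>i. m_open (U i))"
      by (rule sum_le_suminf) auto
    finally show "ennreal (\<Lambda> f) \<le> (\<Sum>i. m_open (U i)) + ennreal e" by (simp add: add_right_mono)
  qed
qed

lemma m_outer_subadditive: "m_outer (\<Union>i. A i) \<le> (\<Sum>i. m_outer (A i))" for A :: "nat \<Rightarrow> 'a set"
proof (rule ennreal_le_epsilon)
  fix e :: real assume e: "0 < e"
  have fin: "m_outer B < \<top>" for B
    using m_outer_mono[of B UNIV] m_outer_open[of UNIV] m_open_UNIV by (auto simp: less_top[symmetric] top_unique)
  have "\<exists>U. open U \<and> A i \<subseteq> U \<and> m_open U \<le> m_outer (A i) + ennreal (e * (1/2)^Suc i)" for i
  proof -
    have "m_outer (A i) < m_outer (A i) + ennreal (e * (1/2)^Suc i)"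
      using fin[of "A i"] e by (auto simp: ennreal_add_left_cancel_less[of _ 0, simplified])
    then show ?thesis unfolding m_outer_def[of "A i"] INF_less_iff by (force intro: less_imp_le)
  qed
  then obtain U where U: "\<And>i. open (U i)" "\<And>i. A i \<subseteq> U i"
    "\<And>i. m_open (U i) \<le> m_outer (A i) + ennreal (e * (1/2)^Suc i)" by metis
  have "m_outer (\<Union>i. A i) \<le> m_outer (\<Union>i. U i)" using U(2) by (intro m_outer_mono) auto
  also have "\<dots> = m_open (\<Union>i. U i)" using U(1) by (intro m_outer_open) auto
  also have "\<dots> \<le> (\<Sum>i. m_open (U i))" using U(1) by (rule m_open_subadditive)
  also have "\<dots> \<le> (\<Sum>i. m_outer (A i) + ennreal (e * (1/2)^Suc i))"
    using U(3) by (intro suminf_le) auto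
  also have "\<dots> = (\<Sum>i. m_outer (A i)) + (\<Sum>i. ennreal (e * (1/2)^Suc i))"
    by (rule suminf_add[symmetric]) auto
  also have "(\<Sum>i. ennreal (e * (1/2)^Suc i)) = ennreal e"
  proof -
    have "(\<lambda>i. e * (1/2)^Suc i) sums (e * 1)" by (intro sums_mult power_half_series)
    then show ?thesis using e by (subst suminf_ennreal_eq[where x=e]) auto
  qed
  finally show "m_outer (\<Union>i. A i) \<le> (\<Sum>i. m_outer (A i)) + ennreal e" .
qed

lemma m_outer_Un: "m_outer (A \<union> B) \<le> m_outer A + m_outer B"
proof -
  have "m_outer (\<Union>i. (\<lambda>i::nat. if i = 0 then A else if i = 1 then B else {}) i)
      \<le> (\<Sum>i. m_outer ((\<lambda>i::nat. if i = 0 then A else if i = 1 then B else {}) i))"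
    by (rule m_outer_subadditive)
  also have "(\<Union>i. (\<lambda>i::nat. if i = 0 then A else if i = 1 then B else {}) i) = A \<union> B"
    by (auto split: if_splits)
  also have "(\<Sum>i. m_outer ((\<lambda>i::nat. if i = 0 then A else if i = 1 then B else {}) i))
     = (\<Sum>i\<in>{0,1}. m_outer ((\<lambda>i::nat. if i = 0 then A else if i = 1 then B else {}) i))"
    by (intro suminf_finite) (auto simp: m_outer_empty)
  finally show ?thesis by simp
qed

text \<open>The Caratheodory condition is first checked on open sets \<open>U\<close>. Test
  functions for \<open>U \<inter> V\<close> and for a neighbourhood of \<open>U - V\<close> cannot
  simply be added, since their sum may exceed 1; cutting the first one off at a small height
  separates the two.\<close>

lemma open_lambda_system:
  assumes V: "open V"
  shows "V \<in> lambda_system UNIV UNIV m_outer"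
proof -
  have open_case: "m_outer (U \<inter> V) + m_outer (U - V) \<le> m_open U" if U: "open U" for U
  proof (rule ennreal_le_epsilon)
    fix e :: real assume e: "0 < e"
    have "m_outer (U - V) \<le> m_open (U - C) " if "closed C" "C \<subseteq> V" for C
      using that m_outer_mono[of "U - V" "U - C"] m_outer_open[of "U - C"] U by (auto simp: open_Diff)
    have main: "ennreal (\<Lambda> f) + m_outer (U - V) \<le> m_open U + ennreal e" if f: "f \<in> tests (U \<inter> V)" for f
    proof -
      have fF: "f \<in> F" using f by (simp add: tests_def)
      \<comment> \<open>The cut costs at most \<open>e\<close> in \<open>\<Lambda>\<close> and
        confines \<open>f'\<close> to the closed set \<open>C\<close> inside \<open>V\<close>. A
        test function for the open set \<open>U - C\<close>, which contains \<open>U - V\<close>,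
        vanishes on \<open>C\<close>, so adding it to \<open>f'\<close> stays within [0, 1].\<close>
      define f' where "f' = (\<lambda>x. max 0 (f x - e))"
      define C where "C = {x\<in>X. e \<le> f x}"
      have "closed C" unfolding C_def
        using continuous_on_closed_Collect_le[OF continuous_on_const F_cont[OF fF]] compact_imp_closed[OF compact_X]
        by blast
      have CV: "C \<subseteq> U \<inter> V" using f e by (force simp: C_def tests_def)
      have f'F: "f' \<in> F" unfolding f'_def by (intro F_max F_diff fF F_const)
      have "\<Lambda> f \<le> \<Lambda> (\<lambda>x. f' x + e)"
        by (intro L_mono F_add f'F fF F_const) (auto simp: f'_def)
      then have le: "\<Lambda> f \<le> \<Lambda> f' + e" by (simp add: L_add f'F F_const L_const)
      have f't: "f' \<in> tests U" using f e f'F CV by (force simp: tests_def f'_def)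
      have "ennreal (\<Lambda> f') + m_open (U - C) \<le> m_open U"
        unfolding m_open_def[of "U - C"]
      proof -
        have "tests (U - C) \<noteq> {}" using bump_tests by blast
        then have "ennreal (\<Lambda> f') + (SUP h\<in>tests (U - C). ennreal (\<Lambda> h))
            = (SUP h\<in>tests (U - C). ennreal (\<Lambda> f') + ennreal (\<Lambda> h))"
          by (rule ennreal_SUP_add_right)
        moreover
        have "(SUP h\<in>tests (U - C). ennreal (\<Lambda> f') + ennreal (\<Lambda> h)) \<le> m_open U"
        proof (rule SUP_least)
          fix h assume h: "h \<in> tests (U - C)"
          have "(\<lambda>x. f' x + h x) \<in> tests U"
          proof -
            have "0 \<le> f' x + h x \<and> f' x + h x \<le> 1" if "x \<in> X" for x
              using that h f't by (cases "x \<in> C") (auto simp: tests_def C_def f'_def)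
            then show ?thesis using h f't by (auto simp: tests_def F_add)
          qed
          then have "ennreal (\<Lambda> (\<lambda>x. f' x + h x)) \<le> m_open U" by (rule m_open_ge)
          then show "ennreal (\<Lambda> f') + ennreal (\<Lambda> h) \<le> m_open U"
            using h f'F tests_nonneg[OF f't] tests_nonneg[OF h] by (simp add: L_add tests_def)
        qed
        ultimately show "ennreal (\<Lambda> f') + (SUP h\<in>tests (U - C). ennreal (\<Lambda> h)) \<le> m_open U" by simp
      qed
      moreover have "m_outer (U - V) \<le> m_open (U - C)"
        using CV m_outer_mono[of "U - V" "U - C"] m_outer_open[of "U - C"] U \<open>closed C\<close> by (auto simp: open_Diff)
      moreover have "ennreal (\<Lambda> f) \<le> ennreal (\<Lambda> f') + ennreal e"
        using le tests_nonneg[OF f't] e by (simp flip: ennreal_plus add: ennreal_leI)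
      ultimately show ?thesis
      proof -
        assume 1: "ennreal (\<Lambda> f') + m_open (U - C) \<le> m_open U"
          and 2: "m_outer (U - V) \<le> m_open (U - C)"
          and 3: "ennreal (\<Lambda> f) \<le> ennreal (\<Lambda> f') + ennreal e"
        have "ennreal (\<Lambda> f) + m_outer (U - V) \<le> (ennreal (\<Lambda> f') + ennreal e) + m_open (U - C)"
          by (intro add_mono 2 3)
        also have "\<dots> = (ennreal (\<Lambda> f') + m_open (U - C)) + ennreal e" by (simp add: ac_simps)
        also have "\<dots> \<le> m_open U + ennreal e" by (intro add_right_mono 1)
        finally show ?thesis .
      qed
    qed
    have "m_outer (U \<inter> V) + m_outer (U - V) = (SUP f\<in>tests (U \<inter> V). ennreal (\<Lambda> f)) + m_outer (U - V)"
      using U V by (simp add: m_outer_open open_Int m_open_def)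
    also have "\<dots> = (SUP f\<in>tests (U \<inter> V). ennreal (\<Lambda> f) + m_outer (U - V))"
      using bump_tests by (intro ennreal_SUP_add_left[symmetric]) blast
    also have "\<dots> \<le> m_open U + ennreal e" by (intro SUP_least main)
    finally show "m_outer (U \<inter> V) + m_outer (U - V) \<le> m_open U + ennreal e" .
  qed
  have "m_outer (V \<inter> A) + m_outer ((UNIV - V) \<inter> A) = m_outer A" for A
  proof (rule antisym)
    show "m_outer (V \<inter> A) + m_outer ((UNIV - V) \<inter> A) \<le> m_outer A"
      unfolding m_outer_def[of A]
    proof (rule INF_greatest)
      fix U assume "U \<in> {U. open U \<and> A \<subseteq> U}"
      then have U: "open U" "A \<subseteq> U" by auto
      have "m_outer (V \<inter> A) + m_outer ((UNIV - V) \<inter> A) \<le> m_outer (U \<inter> V) + m_outer (U - V)"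
        using U by (intro add_mono m_outer_mono) auto
      also have "\<dots> \<le> m_open U" by (rule open_case[OF U(1)])
      finally show "m_outer (V \<inter> A) + m_outer ((UNIV - V) \<inter> A) \<le> m_open U" .
    qed
    show "m_outer A \<le> m_outer (V \<inter> A) + m_outer ((UNIV - V) \<inter> A)"
    proof -
      have "A = (V \<inter> A) \<union> ((UNIV - V) \<inter> A)" by blast
      then show ?thesis using m_outer_Un[of "V \<inter> A" "(UNIV - V) \<inter> A"] by simp
    qed
  qed
  then show ?thesis by (simp add: lambda_system_def)
qed

section \<open>The representing measure and its integrals\<close>

definition rep_measure :: "'a measure" where
  "rep_measure = measure_of UNIV (sets borel) m_outer"

lemma measure_space_m_outer: "measure_space UNIV (sets borel) m_outer"
proof -
  interpret P: sigma_algebra UNIV "Pow UNIV :: 'a set set" by (rule sigma_algebra_Pow)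
  have "outer_measure_space (Pow UNIV) m_outer"
    unfolding outer_measure_space_def positive_def increasing_def countably_subadditive_def
    using m_outer_empty m_outer_mono m_outer_subadditive by auto
  then have ms: "measure_space UNIV (lambda_system UNIV (Pow UNIV) m_outer) m_outer"
    by (rule P.caratheodory_lemma)
  then have sa: "sigma_algebra UNIV (lambda_system UNIV (Pow UNIV) m_outer)"
    by (simp add: measure_space_def)
  have "sets borel \<subseteq> lambda_system UNIV (Pow UNIV) m_outer"
    unfolding borel_def
    using open_lambda_system sigma_algebra.sigma_sets_subset[OF sa, of "{S. open S}"] by auto
  then show ?thesis
    by (rule measure_down[OF ms, rotated]) (use sets.sigma_algebra_axioms[of "borel::'a measure"] in simp)
qed

lemma sets_rep_measure [simp, measurable_cong]: "sets rep_measure = sets borel"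
  unfolding rep_measure_def by (metis sets.sigma_sets_eq sets_measure_of space_borel subset_UNIV Pow_UNIV sets.space_closed)

lemma space_rep_measure [simp]: "space rep_measure = UNIV"
  using sets_eq_imp_space_eq[OF sets_rep_measure] by simp

lemma emeasure_rep_measure: "A \<in> sets borel \<Longrightarrow> emeasure rep_measure A = m_outer A"
  using measure_space_m_outer unfolding measure_space_def
  by (intro emeasure_measure_of[OF rep_measure_def]) auto

lemma prob_space_rep_measure: "prob_space rep_measure"
  by (rule prob_spaceI) (simp add: emeasure_rep_measure m_outer_open m_open_UNIV)

lemma AE_rep_measure: "AE x in rep_measure. x \<in> X"
proof (rule AE_I)
  show "emeasure rep_measure (-X) = 0"
    using compact_imp_closed[OF compact_X]
    by (subst emeasure_rep_measure) (auto simp: m_outer_open open_Compl m_open_compl)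
qed (use compact_imp_closed[OF compact_X] in auto)

lemma borel_X [measurable]: "X \<in> sets borel"
  using compact_imp_closed[OF compact_X] by (rule borel_closed)

lemma measurable_indicator_X:
  fixes f :: "'a \<Rightarrow> real"
  assumes "continuous_on X f" shows "(\<lambda>x. indicator X x * f x) \<in> borel_measurable borel"
  using borel_measurable_continuous_on_indicator[OF borel_X assms] by simp

lemma integrable_rep:
  assumes "continuous_on X f"
  shows "integrable rep_measure (\<lambda>x. indicator X x * (f x :: real))"
proof -
  interpret R: prob_space rep_measure by (rule prob_space_rep_measure)
  have "bounded (f ` X)" using compact_continuous_image[OF assms compact_X] by (rule compact_imp_bounded)
  then obtain B where "\<And>x. x \<in> X \<Longrightarrow> \<bar>f x\<bar> \<le> B" by (auto simp: bounded_iff)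
  moreover have "0 \<le> max B 0" by simp
  ultimately show ?thesis
    using measurable_indicator_X[OF assms]
    by (intro R.integrable_const_bound[of _ "max B 0"]) (auto simp: indicator_def le_max_iff_disj)
qed

text \<open>A layer-cake argument. \<open>n * f\<close> is the sum of the slices \<open>g i\<close>;
  each slice is a test function for an open set whose trace on \<open>X\<close> is
  \<open>V i\<close>, and a point lies in at most \<open>n * f x + 1\<close> of the sets
  \<open>V i\<close>. The excess 1 becomes \<open>1 / n\<close> after division.\<close>

lemma integral_rep_le:
  assumes f: "f \<in> F" and r: "\<And>x. x \<in> X \<Longrightarrow> 0 \<le> f x \<and> f x \<le> 1"
  shows "\<Lambda> f \<le> (\<integral>x. indicator X x * f x \<partial>rep_measure)"
proof (rule field_le_epsilon)
  interpret R: prob_space rep_measure by (rule prob_space_rep_measure)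
  fix e :: real assume e: "0 < e"
  obtain n' where n': "inverse (real (Suc n')) < e" using reals_Archimedean[OF e] by auto
  define n where "n = Suc n'"
  have n: "0 < n" "1 / n < e" using n' by (auto simp: n_def inverse_eq_divide)
  define g where "g i = (\<lambda>x. min 1 (max 0 (real n * f x - real i)))" for i
  define V where "V i = {x\<in>X. real i / n < f x}" for i
  have fm [measurable]: "(\<lambda>x. indicator X x * f x) \<in> borel_measurable borel"
    by (rule measurable_indicator_X[OF F_cont[OF f]])
  have Veq: "V i = {x. real i / n < indicator X x * f x} " for i
  proof -
    have "0 \<le> real i / n" by simp
    then have "\<not> real i / n < 0" by linarith
    then show ?thesis unfolding V_def by (intro set_eqI) (simp add: indicator_def)
  qed
  have Vm [measurable]: "V i \<in> sets borel" for i unfolding Veq by measurable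
  have gF: "g i \<in> F" for i
    unfolding g_def by (intro F_min F_max F_diff F_scale F_const f)
  have Lg: "\<Lambda> (g i) \<le> measure rep_measure (V i)" for i
  proof -
    have "\<exists>U. open U \<and> U \<inter> X = V i"
    proof -
      from continuous_on_open_invariant[THEN iffD1, rule_format, OF F_cont[OF f] open_greaterThan[of "real i / n"]]
      obtain A where "open A" "A \<inter> X = f -` {real i / n<..} \<inter> X" by blast
      then show ?thesis by (intro exI[of _ A]) (auto simp: V_def)
    qed
    then obtain U where U: "open U" "U \<inter> X = V i" by auto
    have "f x \<le> real i / n" if "x \<in> X" "x \<notin> U" for x
    proof -
      have "x \<notin> V i" using that U(2) by blast
      then show ?thesis using that by (simp add: V_def)
    qed
    then have "g i x = 0" if "x \<in> X" "x \<notin> U" for x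
      using that n by (force simp: g_def field_simps)
    then have "g i \<in> tests U" using gF by (auto simp: tests_def g_def)
    then have "ennreal (\<Lambda> (g i)) \<le> emeasure rep_measure U"
      using U m_open_ge by (simp add: emeasure_rep_measure m_outer_open)
    also have "emeasure rep_measure U = emeasure rep_measure (V i)"
      using AE_rep_measure U by (intro emeasure_eq_AE) (auto elim!: eventually_mono)
    finally show ?thesis by (simp add: R.emeasure_eq_measure)
  qed
  have fsum: "real n * f x = (\<Sum>i<n. g i x)" if x: "x \<in> X" for x
  proof -
    have "(\<Sum>i<m. min 1 (max 0 (y - real i))) = min (real m) (max 0 y)" for y m
      by (induction m) (auto simp: min_def max_def)
    from this[of "real n * f x" n] show ?thesis
      using r[OF x] n by (simp add: g_def mult_left_le)
  qed
  have "real n * \<Lambda> f = \<Lambda> (\<lambda>x. \<Sum>i<n. g i x)"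
    unfolding L_scale[OF f, symmetric]
    using fsum by (intro antisym L_mono F_scale F_sum f gF) auto
  also have "\<dots> = (\<Sum>i<n. \<Lambda> (g i))" by (intro L_sum gF) auto
  also have "\<dots> \<le> (\<Sum>i<n. measure rep_measure (V i))" by (intro sum_mono Lg)
  also have "\<dots> = (\<integral>x. (\<Sum>i<n. indicator (V i) x) \<partial>rep_measure)"
    by (subst Bochner_Integration.integral_sum) (auto simp: R.emeasure_eq_measure)
  also have "\<dots> \<le> (\<integral>x. real n * (indicator X x * f x) + 1 \<partial>rep_measure)"
  proof (rule integral_mono)
    show "integrable rep_measure (\<lambda>x. \<Sum>i<n. indicator (V i) x :: real)"
      by (auto intro!: Bochner_Integration.integrable_sum simp: R.emeasure_eq_measure)
    have "integrable rep_measure (\<lambda>x. indicator X x * f x)"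
      by (rule integrable_rep[OF F_cont[OF f]])
    then show "integrable rep_measure (\<lambda>x. real n * (indicator X x * f x) + 1)" by auto
    fix x
    show "(\<Sum>i<n. indicator (V i) x) \<le> real n * (indicator X x * f x) + 1"
    proof (cases "x \<in> X")
      case True
      have "(\<Sum>i<n. indicator (V i) x) = (\<Sum>i<n. if real i < real n * f x then 1 else 0::real)"
        using True n by (intro sum.cong) (auto simp: V_def indicator_def field_simps)
      also have "\<dots> \<le> real n * f x + 1"
      proof -
        have "(\<Sum>i<m. if real i < y then 1 else 0::real) \<le> y + 1" if "0 \<le> y" for y m
        proof -
          have "(\<Sum>i<m. if real i < y then 1 else 0::real) \<le> min (real m) (y + 1)"
            using that by (induction m) auto
          then show ?thesis by simp
        qed
        then show ?thesis using r[OF True] by simp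
      qed
      finally show ?thesis using True by simp
    qed (simp add: V_def)
  qed
  also have "\<dots> = real n * (\<integral>x. indicator X x * f x \<partial>rep_measure) + 1"
  proof -
    have "integrable rep_measure (\<lambda>x. indicator X x * f x)"
      by (rule integrable_rep[OF F_cont[OF f]])
    then show ?thesis using R.prob_space by simp
  qed
  finally have "\<Lambda> f \<le> (\<integral>x. indicator X x * f x \<partial>rep_measure) + 1 / n"
    using n by (simp add: field_simps)
  then show "\<Lambda> f \<le> (\<integral>x. indicator X x * f x \<partial>rep_measure) + e" using n by simp
qed

text \<open>The one-sided estimate for \<open>f\<close> and for \<open>1 - f\<close> gives equality
  when the values lie in [0, 1]; an affine change brings any \<open>f\<close> into that
  range.\<close>

theorem integral_rep:
  assumes f: "f \<in> F"
  shows "(\<integral>x. indicator X x * f x \<partial>rep_measure) = \<Lambda> f"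
proof -
  interpret R: prob_space rep_measure by (rule prob_space_rep_measure)
  note int = integrable_rep[OF F_cont]
  have X1: "(\<integral>x. indicator X x \<partial>rep_measure) = (1::real)"
    using R.prob_eq_1[of X] AE_rep_measure by simp
  have eq: "(\<integral>x. indicator X x * g x \<partial>rep_measure) = \<Lambda> g"
    if g: "g \<in> F" and r: "\<And>x. x \<in> X \<Longrightarrow> 0 \<le> g x \<and> g x \<le> 1" for g
  proof -
    have "\<Lambda> (\<lambda>x. 1 - g x) \<le> (\<integral>x. indicator X x * (1 - g x) \<partial>rep_measure)"
      using r by (intro integral_rep_le F_diff F_const g) auto
    also have "\<dots> = 1 - (\<integral>x. indicator X x * g x \<partial>rep_measure)"
      using int[OF g] int[OF F_const[of 1]] by (simp add: right_diff_distrib X1[simplified])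
    finally show ?thesis
      using integral_rep_le[OF g r] by (simp add: L_diff F_const g L_const)
  qed
  have "bounded (f ` X)" using compact_continuous_image[OF F_cont[OF f] compact_X] by (rule compact_imp_bounded)
  then obtain B where "\<And>x. x \<in> X \<Longrightarrow> \<bar>f x\<bar> \<le> B" by (auto simp: bounded_iff)
  then have B: "\<And>x. x \<in> X \<Longrightarrow> \<bar>f x\<bar> \<le> max B 1" by (simp add: le_max_iff_disj)
  define b where "b = max B 1"
  have b: "0 < b" "\<And>x. x \<in> X \<Longrightarrow> \<bar>f x\<bar> \<le> b" using B by (auto simp: b_def)
  define g where "g = (\<lambda>x. (1 / (2 * b)) * f x + 1 / 2)"
  have gF: "g \<in> F" unfolding g_def by (intro F_add F_scale F_const f)
  have "(\<integral>x. indicator X x * g x \<partial>rep_measure) = \<Lambda> g"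
    using b by (intro eq gF) (force simp: g_def field_simps abs_le_iff)
  moreover have "\<Lambda> g = (1 / (2 * b)) * \<Lambda> f + 1 / 2"
    unfolding g_def using L_add[OF F_scale[OF f, of "1 / (2 * b)"] F_const[of "1/2"]] L_scale[OF f, of "1 / (2 * b)"]
    by (simp add: L_const)
  moreover have "(\<integral>x. indicator X x * g x \<partial>rep_measure)
      = (1 / (2 * b)) * (\<integral>x. indicator X x * f x \<partial>rep_measure) + 1 / 2"
  proof -
    have "(\<lambda>x. indicator X x * g x) = (\<lambda>x. (1 / (2 * b)) * (indicator X x * f x) + 1 / 2 * indicator X x)"
      by (simp add: g_def fun_eq_iff algebra_simps)
    then show ?thesis using int[OF f] int[OF F_const[of 1]] by (simp add: X1[simplified])
  qed
  ultimately show ?thesis using b by simp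
qed

end

lemma integral_norm_bound_AE:
  fixes f :: "'a \<Rightarrow> real"
  assumes "integrable M f" "integrable M h" "AE x in M. norm (f x) \<le> h x"
  shows "norm (\<integral>x. f x \<partial>M) \<le> (\<integral>x. h x \<partial>M)"
proof -
  have "norm (\<integral>x. f x \<partial>M) \<le> (\<integral>x. norm (f x) \<partial>M)" by (rule integral_norm_bound)
  also have "\<dots> \<le> (\<integral>x. h x \<partial>M)" using assms by (intro integral_mono_AE) auto
  finally show ?thesis .
qed

subsection \<open>Contracting transfer operators\<close>

text \<open>\<open>X\<close> attracts \<open>Y\<close> in one step. Log-Lipschitz bounds are required of the weights on \<open>X\<close> only,
  since they may fail up to the boundary of the simplex \<open>Y\<close>.\<close>

locale contracting_transfer = prob_space \<mu>
  for \<mu> :: "'g measure" +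
  fixes X Y :: "'a::metric_space set" and T :: "'g \<Rightarrow> 'a \<Rightarrow> 'a" and w :: "'g \<Rightarrow> 'a \<Rightarrow> real"
    and W :: "'g \<Rightarrow> real" and \<delta> :: "'a \<Rightarrow> 'a \<Rightarrow> real" and c L D :: real and good :: "'g \<Rightarrow> bool"
  assumes compact_X: "compact X" and compact_Y: "compact Y" and XY: "X \<subseteq> Y" and X_ne: "X \<noteq> {}"
    and T_meas: "v \<in> Y \<Longrightarrow> (\<lambda>g. T g v) \<in> borel_measurable \<mu>"
    and w_meas: "v \<in> Y \<Longrightarrow> (\<lambda>g. w g v) \<in> borel_measurable \<mu>"
    and W_int: "integrable \<mu> W"
    and AE_good: "AE g in \<mu>. good g"
    and T_X: "good g \<Longrightarrow> v \<in> Y \<Longrightarrow> T g v \<in> X"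
    and T_cont: "good g \<Longrightarrow> continuous_on Y (T g)"
    and w_cont: "good g \<Longrightarrow> continuous_on Y (w g)"
    and w_pos: "good g \<Longrightarrow> v \<in> Y \<Longrightarrow> 0 < w g v"
    and w_le: "good g \<Longrightarrow> v \<in> Y \<Longrightarrow> w g v \<le> W g"
    and T_contr: "good g \<Longrightarrow> u \<in> Y \<Longrightarrow> v \<in> Y \<Longrightarrow> \<delta> (T g u) (T g v) \<le> c * \<delta> u v"
    and w_lip: "good g \<Longrightarrow> u \<in> Y \<Longrightarrow> v \<in> Y \<Longrightarrow> \<bar>w g u - w g v\<bar> \<le> W g * L * \<delta> u v"
    and w_log: "good g \<Longrightarrow> u \<in> X \<Longrightarrow> v \<in> X \<Longrightarrow> w g u \<le> exp (L * \<delta> u v) * w g v"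
    and \<delta>_nonneg: "u \<in> Y \<Longrightarrow> v \<in> Y \<Longrightarrow> 0 \<le> \<delta> u v"
    and \<delta>_le_1: "u \<in> Y \<Longrightarrow> v \<in> Y \<Longrightarrow> \<delta> u v \<le> 1"
    and \<delta>_sym: "\<delta> u v = \<delta> v u"
    and dist_le: "u \<in> Y \<Longrightarrow> v \<in> Y \<Longrightarrow> dist u v \<le> D * \<delta> u v"
    and c: "0 \<le> c" "c < 1" and L: "0 \<le> L"
begin

definition CY :: "('a \<Rightarrow> real) set" where
  "CY = {f. continuous_on Y f \<and> (\<forall>v. v \<notin> Y \<longrightarrow> f v = 0)}"

definition P :: "('a \<Rightarrow> real) \<Rightarrow> 'a \<Rightarrow> real" where
  "P f v = (if v \<in> Y then (\<integral>g. w g v * f (T g v) \<partial>\<mu>) else 0)"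

definition one :: "'a \<Rightarrow> real" where "one = indicator Y"

definition Wbar :: real where "Wbar = (\<integral>g. W g \<partial>\<mu>)"

lemma inY: "x \<in> X \<Longrightarrow> x \<in> Y" using XY by auto

lemma Y_ne: "Y \<noteq> {}" using X_ne XY by auto

lemma borel_Y [measurable]: "Y \<in> sets borel"
  using compact_imp_closed[OF compact_Y] by (rule borel_closed)

lemma CY_cont: "f \<in> CY \<Longrightarrow> continuous_on Y f" by (simp add: CY_def)

lemma CY_out: "f \<in> CY \<Longrightarrow> v \<notin> Y \<Longrightarrow> f v = 0" by (simp add: CY_def)

lemma CY_eq_indicator: "f \<in> CY \<Longrightarrow> f = (\<lambda>x. indicator Y x * f x)"
  by (auto simp: CY_def indicator_def fun_eq_iff)

lemma CY_meas: "f \<in> CY \<Longrightarrow> f \<in> borel_measurable borel"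
  using borel_measurable_continuous_on_indicator[OF borel_Y CY_cont, of f] CY_eq_indicator[of f]
  by (metis (mono_tags, lifting) measurable_cong real_scaleR_def)

lemma CY_bdd: assumes "f \<in> CY" shows "\<exists>B>0. \<forall>v. \<bar>f v\<bar> \<le> B"
proof -
  have "bounded (f ` Y)"
    using compact_continuous_image[OF CY_cont[OF assms] compact_Y] by (rule compact_imp_bounded)
  then obtain B where B: "\<And>v. v \<in> Y \<Longrightarrow> \<bar>f v\<bar> \<le> B" by (auto simp: bounded_iff)
  have "\<bar>f v\<bar> \<le> max B 1" for v
    using B[of v] CY_out[OF assms, of v] by (cases "v \<in> Y") (auto simp: le_max_iff_disj)
  then show ?thesis by (intro exI[of _ "max B 1"]) auto
qed

lemma CY_add: "f \<in> CY \<Longrightarrow> h \<in> CY \<Longrightarrow> (\<lambda>x. f x + h x) \<in> CY"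
  and CY_diff: "f \<in> CY \<Longrightarrow> h \<in> CY \<Longrightarrow> (\<lambda>x. f x - h x) \<in> CY"
  and CY_scale: "f \<in> CY \<Longrightarrow> (\<lambda>x. b * f x) \<in> CY"
  by (auto simp: CY_def intro!: continuous_intros)

lemma CY_one: "one \<in> CY"
proof -
  have "continuous_on Y (indicator Y :: 'a \<Rightarrow> real)"
    by (subst continuous_on_cong[OF refl, of _ _ "\<lambda>x. 1"]) auto
  then show ?thesis by (simp add: CY_def one_def)
qed

lemma W_nonneg: "good g \<Longrightarrow> 0 \<le> W g"
  using X_ne w_pos[of g] w_le[of g] inY by (metis all_not_in_conv less_imp_le order_trans)

lemma Wbar_nonneg: "0 \<le> Wbar"
  unfolding Wbar_def using AE_good by (intro integral_nonneg_AE) (auto elim!: eventually_mono simp: W_nonneg)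

lemma meas_T: assumes "f \<in> CY" "v \<in> Y" shows "(\<lambda>g. w g v * f (T g v)) \<in> borel_measurable \<mu>"
proof -
  have "(\<lambda>g. f (T g v)) \<in> borel_measurable \<mu>"
    by (rule measurable_compose[OF T_meas[OF assms(2)] CY_meas[OF assms(1)]])
  then show ?thesis using w_meas[OF assms(2)] by simp
qed

text \<open>Only values on \<open>X\<close> count, because \<open>T g v\<close> lies in
  \<open>X\<close> for every \<open>v\<close> in \<open>Y\<close>. The bounds for \<open>P f\<close>
  on \<open>Y\<close> inherit this.\<close>

lemma AE_w_bound:
  assumes "v \<in> Y" "\<And>x. x \<in> X \<Longrightarrow> \<bar>f x\<bar> \<le> B"
  shows "AE g in \<mu>. norm (w g v * f (T g v)) \<le> W g * B"
  using AE_good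
proof eventually_elim
  case (elim g)
  have "w g v * \<bar>f (T g v)\<bar> \<le> W g * B"
    using w_le[OF elim assms(1)] w_pos[OF elim assms(1)] assms(2)[OF T_X[OF elim assms(1)]] W_nonneg[OF elim]
    by (intro mult_mono) auto
  then show ?case using w_pos[OF elim assms(1)] by (simp add: abs_mult)
qed

lemma P_int: assumes "f \<in> CY" "v \<in> Y" shows "integrable \<mu> (\<lambda>g. w g v * f (T g v))"
proof -
  obtain B where B: "\<And>x. \<bar>f x\<bar> \<le> B" using CY_bdd[OF assms(1)] by auto
  show ?thesis
  proof (rule Bochner_Integration.integrable_bound)
    show "integrable \<mu> (\<lambda>g. W g * B)" using W_int by simp
    show "(\<lambda>g. w g v * f (T g v)) \<in> borel_measurable \<mu>" by (rule meas_T[OF assms])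
    show "AE g in \<mu>. norm (w g v * f (T g v)) \<le> norm (W g * B)"
      using AE_w_bound[OF assms(2), of f B] B by (auto elim!: eventually_mono)
  qed
qed

lemma P_in: "v \<in> Y \<Longrightarrow> P f v = (\<integral>g. w g v * f (T g v) \<partial>\<mu>)" by (simp add: P_def)

lemma P_out: "v \<notin> Y \<Longrightarrow> P f v = 0" by (simp add: P_def)

lemma P_CY: assumes f: "f \<in> CY" shows "P f \<in> CY"
proof -
  obtain B where B: "\<And>x. \<bar>f x\<bar> \<le> B" using CY_bdd[OF assms(1)] by auto
  have "continuous_on Y (P f)"
    unfolding continuous_on_sequentially
  proof (intro allI ballI impI)
    fix x a assume a: "a \<in> Y" and x: "(\<forall>n. x n \<in> Y) \<and> x \<longlonglongrightarrow> a"
    have "(\<lambda>n. \<integral>g. w g (x n) * f (T g (x n)) \<partial>\<mu>) \<longlonglongrightarrow> (\<integral>g. w g a * f (T g a) \<partial>\<mu>)"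
    proof (rule integral_dominated_convergence[where w="\<lambda>g. W g * B"])
      show "AE g in \<mu>. (\<lambda>n. w g (x n) * f (T g (x n))) \<longlonglongrightarrow> w g a * f (T g a)"
        using AE_good
      proof eventually_elim
        case (elim g)
        have "continuous_on Y (\<lambda>v. w g v * f (T g v))"
          using continuous_on_compose2[OF CY_cont[OF f] T_cont[OF elim]] T_X[OF elim] XY
          by (intro continuous_on_mult w_cont[OF elim]) auto
        then show ?case using a x unfolding continuous_on_sequentially comp_def by auto
      qed
      show "AE g in \<mu>. norm (w g (x n) * f (T g (x n))) \<le> W g * B" for n
        using AE_w_bound[of "x n" f B] B x by auto
    qed (use a x meas_T[OF f] W_int in auto)
    then show "(P f \<circ> x) \<longlonglongrightarrow> P f a" using a x by (simp add: P_in comp_def)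
  qed
  then show ?thesis by (simp add: CY_def P_out)
qed

lemma P_iter_CY: "f \<in> CY \<Longrightarrow> (P ^^ n) f \<in> CY"
  by (induction n) (auto simp: P_CY)

lemma P_add: assumes "f \<in> CY" "h \<in> CY" shows "P (\<lambda>x. f x + h x) = (\<lambda>v. P f v + P h v)"
  using P_int[OF assms(1)] P_int[OF assms(2)] by (auto simp: P_def fun_eq_iff ring_distribs)

lemma P_scale: shows "P (\<lambda>x. b * f x) = (\<lambda>v. b * P f v)"
proof (rule ext)
  fix v
  have "(\<integral>g. w g v * (b * f (T g v)) \<partial>\<mu>) = (\<integral>g. b * (w g v * f (T g v)) \<partial>\<mu>)"
    by (simp add: mult.left_commute)
  then show "P (\<lambda>x. b * f x) v = b * P f v" by (simp add: P_def)
qed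

lemma P_diff: assumes "f \<in> CY" "h \<in> CY" shows "P (\<lambda>x. f x - h x) = (\<lambda>v. P f v - P h v)"
  using P_add[OF assms(1) CY_scale[OF assms(2), of "-1"]] P_scale[of "-1" h] by simp

lemma P_iter_add: assumes "f \<in> CY" "h \<in> CY" shows "(P ^^ n) (\<lambda>x. f x + h x) = (\<lambda>v. (P ^^ n) f v + (P ^^ n) h v)"
  by (induction n) (auto simp: P_add P_iter_CY assms)

lemma P_iter_scale: "(P ^^ n) (\<lambda>x. b * f x) = (\<lambda>v. b * (P ^^ n) f v)"
  by (induction n) (auto simp: P_scale)

lemma P_mono:
  assumes "f \<in> CY" "h \<in> CY" "\<And>x. x \<in> X \<Longrightarrow> f x \<le> h x"
  shows "P f v \<le> P h v"
proof (cases "v \<in> Y")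
  case True
  have "(\<integral>g. w g v * f (T g v) \<partial>\<mu>) \<le> (\<integral>g. w g v * h (T g v) \<partial>\<mu>)"
  proof (rule integral_mono_AE)
    show "AE g in \<mu>. w g v * f (T g v) \<le> w g v * h (T g v)"
      using AE_good
    proof eventually_elim
      case (elim g)
      then show ?case using w_pos[OF elim True] assms(3)[OF T_X[OF elim True]] by (intro mult_left_mono) auto
    qed
  qed (use P_int assms True in auto)
  then show ?thesis using True by (simp add: P_in)
qed (simp add: P_out)

lemma P_iter_mono:
  assumes "f \<in> CY" "h \<in> CY" "\<And>x. x \<in> X \<Longrightarrow> f x \<le> h x" "v \<in> X"
  shows "(P ^^ n) f v \<le> (P ^^ n) h v"
  using assms(4)
proof (induction n arbitrary: v)
  case (Suc n)
  then show ?case using P_mono[OF P_iter_CY P_iter_CY] assms by auto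
qed (use assms in auto)

lemma P_zero: "P (\<lambda>x. 0) = (\<lambda>v. 0)" by (auto simp: P_def fun_eq_iff)

lemma P_pos:
  assumes f: "f \<in> CY" and pos: "\<And>x. x \<in> X \<Longrightarrow> 0 < f x" and v: "v \<in> Y"
  shows "0 < P f v"
proof -
  have ae: "AE g in \<mu>. 0 < w g v * f (T g v)"
    using AE_good by eventually_elim (use w_pos pos T_X v in auto)
  then have ae': "AE g in \<mu>. 0 \<le> w g v * f (T g v)" by (auto elim!: eventually_mono)
  have "0 \<le> P f v" using ae' v by (simp add: P_in integral_nonneg_AE)
  moreover have "P f v \<noteq> 0"
  proof
    assume "P f v = 0"
    then have "AE g in \<mu>. w g v * f (T g v) = 0"
      using integral_nonneg_eq_0_iff_AE[OF P_int[OF f v] ae'] v by (simp add: P_in)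
    with ae have "AE g in \<mu>. False" by eventually_elim auto
    then show False using AE_False by simp
  qed
  ultimately show ?thesis by simp
qed

lemma P_bound:
  assumes f: "f \<in> CY" and B: "\<And>x. x \<in> X \<Longrightarrow> \<bar>f x\<bar> \<le> B" and v: "v \<in> Y"
  shows "\<bar>P f v\<bar> \<le> Wbar * B"
proof -
  have "norm (\<integral>g. w g v * f (T g v) \<partial>\<mu>) \<le> (\<integral>g. W g * B \<partial>\<mu>)"
    using W_int AE_w_bound[OF v B] by (intro integral_norm_bound_AE P_int f v) auto
  then show ?thesis using v by (simp add: P_in Wbar_def)
qed

text \<open>An inequality of Doeblin-Fortet type. Its data are bounds on \<open>X\<close> while its
  conclusion holds on all of \<open>Y\<close>; this is how estimates obtained on \<open>X\<close>
  reach the boundary of the simplex.\<close>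

lemma P_lip:
  assumes f: "f \<in> CY" and B: "\<And>x. x \<in> X \<Longrightarrow> \<bar>f x\<bar> \<le> B"
    and C: "\<And>x y. x \<in> X \<Longrightarrow> y \<in> X \<Longrightarrow> \<bar>f x - f y\<bar> \<le> C * \<delta> x y" "0 \<le> C"
    and u: "u \<in> Y" and v: "v \<in> Y"
  shows "\<bar>P f u - P f v\<bar> \<le> Wbar * (L * B + c * C) * \<delta> u v"
proof -
  have "norm (\<integral>g. w g u * f (T g u) - w g v * f (T g v) \<partial>\<mu>) \<le> (\<integral>g. W g * ((L * B + c * C) * \<delta> u v) \<partial>\<mu>)"
  proof (rule integral_norm_bound_AE)
    show "AE g in \<mu>. norm (w g u * f (T g u) - w g v * f (T g v)) \<le> W g * ((L * B + c * C) * \<delta> u v)"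
      using AE_good
    proof eventually_elim
      case (elim g)
      have "\<bar>(w g u - w g v) * f (T g u)\<bar> \<le> (W g * L * \<delta> u v) * B"
        unfolding abs_mult using w_lip[OF elim u v] B[OF T_X[OF elim u]]
        by (intro mult_mono) auto
      moreover have "\<bar>w g v * (f (T g u) - f (T g v))\<bar> \<le> W g * (C * (c * \<delta> u v))"
      proof -
        have "\<bar>f (T g u) - f (T g v)\<bar> \<le> C * \<delta> (T g u) (T g v)" using C T_X[OF elim] u v by auto
        also have "\<dots> \<le> C * (c * \<delta> u v)" using T_contr[OF elim u v] C(2) by (intro mult_left_mono) auto
        finally show ?thesis unfolding abs_mult
          using w_pos[OF elim v] w_le[OF elim v] W_nonneg[OF elim] by (intro mult_mono) auto
      qed
      moreover have "w g u * f (T g u) - w g v * f (T g v) = (w g u - w g v) * f (T g u) + w g v * (f (T g u) - f (T g v))"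
        by (simp add: algebra_simps)
      ultimately have "\<bar>w g u * f (T g u) - w g v * f (T g v)\<bar> \<le> (W g * L * \<delta> u v) * B + W g * (C * (c * \<delta> u v))"
        by linarith
      then show ?case by (simp add: algebra_simps)
    qed
  qed (use P_int[OF f] u v W_int in auto)
  also have "(\<integral>g. w g u * f (T g u) - w g v * f (T g v) \<partial>\<mu>) = P f u - P f v"
    using P_int[OF f] u v by (simp add: P_in)
  finally show ?thesis by (simp add: Wbar_def mult.assoc)
qed

subsection \<open>The cone of log-Lipschitz functions\<close>

definition cone :: "real \<Rightarrow> ('a \<Rightarrow> real) set" where
  "cone a = {f \<in> CY. (\<forall>v\<in>X. 0 \<le> f v) \<and> (\<forall>u\<in>X. \<forall>v\<in>X. f u \<le> exp (a * \<delta> u v) * f v)}"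

lemma coneD:
  assumes "f \<in> cone a"
  shows "f \<in> CY" "v \<in> X \<Longrightarrow> 0 \<le> f v" "u \<in> X \<Longrightarrow> v \<in> X \<Longrightarrow> f u \<le> exp (a * \<delta> u v) * f v"
  using assms by (auto simp: cone_def)

lemma cone_mono: assumes "a \<le> b" shows "cone a \<subseteq> cone b"
proof
  fix f assume f: "f \<in> cone a"
  have "f u \<le> exp (b * \<delta> u v) * f v" if "u \<in> X" "v \<in> X" for u v
  proof -
    have "f u \<le> exp (a * \<delta> u v) * f v" using coneD(3)[OF f that] .
    also have "\<dots> \<le> exp (b * \<delta> u v) * f v"
      using assms \<delta>_nonneg inY that coneD(2)[OF f] by (intro mult_right_mono) (auto intro!: mult_right_mono)
    finally show ?thesis .
  qed
  then show "f \<in> cone b" using f by (auto simp: cone_def)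
qed

lemma cone_le_exp:
  assumes "f \<in> cone a" "0 \<le> a" "u \<in> X" "v \<in> X" shows "f u \<le> exp a * f v"
proof -
  have "f u \<le> exp (a * \<delta> u v) * f v" using coneD(3)[OF assms(1,3,4)] .
  also have "\<dots> \<le> exp a * f v"
    using coneD(2)[OF assms(1,4)] assms \<delta>_le_1 inY by (intro mult_right_mono) (auto simp: mult_left_le)
  finally show ?thesis .
qed

lemma cone_scale: assumes "f \<in> cone a" "0 \<le> b" shows "(\<lambda>x. b * f x) \<in> cone a"
proof -
  have "b * f u \<le> exp (a * \<delta> u v) * (b * f v)" if "u \<in> X" "v \<in> X" for u v
    using mult_left_mono[OF coneD(3)[OF assms(1) that] assms(2)] by (simp add: algebra_simps)
  then show ?thesis using assms by (auto simp: cone_def CY_scale)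
qed

lemma cone_one: "0 \<le> a \<Longrightarrow> one \<in> cone a"
  using CY_one XY \<delta>_nonneg by (auto simp: cone_def one_def subset_iff)

lemma exp_minus_one_le: fixes x a :: real assumes "0 \<le> x" "x \<le> a" shows "exp x - 1 \<le> x * exp a"
proof -
  have "1 - x \<le> exp (-x)" using exp_ge_add_one_self[of "-x"] by simp
  then have "exp x * (1 - x) \<le> exp x * exp (-x)" by (intro mult_left_mono) auto
  then have "exp x - 1 \<le> x * exp x" by (simp add: algebra_simps flip: exp_add)
  also have "\<dots> \<le> x * exp a" using assms by (intro mult_left_mono) auto
  finally show ?thesis .
qed

text \<open>Passage from multiplicative to additive control: since \<open>\<delta>\<close> is at
  most 1, \<open>exp (a * \<delta> u v) - 1\<close> is bounded linearly in
  \<open>\<delta> u v\<close>.\<close>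

lemma cone_lip:
  assumes f: "f \<in> cone a" and a: "0 \<le> a" and u: "u \<in> X" and v: "v \<in> X"
    and B: "\<And>x. x \<in> X \<Longrightarrow> f x \<le> B"
  shows "\<bar>f u - f v\<bar> \<le> a * exp a * B * \<delta> u v"
proof -
  have *: "f u - f v \<le> a * exp a * B * \<delta> u v" if u: "u \<in> X" and v: "v \<in> X" for u v
  proof -
    have d: "0 \<le> \<delta> u v" "\<delta> u v \<le> 1" using u v \<delta>_nonneg \<delta>_le_1 inY by auto
    have "f u - f v \<le> (exp (a * \<delta> u v) - 1) * f v" using coneD(3)[OF f u v] by (simp add: algebra_simps)
    also have "\<dots> \<le> (a * \<delta> u v * exp a) * B"
      using coneD(2)[OF f v] B[OF v] a d by (intro mult_mono exp_minus_one_le) (auto simp: mult_left_le)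
    finally show ?thesis by (simp add: algebra_simps)
  qed
  from *[OF u v] *[OF v u] show ?thesis by (simp add: \<delta>_sym abs_le_iff)
qed

text \<open>The contraction of \<open>T g\<close> multiplies the logarithmic Lipschitz constant by
  \<open>c\<close>, and the weight adds \<open>L\<close>. As \<open>c < 1\<close>, large cones are
  mapped into smaller ones.\<close>

lemma P_cone: assumes f: "f \<in> cone a" and a: "0 \<le> a" shows "P f \<in> cone (L + c * a)"
proof -
  have fC: "f \<in> CY" using coneD(1)[OF f] .
  have "P f u \<le> exp ((L + c * a) * \<delta> u v) * P f v" if u: "u \<in> X" and v: "v \<in> X" for u v
  proof -
    have uv: "u \<in> Y" "v \<in> Y" using u v inY by auto
    have "(\<integral>g. w g u * f (T g u) \<partial>\<mu>) \<le> (\<integral>g. exp ((L + c * a) * \<delta> u v) * (w g v * f (T g v)) \<partial>\<mu>)"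
    proof (rule integral_mono_AE)
      show "AE g in \<mu>. w g u * f (T g u) \<le> exp ((L + c * a) * \<delta> u v) * (w g v * f (T g v))"
        using AE_good
      proof eventually_elim
        case (elim g)
        have TX: "T g u \<in> X" "T g v \<in> X" using T_X[OF elim] uv by auto
        have "f (T g u) \<le> exp (a * \<delta> (T g u) (T g v)) * f (T g v)" using coneD(3)[OF f TX] .
        also have "\<dots> \<le> exp (a * (c * \<delta> u v)) * f (T g v)"
          using a T_contr[OF elim uv] coneD(2)[OF f TX(2)] by (intro mult_right_mono) (auto intro: mult_left_mono)
        finally have "w g u * f (T g u) \<le> (exp (L * \<delta> u v) * w g v) * (exp (a * (c * \<delta> u v)) * f (T g v))"
          using w_log[OF elim u v] w_pos[OF elim uv(2)] coneD(2)[OF f TX(1)] by (intro mult_mono) auto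
        also have "\<dots> = exp ((L + c * a) * \<delta> u v) * (w g v * f (T g v))"
          by (simp add: algebra_simps exp_add)
        finally show ?case .
      qed
    qed (use P_int[OF fC] uv in auto)
    then show ?thesis using uv by (simp add: P_in)
  qed
  moreover have "0 \<le> P f v" if "v \<in> X" for v
    using P_mono[of "\<lambda>x. 0" f v] coneD(2)[OF f] fC that by (simp add: P_zero CY_def)
  ultimately show ?thesis using P_CY[OF fC] by (auto simp: cone_def)
qed

text \<open>The solution of \<open>L + c * A = A - 2\<close>: then \<open>P\<close> sends
  \<open>cone A\<close> into \<open>cone (A - 1)\<close> with room to spare. The gap lemma consumes
  this loss of one unit, and \<open>A \<ge> 2\<close> leaves \<open>A - 1 \<ge> 1\<close>, which is
  needed to shift arbitrary Lipschitz functions into \<open>cone (A - 1)\<close>.\<close>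

definition A :: real where "A = (L + 2) / (1 - c)"

lemma A_eq: "L + c * A = A - 2" using c by (simp add: A_def field_simps)

lemma A_ge: "2 \<le> A" using c L by (simp add: A_def le_divide_eq)

lemma P_coneA: "f \<in> cone A \<Longrightarrow> P f \<in> cone (A - 1)"
  using P_cone[of f A] A_eq A_ge cone_mono[of "A - 2" "A - 1"] by auto

lemma P_coneA1: "f \<in> cone (A - 1) \<Longrightarrow> P f \<in> cone (A - 1)"
  using P_coneA cone_mono[of "A - 1" A] by auto

lemma P_iter_coneA1: "f \<in> cone (A - 1) \<Longrightarrow> (P ^^ n) f \<in> cone (A - 1)"
  by (induction n) (auto simp: P_coneA1)

text \<open>Dictated by \<open>cone_gap\<close>: the factor \<open>exp (- 2 * A)\<close> pays for
  comparing the values of \<open>F\<close> and of \<open>H\<close> with those at \<open>x0\<close>;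
  the denominator pays for the variation of the subtracted multiple of \<open>H\<close> and, being
  at least 1, for positivity.\<close>

definition eta :: real where "eta = exp (- 2 * A) / (A * exp A + A + 1)"

lemma eta: "0 < eta" "eta < 1"
proof -
  have "0 < A * exp A" using A_ge by simp
  then have p: "1 < A * exp A + A + 1" using A_ge by linarith
  show "0 < eta" unfolding eta_def using p by (intro divide_pos_pos) auto
  have "exp (- 2 * A) \<le> 1" using A_ge by simp
  then have "exp (- 2 * A) < A * exp A + A + 1" using p by linarith
  then show "eta < 1" unfolding eta_def using p by (simp add: divide_less_eq)
qed

text \<open>\<open>cone (A - 1)\<close> sits inside \<open>cone A\<close> with a definite margin; this gap replaces
  Birkhoff's theorem on the contraction of projective metrics.\<close>

lemma cone_gap:
  assumes F: "F \<in> cone (A - 1)" and H: "H \<in> cone (A - 1)" and x0: "x0 \<in> X" and H0: "0 < H x0"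
  shows "(\<lambda>v. F v - eta * F x0 / H x0 * H v) \<in> cone A"
proof -
  define t where "t = eta * F x0 / H x0"
  have F0: "0 \<le> F x0" using coneD(2)[OF F x0] .
  have t: "0 \<le> t" using F0 H0 eta by (simp add: t_def)
  have A1: "0 \<le> A - 1" using A_ge by simp
  define M where "M = A * exp A + A + 1"
  have M: "1 \<le> M" using A_ge by (simp add: M_def)
  have key: "t * H v * M \<le> exp (-(A - 1)) * F x0" if v: "v \<in> X" for v
  proof -
    have "t * H v * M \<le> t * (exp (A - 1) * H x0) * M"
      using cone_le_exp[OF H A1 v x0] t M by (intro mult_right_mono mult_left_mono) auto
    also have "\<dots> = exp (- 2 * A) * exp (A - 1) * F x0"
      using H0 M by (simp add: t_def eta_def M_def[symmetric])
    also have "\<dots> \<le> exp (-(A - 1)) * F x0"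
      using F0 by (intro mult_right_mono) (simp_all flip: exp_add)
    finally show ?thesis .
  qed
  have low: "exp (-(A - 1)) * F x0 \<le> F v" if v: "v \<in> X" for v
    using cone_le_exp[OF F A1 x0 v] unfolding exp_minus by (simp add: field_simps)
  have nn: "0 \<le> F v - t * H v" if v: "v \<in> X" for v
  proof -
    have "t * H v * 1 \<le> t * H v * M" using t M coneD(2)[OF H v] by (intro mult_left_mono) auto
    then show ?thesis using key[OF v] low[OF v] by simp
  qed
  have "F u - t * H u \<le> exp (A * \<delta> u v) * (F v - t * H v)" if u: "u \<in> X" and v: "v \<in> X" for u v
  proof -
    define d where "d = \<delta> u v"
    have d: "0 \<le> d" "d \<le> 1" using u v \<delta>_nonneg \<delta>_le_1 inY by (auto simp: d_def)
    have "H v \<le> exp ((A - 1) * d) * H u"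
      using coneD(3)[OF H v u] by (simp add: d_def \<delta>_sym)
    then have Hu: "exp (- ((A - 1) * d)) * H v \<le> H u"
      unfolding exp_minus by (simp add: divide_simps) (simp add: mult.commute)
    \<comment> \<open>Subtracting \<open>t * H\<close> spoils the estimate by an amount linear in
      \<open>d\<close>, which \<open>key\<close> and \<open>low\<close> bound by
      \<open>d * F v\<close>. The slack between the exponents \<open>A - 1\<close> and
      \<open>A\<close> is worth at least \<open>d * F v\<close> and absorbs it.\<close>
    have "t * (exp (A * d) * H v - H u) \<le> t * ((exp (A * d) - exp (- ((A - 1) * d))) * H v)"
      using Hu t by (intro mult_left_mono) (auto simp: algebra_simps)
    also have "\<dots> \<le> t * ((A * d * exp A + A * d) * H v)"
    proof (intro mult_left_mono mult_right_mono t coneD(2)[OF H v])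
      have "exp (A * d) - 1 \<le> A * d * exp A"
        using d A_ge by (intro exp_minus_one_le) (auto simp: mult_left_le)
      moreover have "1 - exp (- ((A - 1) * d)) \<le> (A - 1) * d"
        using exp_ge_add_one_self[of "- ((A - 1) * d)"] by simp
      moreover have "(A - 1) * d \<le> A * d" using d by (intro mult_right_mono) auto
      ultimately show "exp (A * d) - exp (- ((A - 1) * d)) \<le> A * d * exp A + A * d" by linarith
    qed
    also have "\<dots> \<le> d * (t * H v * M)"
      using d t coneD(2)[OF H v] by (simp add: M_def algebra_simps)
    also have "\<dots> \<le> d * F v"
      using key[OF v] low[OF v] d by (intro mult_left_mono) auto
    also have "\<dots> \<le> (exp (A * d) - exp ((A - 1) * d)) * F v"
    proof (intro mult_right_mono coneD(2)[OF F v])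
      have "exp (A * d) = exp ((A - 1) * d) * exp d" by (simp add: algebra_simps flip: exp_add)
      moreover have "1 * d \<le> exp ((A - 1) * d) * (exp d - 1)"
      proof (rule mult_mono)
        show "d \<le> exp d - 1" using exp_ge_add_one_self[of d] by linarith
      qed (use d A1 in auto)
      ultimately show "d \<le> exp (A * d) - exp ((A - 1) * d)" by (simp add: algebra_simps)
    qed
    also have "\<dots> \<le> exp (A * d) * F v - F u" using coneD(3)[OF F u v] by (simp add: d_def algebra_simps)
    finally show ?thesis by (simp add: d_def algebra_simps)
  qed
  moreover have "(\<lambda>v. F v - t * H v) \<in> CY" by (intro CY_diff CY_scale coneD(1)[OF F] coneD(1)[OF H])
  ultimately show ?thesis using nn unfolding t_def by (simp add: cone_def)
qed

text \<open>The lower and the upper difference each give up the fraction \<open>eta\<close> of their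
  size relative to \<open>P H\<close>, both measured at the same point \<open>x0\<close>. There the
  two differences add up to \<open>(b - a) * P H x0\<close>, so the gap shrinks by exactly
  \<open>1 - eta\<close>.\<close>

lemma sandwich_step:
  assumes f: "f \<in> CY" and H: "H \<in> cone A" "\<And>x. x \<in> X \<Longrightarrow> 0 < H x"
    and lo: "(\<lambda>v. f v - a * H v) \<in> cone A" and hi: "(\<lambda>v. b * H v - f v) \<in> cone A"
  shows "\<exists>a' b'. (\<lambda>v. P f v - a' * P H v) \<in> cone A \<and> (\<lambda>v. b' * P H v - P f v) \<in> cone A
    \<and> b' - a' = (1 - eta) * (b - a)"
proof -
  obtain x0 where x0: "x0 \<in> X" using X_ne by auto
  have HC: "H \<in> CY" using coneD(1)[OF H(1)] .
  define F1 F2 where "F1 = P (\<lambda>v. f v - a * H v)" and "F2 = P (\<lambda>v. b * H v - f v)"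
  have F1: "F1 = (\<lambda>v. P f v - a * P H v)" unfolding F1_def using f HC by (simp add: P_diff CY_scale P_scale)
  have F2: "F2 = (\<lambda>v. b * P H v - P f v)" unfolding F2_def using f HC by (simp add: P_diff CY_scale P_scale)
  have pos: "0 < P H x0" using P_pos[OF HC H(2) inY[OF x0]] by simp
  have c1: "F1 \<in> cone (A - 1)" and c2: "F2 \<in> cone (A - 1)" and cH: "P H \<in> cone (A - 1)"
    unfolding F1_def F2_def using P_coneA lo hi H(1) by auto
  define t1 t2 where "t1 = eta * F1 x0 / P H x0" and "t2 = eta * F2 x0 / P H x0"
  have "(\<lambda>v. P f v - (a + t1) * P H v) \<in> cone A"
    using cone_gap[OF c1 cH x0 pos] unfolding t1_def[symmetric] by (simp add: F1 algebra_simps)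
  moreover have "(\<lambda>v. (b - t2) * P H v - P f v) \<in> cone A"
    using cone_gap[OF c2 cH x0 pos] unfolding t2_def[symmetric] by (simp add: F2 algebra_simps)
  moreover have "(b - t2) - (a + t1) = (1 - eta) * (b - a)"
    using pos by (simp add: t1_def t2_def F1 F2 field_simps)
  ultimately show ?thesis by blast
qed

lemma sandwich:
  assumes f: "f \<in> cone (A - 1)" and H: "H \<in> cone (A - 1)" "\<And>x. x \<in> X \<Longrightarrow> 0 < H x" and x0: "x0 \<in> X"
  shows "\<exists>a b. (\<lambda>v. (P ^^ n) f v - a * (P ^^ n) H v) \<in> cone A
    \<and> (\<lambda>v. b * (P ^^ n) H v - (P ^^ n) f v) \<in> cone A \<and> b - a = (1 - eta) ^ n * (f x0 / (eta * H x0))"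
proof (induction n)
  case 0
  have fC: "f \<in> CY" and HC: "H \<in> CY" using coneD(1) f H by auto
  have A1: "0 \<le> A - 1" using A_ge by simp
  have f0: "0 \<le> f x0" using coneD(2)[OF f x0] .
  have sub: "cone (A - 1) \<subseteq> cone A" by (rule cone_mono) simp
  \<comment> \<open>The initial upper factor comes from \<open>cone_gap\<close> with the roles of
    \<open>f\<close> and \<open>H\<close> exchanged, multiplied by \<open>b\<close>. This requires
    \<open>f x0 > 0\<close>; if \<open>f x0 = 0\<close>, then \<open>f\<close> vanishes on
    \<open>X\<close> and \<open>b\<close> is 0.\<close>
  define b where "b = f x0 / (eta * H x0)"
  have "(\<lambda>v. b * H v - f v) \<in> cone A"
  proof (cases "f x0 = 0")
    case True
    have "f v = 0" if "v \<in> X" for v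
      using cone_le_exp[OF f A1 that x0] coneD(2)[OF f that] True by simp
    then show ?thesis using True fC CY_scale[OF fC, of "-1"] by (auto simp: cone_def b_def)
  next
    case False
    with f0 have f0: "0 < f x0" by simp
    have b: "0 \<le> b" using f0 H(2)[OF x0] eta by (simp add: b_def)
    have bb: "b * (eta * H x0 / f x0) = 1" using f0 H(2)[OF x0] eta by (simp add: b_def)
    have "(\<lambda>v. b * (H v - eta * H x0 / f x0 * f v)) \<in> cone A"
      using cone_gap[OF H(1) f x0 f0] b by (rule cone_scale)
    also have "(\<lambda>v. b * (H v - eta * H x0 / f x0 * f v)) = (\<lambda>v. b * H v - f v)"
    proof
      fix v
      have "b * (H v - eta * H x0 / f x0 * f v) = b * H v - (b * (eta * H x0 / f x0)) * f v"
        by (simp only: right_diff_distrib mult.assoc)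
      then show "b * (H v - eta * H x0 / f x0 * f v) = b * H v - f v" by (simp only: bb mult_1)
    qed
    finally show ?thesis .
  qed
  then show ?case using f sub by (intro exI[of _ 0] exI[of _ b]) (auto simp: b_def)
next
  case (Suc n)
  then obtain a b where ab: "(\<lambda>v. (P ^^ n) f v - a * (P ^^ n) H v) \<in> cone A"
    "(\<lambda>v. b * (P ^^ n) H v - (P ^^ n) f v) \<in> cone A" "b - a = (1 - eta) ^ n * (f x0 / (eta * H x0))" by auto
  have Hn: "(P ^^ n) H \<in> cone A" using P_iter_coneA1[OF H(1)] cone_mono[of "A - 1" A] by auto
  have Hp: "0 < (P ^^ n) H x" if "x \<in> X" for x
    using that
  proof (induction n arbitrary: x)
    case (Suc n) then show ?case using P_pos[OF P_iter_CY[OF coneD(1)[OF H(1)]]] inY by auto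
  qed (use H in auto)
  from sandwich_step[OF P_iter_CY[OF coneD(1)[OF f]] Hn Hp ab(1,2)] ab(3)
  show ?case by (auto simp: mult.assoc)
qed

end

subsection \<open>The positive functional and the eigenfunction\<close>

context contracting_transfer begin

definition x0 :: 'a where "x0 = (SOME x. x \<in> X)"

lemma x0: "x0 \<in> X" unfolding x0_def using X_ne by (simp add: some_in_eq)

lemma one_X: "x \<in> X \<Longrightarrow> one x = 1" using XY by (auto simp: one_def)

lemma P_iter_pos:
  assumes "f \<in> CY" "\<And>x. x \<in> X \<Longrightarrow> 0 < f x" "x \<in> X" shows "0 < (P ^^ n) f x"
  using assms(3) by (induction n arbitrary: x) (use assms P_pos[OF P_iter_CY[OF assms(1)]] inY in auto)

lemma one_pos: "x \<in> X \<Longrightarrow> 0 < one x" by (simp add: one_X)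

lemma one_iter_pos: "x \<in> X \<Longrightarrow> 0 < (P ^^ n) one x"
  using P_iter_pos[OF CY_one] one_X by auto

lemma A1: "0 \<le> A - 1" "1 \<le> A - 1" using A_ge by auto

definition \<theta> :: real where "\<theta> = 1 - eta"

lemma \<theta>: "0 < \<theta>" "\<theta> < 1" using eta by (auto simp: \<theta>_def)

text \<open>Cone membership at time \<open>n\<close> contains pointwise bounds on \<open>X\<close>,
  and positivity of \<open>P\<close> propagates them to all later times with the same
  \<open>a\<close> and \<open>b\<close>.\<close>

lemma sandwich_values:
  assumes f: "f \<in> cone (A - 1)" and H: "H \<in> cone (A - 1)" "\<And>x. x \<in> X \<Longrightarrow> 0 < H x"
  obtains a b where "(\<lambda>v. (P ^^ n) f v - a * (P ^^ n) H v) \<in> cone A"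
    "b - a = \<theta> ^ n * (f x0 / (eta * H x0))"
    "\<And>m x. n \<le> m \<Longrightarrow> x \<in> X \<Longrightarrow> a * (P ^^ m) H x \<le> (P ^^ m) f x"
    "\<And>m x. n \<le> m \<Longrightarrow> x \<in> X \<Longrightarrow> (P ^^ m) f x \<le> b * (P ^^ m) H x"
proof -
  have fC: "f \<in> CY" and HC: "H \<in> CY" using coneD(1) f H by auto
  obtain a b where ab: "(\<lambda>v. (P ^^ n) f v - a * (P ^^ n) H v) \<in> cone A"
     "(\<lambda>v. b * (P ^^ n) H v - (P ^^ n) f v) \<in> cone A" "b - a = (1 - eta) ^ n * (f x0 / (eta * H x0))"
    using sandwich[OF f H x0, of n] by auto
  have split: "(P ^^ m) h = (P ^^ (m - n)) ((P ^^ n) h)" if "n \<le> m" for m h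
    using that by (metis funpow_add comp_apply le_add_diff_inverse2)
  have lo: "a * (P ^^ n) H x \<le> (P ^^ n) f x" and hi: "(P ^^ n) f x \<le> b * (P ^^ n) H x" if "x \<in> X" for x
    using coneD(2)[OF ab(1) that] coneD(2)[OF ab(2) that] by auto
  show ?thesis
  proof (rule that[OF ab(1)])
    show "b - a = \<theta> ^ n * (f x0 / (eta * H x0))" using ab(3) by (simp add: \<theta>_def)
    fix m x assume m: "n \<le> m" and x: "x \<in> X"
    show "a * (P ^^ m) H x \<le> (P ^^ m) f x"
      using P_iter_mono[OF CY_scale[OF P_iter_CY[OF HC]] P_iter_CY[OF fC] lo x, of "m - n"]
      by (simp add: P_iter_scale split[OF m])
    show "(P ^^ m) f x \<le> b * (P ^^ m) H x"
      using P_iter_mono[OF P_iter_CY[OF fC] CY_scale[OF P_iter_CY[OF HC]] hi x, of "m - n"]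
      by (simp add: P_iter_scale split[OF m])
  qed
qed

text \<open>The domain of the limit functional. Lipschitz control is asked on \<open>X\<close>,
  where the cone lives; on the rest of \<open>Y\<close> continuity suffices.\<close>

definition FX :: "('a \<Rightarrow> real) set" where
  "FX = {f \<in> CY. \<exists>C\<ge>0. \<forall>u\<in>X. \<forall>v\<in>X. \<bar>f u - f v\<bar> \<le> C * \<delta> u v}"

lemma FX_I: "f \<in> CY \<Longrightarrow> 0 \<le> C \<Longrightarrow> (\<And>u v. u \<in> X \<Longrightarrow> v \<in> X \<Longrightarrow> \<bar>f u - f v\<bar> \<le> C * \<delta> u v) \<Longrightarrow> f \<in> FX"
  by (auto simp: FX_def)

lemma FX_CY: "f \<in> FX \<Longrightarrow> f \<in> CY" by (simp add: FX_def)

lemma FX_bounds: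
  assumes "f \<in> FX"
  obtains a where "0 \<le> a" "\<And>x. x \<in> X \<Longrightarrow> \<bar>f x\<bar> \<le> a" "\<And>u v. u \<in> X \<Longrightarrow> v \<in> X \<Longrightarrow> \<bar>f u - f v\<bar> \<le> a * \<delta> u v"
proof -
  obtain C where C: "0 \<le> C" "\<forall>u\<in>X. \<forall>v\<in>X. \<bar>f u - f v\<bar> \<le> C * \<delta> u v" using assms by (auto simp: FX_def)
  obtain B where B: "0 < B" "\<And>v. \<bar>f v\<bar> \<le> B" using CY_bdd[OF FX_CY[OF assms]] by auto
  show ?thesis
  proof (rule that[of "max B C"])
    fix u v assume uv: "u \<in> X" "v \<in> X"
    have "C * \<delta> u v \<le> max B C * \<delta> u v" using \<delta>_nonneg inY uv by (intro mult_right_mono) auto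
    then show "\<bar>f u - f v\<bar> \<le> max B C * \<delta> u v" using C uv by (meson order_trans)
  qed (use B C in \<open>auto simp: le_max_iff_disj\<close>)
qed

lemma FX_add: assumes "f \<in> FX" "h \<in> FX" shows "(\<lambda>x. f x + h x) \<in> FX"
proof -
  obtain C1 where C1: "0 \<le> C1" "\<forall>u\<in>X. \<forall>v\<in>X. \<bar>f u - f v\<bar> \<le> C1 * \<delta> u v" using assms by (auto simp: FX_def)
  obtain C2 where C2: "0 \<le> C2" "\<forall>u\<in>X. \<forall>v\<in>X. \<bar>h u - h v\<bar> \<le> C2 * \<delta> u v" using assms by (auto simp: FX_def)
  show ?thesis
  proof (rule FX_I[where C="C1 + C2"])
    fix u v assume "u \<in> X" "v \<in> X"
    then have "\<bar>f u - f v\<bar> \<le> C1 * \<delta> u v" "\<bar>h u - h v\<bar> \<le> C2 * \<delta> u v" using C1 C2 by auto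
    then show "\<bar>f u + h u - (f v + h v)\<bar> \<le> (C1 + C2) * \<delta> u v" unfolding distrib_right by linarith
  qed (use assms C1 C2 in \<open>auto simp: FX_CY CY_add\<close>)
qed

lemma FX_scale: assumes "f \<in> FX" shows "(\<lambda>x. b * f x) \<in> FX"
proof -
  obtain C where C: "0 \<le> C" "\<forall>u\<in>X. \<forall>v\<in>X. \<bar>f u - f v\<bar> \<le> C * \<delta> u v" using assms by (auto simp: FX_def)
  show ?thesis
  proof (rule FX_I[where C="\<bar>b\<bar> * C"])
    fix u v assume "u \<in> X" "v \<in> X"
    then have "\<bar>b\<bar> * \<bar>f u - f v\<bar> \<le> \<bar>b\<bar> * (C * \<delta> u v)" using C by (intro mult_left_mono) auto
    then show "\<bar>b * f u - b * f v\<bar> \<le> \<bar>b\<bar> * C * \<delta> u v"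
      by (simp add: mult.assoc flip: right_diff_distrib abs_mult)
  qed (use assms C in \<open>auto simp: FX_CY CY_scale\<close>)
qed

lemma FX_diff: "f \<in> FX \<Longrightarrow> h \<in> FX \<Longrightarrow> (\<lambda>x. f x - h x) \<in> FX"
  using FX_add[of f "\<lambda>x. -1 * h x"] FX_scale[of h "-1"] by simp

lemma FX_one: "one \<in> FX" by (rule FX_I[OF CY_one, of 0]) (auto simp: one_X)

lemma cone_FX: assumes "f \<in> cone a" "0 \<le> a" shows "f \<in> FX"
proof -
  obtain B where B: "0 < B" "\<And>v. \<bar>f v\<bar> \<le> B" using CY_bdd[OF coneD(1)[OF assms(1)]] by auto
  have "\<And>x. f x \<le> B" using B(2) by (simp add: abs_le_iff)
  then show ?thesis
    using assms B by (intro FX_I[OF coneD(1)[OF assms(1)], of "a * exp a * B"] cone_lip) auto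
qed

lemma P_FX: assumes "f \<in> FX" shows "P f \<in> FX"
proof -
  obtain a where a: "0 \<le> a" "\<And>x. x \<in> X \<Longrightarrow> \<bar>f x\<bar> \<le> a" "\<And>u v. u \<in> X \<Longrightarrow> v \<in> X \<Longrightarrow> \<bar>f u - f v\<bar> \<le> a * \<delta> u v"
    using FX_bounds[OF assms] by blast
  have "0 \<le> Wbar * (L * a + c * a)" using a c L Wbar_nonneg by simp
  then show ?thesis
    using P_lip[OF FX_CY[OF assms] a(2,3,1)] inY by (intro FX_I[OF P_CY[OF FX_CY[OF assms]]]) auto
qed

lemma P_iter_FX: "f \<in> FX \<Longrightarrow> (P ^^ n) f \<in> FX"
  by (induction n) (auto simp: P_FX)

text \<open>After adding \<open>2 * a\<close> the values on \<open>X\<close> are at least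
  \<open>a\<close>, so an oscillation of at most \<open>a * \<delta> u v\<close> is a relative
  oscillation of at most \<open>\<delta> u v\<close>: the sum lies in \<open>cone 1\<close>.
  Differences of two cone members thus exhaust the Lipschitz functions.\<close>

lemma shift_cone:
  assumes f: "f \<in> CY" and a: "0 \<le> a" "\<And>x. x \<in> X \<Longrightarrow> \<bar>f x\<bar> \<le> a"
    "\<And>u v. u \<in> X \<Longrightarrow> v \<in> X \<Longrightarrow> \<bar>f u - f v\<bar> \<le> a * \<delta> u v"
  shows "(\<lambda>v. f v + 2 * a * one v) \<in> cone (A - 1)"
proof -
  have "(\<lambda>v. f v + 2 * a * one v) \<in> cone 1"
  proof -
    have "f u + 2 * a \<le> exp (1 * \<delta> u v) * (f v + 2 * a)" if u: "u \<in> X" and v: "v \<in> X" for u v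
    proof -
      have d: "0 \<le> \<delta> u v" using u v \<delta>_nonneg inY by auto
      have "f u + 2 * a \<le> (f v + 2 * a) + \<delta> u v * a" using a(3)[OF u v] by (simp add: mult.commute abs_le_iff)
      also have "\<dots> \<le> (f v + 2 * a) + \<delta> u v * (f v + 2 * a)"
        using a(2)[OF v] d by (intro add_left_mono mult_left_mono) (auto simp: abs_le_iff)
      also have "\<dots> = (1 + \<delta> u v) * (f v + 2 * a)" by (simp add: algebra_simps)
      also have "\<dots> \<le> exp (\<delta> u v) * (f v + 2 * a)"
        using a(2)[OF v] a(1) exp_ge_add_one_self[of "\<delta> u v"] by (intro mult_right_mono) (auto simp: abs_le_iff)
      finally show ?thesis by simp
    qed
    moreover have "0 \<le> f v + 2 * a" if "v \<in> X" for v using a(1,2) that by (force simp: abs_le_iff)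
    ultimately show ?thesis by (simp add: cone_def one_X CY_add CY_scale f CY_one)
  qed
  then show ?thesis using cone_mono[OF A1(2)] by auto
qed

definition nuF :: "('a \<Rightarrow> real) \<Rightarrow> real" where
  "nuF f = lim (\<lambda>n. (P ^^ n) f x0 / (P ^^ n) one x0)"

lemma one_cone: "one \<in> cone (A - 1)" using cone_one A1 by auto

text \<open>From time \<open>N\<close> on all ratios lie in the interval from \<open>a\<close> to
  \<open>b\<close> given by the sandwich at time \<open>N\<close>, whose length decays like
  \<open>\<theta> ^ N\<close>.\<close>

lemma ratio_convergent_cone:
  assumes f: "f \<in> cone (A - 1)"
  shows "convergent (\<lambda>n. (P ^^ n) f x0 / (P ^^ n) one x0)"
proof (rule Cauchy_convergent, rule metric_CauchyI)
  fix e :: real assume e: "0 < e"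
  define K where "K = f x0 / (eta * one x0)"
  have "(\<lambda>n. \<theta> ^ n * K) \<longlonglongrightarrow> 0 * K" using \<theta> by (intro tendsto_mult LIMSEQ_power_zero tendsto_const) auto
  then have "\<forall>\<^sub>F n in sequentially. \<theta> ^ n * K < e" using e by (auto dest: order_tendstoD(2))
  then obtain N where N: "\<theta> ^ N * K < e" by (auto simp: eventually_sequentially)
  obtain a b where "(\<lambda>v. (P ^^ N) f v - a * (P ^^ N) one v) \<in> cone A"
    and ab: "b - a = \<theta> ^ N * (f x0 / (eta * one x0))"
    "\<And>m x. N \<le> m \<Longrightarrow> x \<in> X \<Longrightarrow> a * (P ^^ m) one x \<le> (P ^^ m) f x"
    "\<And>m x. N \<le> m \<Longrightarrow> x \<in> X \<Longrightarrow> (P ^^ m) f x \<le> b * (P ^^ m) one x"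
    by (rule sandwich_values[where n=N, OF f one_cone one_pos]) (assumption, (rule that; (assumption | blast)))
  have 1: "a \<le> (P ^^ m) f x0 / (P ^^ m) one x0 \<and> (P ^^ m) f x0 / (P ^^ m) one x0 \<le> b" if "N \<le> m" for m
    using ab(2,3)[OF that x0] one_iter_pos[OF x0, of m] by (simp add: field_simps)
  have 2: "b - a < e" using ab(1) N by (simp add: K_def)
  have "\<bar>(P ^^ m) f x0 / (P ^^ m) one x0 - (P ^^ n) f x0 / (P ^^ n) one x0\<bar> < e"
    if "N \<le> m" "N \<le> n" for m n
  proof -
    define p q where "p = (P ^^ m) f x0 / (P ^^ m) one x0" and "q = (P ^^ n) f x0 / (P ^^ n) one x0"
    have "a \<le> p \<and> p \<le> b" "a \<le> q \<and> q \<le> b" using 1 that by (auto simp: p_def q_def)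
    then show ?thesis using 2 unfolding p_def[symmetric] q_def[symmetric] by linarith
  qed
  then show "\<exists>M. \<forall>m\<ge>M. \<forall>n\<ge>M. dist ((P ^^ m) f x0 / (P ^^ m) one x0) ((P ^^ n) f x0 / (P ^^ n) one x0) < e"
    unfolding dist_real_def by blast
qed

lemma nuF_tendsto:
  assumes "f \<in> FX"
  shows "(\<lambda>n. (P ^^ n) f x0 / (P ^^ n) one x0) \<longlonglongrightarrow> nuF f"
proof -
  obtain a where a: "0 \<le> a" "\<And>x. x \<in> X \<Longrightarrow> \<bar>f x\<bar> \<le> a" "\<And>u v. u \<in> X \<Longrightarrow> v \<in> X \<Longrightarrow> \<bar>f u - f v\<bar> \<le> a * \<delta> u v"
    using FX_bounds[OF assms] by blast
  have fC: "f \<in> CY" by (rule FX_CY[OF assms])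
  have "convergent (\<lambda>n. (P ^^ n) (\<lambda>v. f v + 2 * a * one v) x0 / (P ^^ n) one x0 - 2 * a)"
    by (intro convergent_diff convergent_const ratio_convergent_cone shift_cone fC a)
  moreover have "(P ^^ n) (\<lambda>v. f v + 2 * a * one v) x0 / (P ^^ n) one x0 - 2 * a = (P ^^ n) f x0 / (P ^^ n) one x0" for n
    using one_iter_pos[OF x0, of n] by (simp add: P_iter_add P_iter_scale fC CY_scale CY_one field_simps)
  ultimately have "convergent (\<lambda>n. (P ^^ n) f x0 / (P ^^ n) one x0)" by simp
  then show ?thesis unfolding nuF_def by (simp add: convergent_LIMSEQ_iff)
qed

lemma nuF_unique: "f \<in> FX \<Longrightarrow> (\<lambda>n. (P ^^ n) f x0 / (P ^^ n) one x0) \<longlonglongrightarrow> l \<Longrightarrow> nuF f = l"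
  using LIMSEQ_unique nuF_tendsto by blast

lemma nuF_add: assumes "f \<in> FX" "h \<in> FX" shows "nuF (\<lambda>x. f x + h x) = nuF f + nuF h"
  using tendsto_add[OF nuF_tendsto[OF assms(1)] nuF_tendsto[OF assms(2)]]
  by (intro nuF_unique FX_add assms) (simp add: P_iter_add FX_CY assms add_divide_distrib)

lemma nuF_scale: assumes "f \<in> FX" shows "nuF (\<lambda>x. b * f x) = b * nuF f"
  using tendsto_mult_left[OF nuF_tendsto[OF assms], of b]
  by (intro nuF_unique FX_scale assms) (simp add: P_iter_scale)

lemma nuF_diff: "f \<in> FX \<Longrightarrow> h \<in> FX \<Longrightarrow> nuF (\<lambda>x. f x - h x) = nuF f - nuF h"
  using nuF_add[of f "\<lambda>x. -1 * h x"] FX_scale[of h "-1"] nuF_scale[of h "-1"] by simp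

lemma nuF_mono: assumes "f \<in> FX" "h \<in> FX" "\<And>x. x \<in> X \<Longrightarrow> f x \<le> h x" shows "nuF f \<le> nuF h"
proof (rule LIMSEQ_le[OF nuF_tendsto[OF assms(1)] nuF_tendsto[OF assms(2)]])
  show "\<exists>N. \<forall>n\<ge>N. (P ^^ n) f x0 / (P ^^ n) one x0 \<le> (P ^^ n) h x0 / (P ^^ n) one x0"
    using P_iter_mono[OF FX_CY[OF assms(1)] FX_CY[OF assms(2)] assms(3) x0] one_iter_pos[OF x0]
    by (auto intro!: divide_right_mono simp: less_imp_le)
qed

lemma nuF_one: "nuF one = 1"
proof (rule nuF_unique[OF FX_one])
  have "(P ^^ n) one x0 / (P ^^ n) one x0 = 1" for n using one_iter_pos[OF x0, of n] by simp
  then show "(\<lambda>n. (P ^^ n) one x0 / (P ^^ n) one x0) \<longlonglongrightarrow> 1" by simp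
qed

lemma nuF_le: "f \<in> FX \<Longrightarrow> (\<And>x. x \<in> X \<Longrightarrow> f x \<le> b) \<Longrightarrow> nuF f \<le> b"
  using nuF_mono[of f "\<lambda>x. b * one x"] FX_scale[OF FX_one, of b] nuF_scale[OF FX_one, of b]
  by (simp add: one_X nuF_one)

lemma nuF_ge: "f \<in> FX \<Longrightarrow> (\<And>x. x \<in> X \<Longrightarrow> b \<le> f x) \<Longrightarrow> b \<le> nuF f"
  using nuF_mono[of "\<lambda>x. b * one x" f] FX_scale[OF FX_one, of b] nuF_scale[OF FX_one, of b]
  by (simp add: one_X nuF_one)

definition k :: real where "k = nuF (P one)"

text \<open>The ratio for \<open>P f\<close> at time \<open>n\<close> is the ratio for
  \<open>P one\<close> at time \<open>n\<close> times the ratio for \<open>f\<close> at time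
  \<open>n + 1\<close>. This identifies the limit for \<open>P one\<close> as the
  eigenvalue.\<close>

lemma nuF_P: assumes f: "f \<in> FX" shows "nuF (P f) = k * nuF f"
proof (rule nuF_unique[OF P_FX[OF f]])
  have "(\<lambda>n. (P ^^ n) (P one) x0 / (P ^^ n) one x0 * ((P ^^ Suc n) f x0 / (P ^^ Suc n) one x0)) \<longlonglongrightarrow> k * nuF f"
    unfolding k_def by (intro tendsto_mult nuF_tendsto P_FX FX_one LIMSEQ_Suc[OF nuF_tendsto[OF f]])
  moreover have "(P ^^ n) (P one) x0 / (P ^^ n) one x0 * ((P ^^ Suc n) f x0 / (P ^^ Suc n) one x0)
     = (P ^^ n) (P f) x0 / (P ^^ n) one x0" for n
    using one_iter_pos[OF x0, of "Suc n"] by (simp add: funpow_swap1)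
  ultimately show "(\<lambda>n. (P ^^ n) (P f) x0 / (P ^^ n) one x0) \<longlonglongrightarrow> k * nuF f" by simp
qed

lemma k_pos: "0 < k"
proof -
  have c1: "P one \<in> cone (A - 1)" by (rule P_coneA1[OF one_cone])
  have "0 < exp (- (A - 1)) * P one x0" using one_iter_pos[OF x0, of 1] by simp
  also have "\<dots> \<le> k" unfolding k_def
  proof (rule nuF_ge[OF P_FX[OF FX_one]])
    fix x assume "x \<in> X"
    from cone_le_exp[OF c1 A1(1) x0 this] show "exp (- (A - 1)) * P one x0 \<le> P one x"
      unfolding exp_minus by (simp add: field_simps)
  qed
  finally show ?thesis .
qed

lemma nuF_P_iter: "f \<in> FX \<Longrightarrow> nuF ((P ^^ n) f) = k ^ n * nuF f"
  by (induction n) (auto simp: nuF_P P_iter_FX)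

text \<open>A Harnack inequality: values of \<open>f\<close> on \<open>X\<close> differ by a factor
  of at most \<open>exp (A - 1)\<close>, and the mean \<open>nuF f = 1\<close> lies between their
  extremes.\<close>

lemma cone_normalized:
  assumes f: "f \<in> cone (A - 1)" and 1: "nuF f = 1" and x: "x \<in> X"
  shows "f x \<le> exp A" "exp (- A) \<le> f x"
proof -
  have fX: "f \<in> FX" using cone_FX[OF f A1(1)] .
  have "exp (- (A - 1)) * f x \<le> nuF f"
  proof (rule nuF_ge[OF fX])
    fix y assume "y \<in> X"
    from cone_le_exp[OF f A1(1) x this] show "exp (- (A - 1)) * f x \<le> f y"
      unfolding exp_minus by (simp add: field_simps)
  qed
  then have "f x \<le> exp (A - 1)" using 1 unfolding exp_minus by (simp add: field_simps)
  also have "\<dots> \<le> exp A" by simp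
  finally show "f x \<le> exp A" .
  have "nuF f \<le> exp (A - 1) * f x" by (rule nuF_le[OF fX cone_le_exp[OF f A1(1) _ x]])
  also have "\<dots> \<le> exp A * f x" using coneD(2)[OF f x] by (intro mult_right_mono) auto
  finally show "exp (- A) \<le> f x" using 1 unfolding exp_minus by (simp add: field_simps)
qed

definition h :: "nat \<Rightarrow> 'a \<Rightarrow> real" where "h n = (\<lambda>v. (1 / k ^ n) * (P ^^ n) one v)"

lemma h_cone: "h n \<in> cone (A - 1)"
  unfolding h_def using k_pos by (intro cone_scale P_iter_coneA1 one_cone) auto

lemma h_nuF: "nuF (h n) = 1"
  unfolding h_def nuF_scale[OF P_iter_FX[OF FX_one]] nuF_P_iter[OF FX_one] nuF_one using k_pos by simp

lemma P_h: "P (h n) = (\<lambda>v. k * h (Suc n) v)"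
  unfolding h_def P_scale using k_pos by (simp add: fun_eq_iff)

lemma h_CY: "h n \<in> CY" using h_cone coneD(1) by auto

text \<open>The sandwich compares \<open>P one\<close> with \<open>one\<close>. Applying
  \<open>nuF\<close> to both bounds shows that \<open>k\<close> lies between \<open>a\<close> and
  \<open>b\<close> as well, so \<open>(P ^^ n) (P one)\<close> differs from \<open>k\<close> times
  \<open>(P ^^ n) one\<close> by at most \<open>b - a\<close> times the latter.\<close>

lemma h_Suc_diff_X:
  assumes x: "x \<in> X"
  shows "\<bar>h (Suc n) x - h n x\<bar> \<le> P one x0 / eta * exp A / k * \<theta> ^ n"
proof -
  have o: "\<And>x. x \<in> X \<Longrightarrow> 0 < one x" by (simp add: one_X)
  obtain a b where "(\<lambda>v. (P ^^ n) (P one) v - a * (P ^^ n) one v) \<in> cone A"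
    and ab: "b - a = \<theta> ^ n * (P one x0 / (eta * one x0))"
    "\<And>m x. n \<le> m \<Longrightarrow> x \<in> X \<Longrightarrow> a * (P ^^ m) one x \<le> (P ^^ m) (P one) x"
    "\<And>m x. n \<le> m \<Longrightarrow> x \<in> X \<Longrightarrow> (P ^^ m) (P one) x \<le> b * (P ^^ m) one x"
    by (rule sandwich_values[where n=n, OF P_coneA1[OF one_cone] one_cone o]) (assumption, (rule that; (assumption | blast)))
  have nu1: "nuF (P one) = k" by (simp add: k_def)
  have kn: "0 < k ^ n" using k_pos by simp
  have "nuF (\<lambda>x. a * (P ^^ n) one x) \<le> nuF ((P ^^ n) (P one))"
    by (intro nuF_mono FX_scale P_iter_FX P_FX FX_one) (use ab(2)[of n] in auto)
  then have ak: "a \<le> k" using kn by (simp add: nuF_scale P_iter_FX FX_one P_FX nuF_P_iter nuF_one nu1)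
  have "nuF ((P ^^ n) (P one)) \<le> nuF (\<lambda>x. b * (P ^^ n) one x)"
    by (intro nuF_mono FX_scale P_iter_FX P_FX FX_one) (use ab(3)[of n] in auto)
  then have kb: "k \<le> b" using kn by (simp add: nuF_scale P_iter_FX FX_one P_FX nuF_P_iter nuF_one nu1)
  define p where "p = (P ^^ n) one x"
  have p: "0 < p" using one_iter_pos[OF x] by (simp add: p_def)
  have "a * p \<le> k * p" "k * p \<le> b * p" using ak kb p by auto
  then have "\<bar>(P ^^ n) (P one) x - k * p\<bar> \<le> (b - a) * p"
    using ab(2)[of n x] ab(3)[of n x] x unfolding p_def[symmetric] by (simp add: algebra_simps abs_le_iff)
  then have "\<bar>(P ^^ n) (P one) x - k * p\<bar> / k ^ Suc n \<le> (b - a) * p / k ^ Suc n"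
    using k_pos by (intro divide_right_mono) auto
  also have "(b - a) * p / k ^ Suc n = (b - a) / k * h n x" by (simp add: h_def p_def)
  also have "\<dots> \<le> (b - a) / k * exp A"
    using cone_normalized(1)[OF h_cone h_nuF x] ak kb k_pos by (intro mult_left_mono) auto
  also have "\<dots> = P one x0 / eta * exp A / k * \<theta> ^ n" using ab(1) by (simp add: one_X x0)
  also have "\<bar>(P ^^ n) (P one) x - k * p\<bar> / k ^ Suc n = \<bar>((P ^^ n) (P one) x - k * p) / k ^ Suc n\<bar>"
    using k_pos by (simp add: abs_divide)
  also have "((P ^^ n) (P one) x - k * p) / k ^ Suc n = h (Suc n) x - h n x"
    using k_pos by (simp add: h_def p_def funpow_swap1 diff_divide_distrib)
  finally show ?thesis .
qed

definition Ch :: real where "Ch = Wbar * (P one x0 / eta * exp A / k) / k"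

lemma h_Suc_diff:
  assumes v: "v \<in> Y"
  shows "\<bar>h (Suc (Suc n)) v - h (Suc n) v\<bar> \<le> Ch * \<theta> ^ n"
proof -
  have "\<bar>P (\<lambda>x. h (Suc n) x - h n x) v\<bar> \<le> Wbar * (P one x0 / eta * exp A / k * \<theta> ^ n)"
    by (intro P_bound CY_diff h_CY v h_Suc_diff_X)
  then have "k * \<bar>h (Suc (Suc n)) v - h (Suc n) v\<bar> \<le> Wbar * (P one x0 / eta * exp A / k * \<theta> ^ n)"
    using k_pos by (simp add: P_diff h_CY P_h abs_mult flip: right_diff_distrib)
  then have "\<bar>h (Suc (Suc n)) v - h (Suc n) v\<bar> \<le> Wbar * (P one x0 / eta * exp A / k * \<theta> ^ n) / k"
    using k_pos by (subst pos_le_divide_eq) (simp_all only: mult.commute)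
  then show ?thesis by (simp add: Ch_def)
qed

text \<open>The limit of \<open>h n\<close>, written as a telescoping series to which the
  Weierstrass test applies. It starts at \<open>h 1\<close> because carrying the geometric bound
  from \<open>X\<close> to \<open>Y\<close> has cost one application of \<open>P\<close>.\<close>

definition r :: "'a \<Rightarrow> real" where
  "r v = h 1 v + (\<Sum>i. h (Suc (Suc i)) v - h (Suc i) v)"

lemma uniform_limit_h: "uniform_limit Y (\<lambda>n. h (Suc n)) r sequentially"
proof -
  have "uniform_limit Y (\<lambda>n v. \<Sum>i<n. h (Suc (Suc i)) v - h (Suc i) v)
      (\<lambda>v. \<Sum>i. h (Suc (Suc i)) v - h (Suc i) v) sequentially"
    using h_Suc_diff \<theta> by (intro Weierstrass_m_test[where M="\<lambda>n. Ch * \<theta> ^ n"])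
      (auto intro!: summable_mult summable_geometric)
  moreover have "(\<Sum>i<n. h (Suc (Suc i)) v - h (Suc i) v) = h (Suc n) v - h 1 v" for n v
    by (induction n) auto
  ultimately have "uniform_limit Y (\<lambda>n v. h (Suc n) v - h 1 v) (\<lambda>v. r v - h 1 v) sequentially"
    by (simp add: r_def)
  then show ?thesis by (simp add: uniform_limit_iff dist_real_def)
qed

lemma r_tendsto: assumes "v \<in> Y" shows "(\<lambda>n. h (Suc n) v) \<longlonglongrightarrow> r v"
  using tendsto_uniform_limitI[OF uniform_limit_h assms] .

lemma r_CY: "r \<in> CY"
proof -
  have "continuous_on Y r"
    by (rule uniform_limit_theorem[OF _ uniform_limit_h]) (auto intro!: always_eventually CY_cont h_CY)
  then show ?thesis using CY_out[OF h_CY] by (simp add: CY_def r_def)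
qed

lemma r_cone: "r \<in> cone (A - 1)"
proof -
  have "0 \<le> r v" if "v \<in> X" for v
    by (rule LIMSEQ_le_const[OF r_tendsto[OF inY[OF that]]]) (use coneD(2)[OF h_cone that] in auto)
  moreover have "r u \<le> exp ((A - 1) * \<delta> u v) * r v" if uv: "u \<in> X" "v \<in> X" for u v
    by (rule LIMSEQ_le[OF r_tendsto[OF inY[OF uv(1)]] tendsto_mult_left[OF r_tendsto[OF inY[OF uv(2)]]]])
       (use coneD(3)[OF h_cone uv] in auto)
  ultimately show ?thesis using r_CY by (simp add: cone_def)
qed

lemma h_close:
  assumes "0 < e" shows "\<exists>N. \<forall>n\<ge>N. \<forall>v\<in>Y. \<bar>h (Suc n) v - r v\<bar> < e"
  using uniform_limit_h assms unfolding uniform_limit_iff eventually_sequentially dist_real_def by blast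

lemma P_r: "P r = (\<lambda>v. k * r v)"
proof
  fix v show "P r v = k * r v"
  proof (cases "v \<in> Y")
    case True
    have "(\<lambda>n. P (h (Suc n)) v) \<longlonglongrightarrow> P r v"
    proof (rule LIMSEQ_I)
      fix e :: real assume e: "0 < e"
      have "0 < e / (Wbar + 1)" using e Wbar_nonneg by simp
      from h_close[OF this] obtain N where N: "\<And>n x. n \<ge> N \<Longrightarrow> x \<in> Y \<Longrightarrow> \<bar>h (Suc n) x - r x\<bar> < e / (Wbar + 1)"
        by blast
      have "norm (P (h (Suc n)) v - P r v) < e" if "n \<ge> N" for n
      proof -
        have "\<bar>P (\<lambda>x. h (Suc n) x - r x) v\<bar> \<le> Wbar * (e / (Wbar + 1))"
          using N[OF that] inY by (intro P_bound CY_diff h_CY r_CY True less_imp_le) auto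
        also have "\<dots> < e" using e Wbar_nonneg by (simp add: field_simps)
        finally show ?thesis by (simp add: P_diff h_CY r_CY)
      qed
      then show "\<exists>no. \<forall>n\<ge>no. norm (P (h (Suc n)) v - P r v) < e" by blast
    qed
    moreover have "(\<lambda>n. P (h (Suc n)) v) \<longlonglongrightarrow> k * r v"
      unfolding P_h using LIMSEQ_Suc[OF r_tendsto[OF True]] by (intro tendsto_mult_left) simp
    ultimately show ?thesis by (rule LIMSEQ_unique)
  qed (simp add: P_out CY_out[OF r_CY])
qed

lemma P_iter_r: "(P ^^ n) r = (\<lambda>v. k ^ n * r v)"
  by (induction n) (auto simp: P_scale P_r)

lemma r_FX: "r \<in> FX" using cone_FX[OF r_cone A1(1)] .

text \<open>\<open>nuF\<close> is bounded by the supremum over \<open>X\<close>, so the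
  normalisation of the \<open>h n\<close> passes to their uniform limit.\<close>

lemma nuF_r: "nuF r = 1"
proof -
  have "\<bar>nuF r - 1\<bar> \<le> e" if e: "0 < e" for e
  proof -
    obtain n where n: "\<And>x. x \<in> Y \<Longrightarrow> \<bar>h (Suc n) x - r x\<bar> < e" using h_close[OF e] by blast
    have hX: "h (Suc n) \<in> FX" using cone_FX[OF h_cone A1(1)] .
    have "nuF (\<lambda>x. r x - h (Suc n) x) \<le> e" "- e \<le> nuF (\<lambda>x. r x - h (Suc n) x)"
    proof -
      have "r x - h (Suc n) x \<le> e \<and> - e \<le> r x - h (Suc n) x" if "x \<in> X" for x
        using n[OF inY[OF that]] by linarith
      then show "nuF (\<lambda>x. r x - h (Suc n) x) \<le> e" "- e \<le> nuF (\<lambda>x. r x - h (Suc n) x)"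
        by (auto intro!: nuF_le nuF_ge FX_diff r_FX hX)
    qed
    then show ?thesis by (simp add: nuF_diff r_FX hX h_nuF abs_le_iff)
  qed
  then have "\<bar>nuF r - 1\<bar> \<le> 0" by (metis field_le_epsilon add_0)
  then show ?thesis by simp
qed

lemma r_bounds: "x \<in> X \<Longrightarrow> r x \<le> exp A" "x \<in> X \<Longrightarrow> exp (- A) \<le> r x"
  using cone_normalized[OF r_cone nuF_r] by auto

lemma r_pos_X: "x \<in> X \<Longrightarrow> 0 < r x" using r_bounds(2)[of x] exp_gt_zero[of "- A"] by linarith

lemma r_pos: "v \<in> Y \<Longrightarrow> 0 < r v"
  using P_pos[OF r_CY r_pos_X, of v] k_pos by (simp add: P_r zero_less_mult_iff)

section \<open>Geometric decay of the remainder\<close>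

definition R :: "nat \<Rightarrow> ('a \<Rightarrow> real) \<Rightarrow> 'a \<Rightarrow> real" where
  "R n f v = (P ^^ n) f v - k ^ n * nuF f * r v"

lemma R_CY: "f \<in> CY \<Longrightarrow> R n f \<in> CY"
  unfolding R_def by (intro CY_diff CY_scale P_iter_CY r_CY)

lemma R_Suc: "f \<in> CY \<Longrightarrow> R (Suc n) f = P (R n f)"
  unfolding R_def by (simp add: P_diff P_iter_CY CY_scale r_CY P_scale P_r mult.assoc mult.left_commute)

text \<open>With the lower factor \<open>a\<close> of the sandwich against \<open>r\<close>, the
  remainder is \<open>F - t * r\<close>, where both terms lie in \<open>cone A\<close> and are at
  most \<open>s\<close> on \<open>X\<close>. The difference itself need not lie in a cone, but each
  term is Lipschitz by \<open>cone_lip\<close>, which yields the second bound.\<close>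

lemma R_cone:
  assumes f: "f \<in> cone (A - 1)" and x: "x \<in> X" and y: "y \<in> X"
  shows "\<bar>R n f x\<bar> \<le> exp A / eta * exp A * (f x0 * (k * \<theta>) ^ n)"
    "\<bar>R n f x - R n f y\<bar> \<le> 2 * A * exp A * (exp A / eta * exp A) * (f x0 * (k * \<theta>) ^ n) * \<delta> x y"
proof -
  have fX: "f \<in> FX" using cone_FX[OF f A1(1)] .
  have f0: "0 \<le> f x0" using coneD(2)[OF f x0] .
  obtain a b where ab: "(\<lambda>v. (P ^^ n) f v - a * (P ^^ n) r v) \<in> cone A"
    "b - a = \<theta> ^ n * (f x0 / (eta * r x0))"
    "\<And>m x. n \<le> m \<Longrightarrow> x \<in> X \<Longrightarrow> a * (P ^^ m) r x \<le> (P ^^ m) f x"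
    "\<And>m x. n \<le> m \<Longrightarrow> x \<in> X \<Longrightarrow> (P ^^ m) f x \<le> b * (P ^^ m) r x"
    by (rule sandwich_values[where n=n, OF f r_cone r_pos_X]) (assumption, (rule that; (assumption | blast)))
  have kn: "0 < k ^ n" using k_pos by simp
  define F where "F = (\<lambda>v. (P ^^ n) f v - a * (P ^^ n) r v)"
  define s where "s = (b - a) * k ^ n * exp A"
  have F: "F \<in> cone A" using ab(1) by (simp add: F_def)
  have "nuF (\<lambda>x. a * (P ^^ n) r x) \<le> nuF ((P ^^ n) f)"
    by (intro nuF_mono FX_scale P_iter_FX fX r_FX) (use ab(3)[of n] in auto)
  then have an: "a \<le> nuF f" using kn by (simp add: nuF_scale P_iter_FX fX r_FX nuF_P_iter nuF_r)
  have "nuF ((P ^^ n) f) \<le> nuF (\<lambda>x. b * (P ^^ n) r x)"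
    by (intro nuF_mono FX_scale P_iter_FX fX r_FX) (use ab(4)[of n] in auto)
  then have nb: "nuF f \<le> b" using kn by (simp add: nuF_scale P_iter_FX fX r_FX nuF_P_iter nuF_r)
  have Fs: "F z \<le> s" if z: "z \<in> X" for z
  proof -
    have "F z \<le> (b - a) * (k ^ n * r z)" using ab(4)[of n z] z by (simp add: F_def P_iter_r algebra_simps)
    also have "\<dots> \<le> (b - a) * (k ^ n * exp A)"
      using r_bounds(1)[OF z] an nb kn by (intro mult_left_mono) auto
    finally show ?thesis by (simp add: s_def mult.assoc)
  qed
  define t where "t = k ^ n * (nuF f - a)"
  have t: "0 \<le> t" using an kn by (simp add: t_def)
  have tr: "(\<lambda>v. t * r v) \<in> cone A" using cone_scale[OF r_cone t] cone_mono[of "A - 1" A] by auto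
  have trs: "t * r z \<le> s" if z: "z \<in> X" for z
  proof -
    have "t * r z \<le> (k ^ n * (b - a)) * exp A"
      unfolding t_def using r_bounds(1)[OF z] r_pos_X[OF z] an nb kn by (intro mult_mono) auto
    then show ?thesis by (simp add: s_def mult_ac)
  qed
  have R: "R n f z = F z - t * r z" for z
    by (simp add: R_def F_def t_def P_iter_r algebra_simps)
  have "b - a \<le> \<theta> ^ n * (f x0 * (exp A / eta))"
  proof -
    have "f x0 / (eta * r x0) = f x0 / eta * (1 / r x0)" by simp
    also have "\<dots> \<le> f x0 / eta * exp A"
      using r_bounds(2)[OF x0] r_pos_X[OF x0] f0 eta unfolding exp_minus
      by (intro mult_left_mono) (auto simp: field_simps)
    finally have "\<theta> ^ n * (f x0 / (eta * r x0)) \<le> \<theta> ^ n * (f x0 / eta * exp A)"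
      using \<theta> by (intro mult_left_mono) auto
    then show ?thesis using ab(2) by simp
  qed
  then have "s \<le> (\<theta> ^ n * (f x0 * (exp A / eta))) * k ^ n * exp A"
    unfolding s_def using kn by (intro mult_right_mono) auto
  then have s: "s \<le> exp A / eta * exp A * (f x0 * (k * \<theta>) ^ n)"
    by (simp add: power_mult_distrib mult_ac)
  have "\<bar>R n f x\<bar> \<le> s"
    using Fs[OF x] trs[OF x] coneD(2)[OF F x] coneD(2)[OF tr x] unfolding R by (simp add: abs_le_iff)
  with s show "\<bar>R n f x\<bar> \<le> exp A / eta * exp A * (f x0 * (k * \<theta>) ^ n)" by simp
  have A0: "0 \<le> A" using A_ge by simp
  have "\<bar>F x - F y\<bar> \<le> A * exp A * s * \<delta> x y" by (rule cone_lip[OF F A0 x y Fs])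
  moreover have "\<bar>t * r x - t * r y\<bar> \<le> A * exp A * s * \<delta> x y" by (rule cone_lip[OF tr A0 x y trs])
  ultimately have "\<bar>R n f x - R n f y\<bar> \<le> 2 * A * exp A * s * \<delta> x y"
    unfolding R by (simp add: abs_le_iff)
  also have "\<dots> \<le> 2 * A * exp A * (exp A / eta * exp A * (f x0 * (k * \<theta>) ^ n)) * \<delta> x y"
    using s A0 \<delta>_nonneg[OF inY[OF x] inY[OF y]] by (intro mult_right_mono mult_left_mono) auto
  finally show "\<bar>R n f x - R n f y\<bar> \<le> 2 * A * exp A * (exp A / eta * exp A) * (f x0 * (k * \<theta>) ^ n) * \<delta> x y"
    by (simp add: mult.assoc)
qed

text \<open>The 5 is 3 + 2: the shifted function is at most \<open>3 * a\<close> at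
  \<open>x0\<close>, and \<open>2 * a\<close> times the remainder of \<open>one\<close> is
  subtracted again.\<close>

definition CR :: real where "CR = 5 * (1 + 2 * A * exp A) * (exp A / eta * exp A)"

lemma CR_nonneg: "0 \<le> CR" using A_ge eta by (simp add: CR_def)

lemma R_bounds_X:
  assumes f: "f \<in> CY" and a: "0 \<le> a" "\<And>x. x \<in> X \<Longrightarrow> \<bar>f x\<bar> \<le> a"
    "\<And>u v. u \<in> X \<Longrightarrow> v \<in> X \<Longrightarrow> \<bar>f u - f v\<bar> \<le> a * \<delta> u v" and x: "x \<in> X" and y: "y \<in> X"
  shows "\<bar>R n f x\<bar> \<le> CR * a * (k * \<theta>) ^ n"
    "\<bar>R n f x - R n f y\<bar> \<le> CR * a * (k * \<theta>) ^ n * \<delta> x y"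
proof -
  define F where "F = (\<lambda>v. f v + 2 * a * one v)"
  define K where "K = exp A / eta * exp A"
  define q where "q = (k * \<theta>) ^ n"
  have Fc: "F \<in> cone (A - 1)" unfolding F_def by (rule shift_cone[OF f a])
  have fX: "f \<in> FX" using f a by (intro FX_I) auto
  have Rf: "R n f z = R n F z - 2 * a * R n one z" for z
    by (simp add: R_def F_def P_iter_add P_iter_scale nuF_add nuF_scale FX_scale FX_one fX f CY_scale CY_one algebra_simps)
  have F0: "F x0 \<le> 3 * a" using a(2)[OF x0] by (simp add: F_def one_X x0 abs_le_iff)
  have K: "0 \<le> K" using eta by (simp add: K_def)
  have q: "0 \<le> q" using k_pos \<theta> by (simp add: q_def)
  have d: "0 \<le> \<delta> x y" using x y \<delta>_nonneg inY by auto
  have A0: "0 \<le> A" using A_ge by simp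
  have 1: "\<bar>R n F x\<bar> \<le> K * (3 * a * q)"
  proof -
    have "\<bar>R n F x\<bar> \<le> K * (F x0 * q)" using R_cone(1)[OF Fc x x] by (simp add: K_def q_def)
    also have "\<dots> \<le> K * (3 * a * q)" using F0 K q by (intro mult_left_mono mult_right_mono) auto
    finally show ?thesis .
  qed
  have 2: "\<bar>R n one x\<bar> \<le> K * q" using R_cone(1)[OF one_cone x x] by (simp add: K_def q_def one_X x0)
  have "\<bar>2 * a * R n one x\<bar> \<le> 2 * a * (K * q)" unfolding abs_mult using 2 a(1) by (intro mult_mono) auto
  then have "\<bar>R n F x - 2 * a * R n one x\<bar> \<le> K * (3 * a * q) + 2 * a * (K * q)" using 1 by linarith
  then have "\<bar>R n f x\<bar> \<le> 1 * (5 * K * a * q)" unfolding Rf by (simp add: algebra_simps)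
  also have "\<dots> \<le> (1 + 2 * A * exp A) * (5 * K * a * q)"
    using A0 K a(1) q by (intro mult_right_mono) auto
  also have "\<dots> = CR * a * q" unfolding CR_def K_def by (simp only: mult_ac)
  finally show "\<bar>R n f x\<bar> \<le> CR * a * (k * \<theta>) ^ n" by (simp only: q_def)
  have 3: "\<bar>R n F x - R n F y\<bar> \<le> 2 * A * exp A * K * (3 * a * q) * \<delta> x y"
  proof -
    have "\<bar>R n F x - R n F y\<bar> \<le> 2 * A * exp A * K * (F x0 * q) * \<delta> x y"
      using R_cone(2)[OF Fc x y] by (simp add: K_def q_def)
    also have "\<dots> \<le> 2 * A * exp A * K * (3 * a * q) * \<delta> x y"
      using F0 K q d A0 by (intro mult_left_mono mult_right_mono) auto
    finally show ?thesis .
  qed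
  have 4: "\<bar>R n one x - R n one y\<bar> \<le> 2 * A * exp A * K * q * \<delta> x y"
    using R_cone(2)[OF one_cone x y] by (simp add: K_def q_def one_X x0)
  have "\<bar>2 * a * (R n one x - R n one y)\<bar> \<le> 2 * a * (2 * A * exp A * K * q * \<delta> x y)"
    unfolding abs_mult using 4 a(1) by (intro mult_mono) auto
  then have "\<bar>(R n F x - R n F y) - 2 * a * (R n one x - R n one y)\<bar>
      \<le> 2 * A * exp A * K * (3 * a * q) * \<delta> x y + 2 * a * (2 * A * exp A * K * q * \<delta> x y)"
    using 3 by linarith
  also have "(R n F x - R n F y) - 2 * a * (R n one x - R n one y) = R n f x - R n f y"
    unfolding Rf by (simp add: algebra_simps)
  also have "2 * A * exp A * K * (3 * a * q) * \<delta> x y + 2 * a * (2 * A * exp A * K * q * \<delta> x y)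
      = 2 * A * exp A * (5 * K * a * q * \<delta> x y)" by (simp add: algebra_simps)
  also have "\<dots> \<le> (1 + 2 * A * exp A) * (5 * K * a * q * \<delta> x y)"
    using K a(1) q d by (intro mult_right_mono) auto
  also have "\<dots> = CR * a * q * \<delta> x y" unfolding CR_def K_def by (simp only: mult_ac)
  finally show "\<bar>R n f x - R n f y\<bar> \<le> CR * a * (k * \<theta>) ^ n * \<delta> x y" by (simp only: q_def)
qed

text \<open>The bounds on \<open>X\<close> at time \<open>n - 1\<close> followed by one application
  of \<open>P\<close>; dividing by \<open>k * \<theta>\<close> restores the exponent
  \<open>n\<close>. Hence \<open>R_bounds\<close> begins at \<open>n = 1\<close>.\<close>

definition CS :: real where "CS = (Wbar * (1 + L + c)) * CR / (k * \<theta>)"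

lemma CS_nonneg: "0 \<le> CS" using CR_nonneg Wbar_nonneg L c k_pos \<theta> by (simp add: CS_def)

theorem R_bounds:
  assumes f: "f \<in> CY" and a: "0 \<le> a" "\<And>x. x \<in> X \<Longrightarrow> \<bar>f x\<bar> \<le> a"
    "\<And>u v. u \<in> X \<Longrightarrow> v \<in> X \<Longrightarrow> \<bar>f u - f v\<bar> \<le> a * \<delta> u v" and u: "u \<in> Y" and v: "v \<in> Y" and n: "1 \<le> n"
  shows "\<bar>R n f u\<bar> \<le> CS * a * (k * \<theta>) ^ n"
    "\<bar>R n f u - R n f v\<bar> \<le> CS * a * (k * \<theta>) ^ n * \<delta> u v"
proof -
  obtain m where m: "n = Suc m" using n by (cases n) auto
  define b where "b = CR * a * (k * \<theta>) ^ m"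
  have b: "0 \<le> b" using CR_nonneg a(1) k_pos \<theta> by (simp add: b_def)
  have d: "0 \<le> \<delta> u v" using u v \<delta>_nonneg by auto
  have W: "0 \<le> Wbar" by (rule Wbar_nonneg)
  have CSb: "CS * a * (k * \<theta>) ^ n = (Wbar * (1 + L + c)) * b"
    using k_pos \<theta> by (simp add: CS_def b_def m field_simps)
  note bd = R_bounds_X[OF f a, of _ _ m, folded b_def]
  have "\<bar>R n f u\<bar> \<le> Wbar * b" unfolding m R_Suc[OF f] by (intro P_bound R_CY f u bd) auto
  also have "\<dots> \<le> (Wbar * (1 + L + c)) * b" using W L c b by (intro mult_right_mono) (auto simp: mult_left_le algebra_simps)
  finally show "\<bar>R n f u\<bar> \<le> CS * a * (k * \<theta>) ^ n" by (simp add: CSb)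
  have "\<bar>R n f u - R n f v\<bar> \<le> Wbar * (L * b + c * b) * \<delta> u v"
    unfolding m R_Suc[OF f] by (intro P_lip R_CY f u v bd b) auto
  also have "\<dots> \<le> (Wbar * (1 + L + c)) * b * \<delta> u v"
    using W L c b d by (intro mult_right_mono) (auto simp: algebra_simps)
  finally show "\<bar>R n f u - R n f v\<bar> \<le> CS * a * (k * \<theta>) ^ n * \<delta> u v" by (simp add: CSb)
qed

end

subsection \<open>The eigenmeasure\<close>

lemma measure_eqI_open_restrict:
  fixes M N :: "'a::topological_space measure"
  assumes Y: "Y \<in> sets borel"
    and "sets M = sets (restrict_space borel Y)" "sets N = sets (restrict_space borel Y)"
    and fin: "emeasure M Y \<noteq> \<infinity>"
    and eq: "\<And>U. open U \<Longrightarrow> emeasure M (Y \<inter> U) = emeasure N (Y \<inter> U)"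
  shows "M = N"
proof (rule measure_eqI_generator_eq[where E="(\<inter>) Y ` {U. open U}" and \<Omega>=Y and A="\<lambda>_. Y"])
  show "Int_stable ((\<inter>) Y ` {U. open U})"
  proof (rule Int_stableI)
    fix a b assume "a \<in> (\<inter>) Y ` {U. open U}" "b \<in> (\<inter>) Y ` {U. open U}"
    then obtain U V where "open U" "open V" "a = Y \<inter> U" "b = Y \<inter> V" by auto
    then have "open (U \<inter> V)" "a \<inter> b = Y \<inter> (U \<inter> V)" by auto
    then show "a \<inter> b \<in> (\<inter>) Y ` {U. open U}" by blast
  qed
  have "sets (restrict_space borel Y) = (\<inter>) Y ` sigma_sets UNIV {U. open U}"
    by (simp add: sets_restrict_space borel_def)
  also have "\<dots> = sigma_sets Y ((\<inter>) Y ` {U. open U})"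
    using Y by (intro sigma_sets_Int) (auto simp: borel_def)
  finally show "sets M = sigma_sets Y ((\<inter>) Y ` {U. open U})" "sets N = sigma_sets Y ((\<inter>) Y ` {U. open U})"
    using assms by auto
  show "range (\<lambda>_. Y) \<subseteq> (\<inter>) Y ` {U. open U}" using open_UNIV by (auto intro!: image_eqI[of _ _ UNIV])
  show "emeasure M X = emeasure N X" if "X \<in> (\<inter>) Y ` {U. open U}" for X using that eq by auto
qed (use fin in auto)

context contracting_transfer begin

text \<open>Unlike \<open>CY\<close> and \<open>FX\<close> this class does not ask for vanishing
  outside \<open>Y\<close>, since constants and \<open>infdist\<close> have to belong to it;
  \<open>res\<close> passes from it to the others.\<close>

definition FL :: "('a \<Rightarrow> real) set" where
  "FL = {f. continuous_on Y f \<and> (\<exists>C\<ge>0. \<forall>u\<in>Y. \<forall>v\<in>Y. \<bar>f u - f v\<bar> \<le> C * \<delta> u v)}"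

lemma FL_I: "continuous_on Y f \<Longrightarrow> 0 \<le> C \<Longrightarrow> (\<And>u v. u \<in> Y \<Longrightarrow> v \<in> Y \<Longrightarrow> \<bar>f u - f v\<bar> \<le> C * \<delta> u v) \<Longrightarrow> f \<in> FL"
  by (auto simp: FL_def)

lemma FL_E:
  assumes "f \<in> FL"
  obtains C where "continuous_on Y f" "0 \<le> C" "\<And>u v. u \<in> Y \<Longrightarrow> v \<in> Y \<Longrightarrow> \<bar>f u - f v\<bar> \<le> C * \<delta> u v"
  using assms by (auto simp: FL_def)

definition res :: "('a \<Rightarrow> real) \<Rightarrow> 'a \<Rightarrow> real" where "res f x = one x * f x"

lemma res_Y: "x \<in> Y \<Longrightarrow> res f x = f x" by (simp add: res_def one_def)

lemma res_CY_id: "f \<in> CY \<Longrightarrow> res f = f"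
  by (auto simp: res_def one_def CY_def indicator_def fun_eq_iff)

lemma res_CY: "continuous_on Y f \<Longrightarrow> res f \<in> CY"
  by (subst CY_def) (simp add: res_def one_def cong: continuous_on_cong)

lemma res_FX: assumes "f \<in> FL" shows "res f \<in> FX"
proof -
  obtain C where C: "continuous_on Y f" "0 \<le> C" "\<And>u v. u \<in> Y \<Longrightarrow> v \<in> Y \<Longrightarrow> \<bar>f u - f v\<bar> \<le> C * \<delta> u v"
    using FL_E[OF assms] by blast
  show ?thesis by (rule FX_I[OF res_CY[OF C(1)] C(2)]) (use C(3) inY in \<open>auto simp: res_Y\<close>)
qed

lemma P_FL: assumes "f \<in> FX" shows "P f \<in> FL"
proof -
  obtain a where a: "0 \<le> a" "\<And>x. x \<in> X \<Longrightarrow> \<bar>f x\<bar> \<le> a" "\<And>u v. u \<in> X \<Longrightarrow> v \<in> X \<Longrightarrow> \<bar>f u - f v\<bar> \<le> a * \<delta> u v"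
    using FX_bounds[OF assms] by blast
  have "0 \<le> Wbar * (L * a + c * a)" using a c L Wbar_nonneg by simp
  then show ?thesis
    using P_lip[OF FX_CY[OF assms] a(2,3,1)] by (intro FL_I[OF CY_cont[OF P_CY[OF FX_CY[OF assms]]]]) auto
qed

lemma FL_add: assumes "f \<in> FL" "hh \<in> FL" shows "(\<lambda>x. f x + hh x) \<in> FL"
proof -
  obtain C where C: "continuous_on Y f" "0 \<le> C" "\<And>u v. u \<in> Y \<Longrightarrow> v \<in> Y \<Longrightarrow> \<bar>f u - f v\<bar> \<le> C * \<delta> u v"
    using FL_E[OF assms(1)] by blast
  obtain D where D: "continuous_on Y hh" "0 \<le> D" "\<And>u v. u \<in> Y \<Longrightarrow> v \<in> Y \<Longrightarrow> \<bar>hh u - hh v\<bar> \<le> D * \<delta> u v"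
    using FL_E[OF assms(2)] by blast
  show ?thesis
  proof (rule FL_I[where C="C + D"])
    fix u v assume "u \<in> Y" "v \<in> Y"
    then show "\<bar>f u + hh u - (f v + hh v)\<bar> \<le> (C + D) * \<delta> u v"
      using C(3)[of u v] D(3)[of u v] unfolding distrib_right by linarith
  qed (use C D in \<open>auto intro: continuous_on_add\<close>)
qed

lemma FL_mult: assumes "f \<in> FL" "hh \<in> FL" shows "(\<lambda>x. f x * hh x) \<in> FL"
proof -
  obtain C where C: "continuous_on Y f" "0 \<le> C" "\<And>u v. u \<in> Y \<Longrightarrow> v \<in> Y \<Longrightarrow> \<bar>f u - f v\<bar> \<le> C * \<delta> u v"
    using FL_E[OF assms(1)] by blast
  obtain D where D: "continuous_on Y hh" "0 \<le> D" "\<And>u v. u \<in> Y \<Longrightarrow> v \<in> Y \<Longrightarrow> \<bar>hh u - hh v\<bar> \<le> D * \<delta> u v"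
    using FL_E[OF assms(2)] by blast
  obtain M where M: "0 < M" "\<And>v. \<bar>res f v\<bar> \<le> M" using CY_bdd[OF res_CY[OF C(1)]] by auto
  obtain N where N: "0 < N" "\<And>v. \<bar>res hh v\<bar> \<le> N" using CY_bdd[OF res_CY[OF D(1)]] by auto
  show ?thesis
  proof (rule FL_I[where C="C * N + M * D"])
    fix u v assume uv: "u \<in> Y" "v \<in> Y"
    have "\<bar>(f u - f v) * hh u\<bar> \<le> (C * \<delta> u v) * N"
      unfolding abs_mult using C(2) C(3)[OF uv] N(2)[of u] uv \<delta>_nonneg[OF uv] by (intro mult_mono) (auto simp: res_Y)
    moreover have "\<bar>f v * (hh u - hh v)\<bar> \<le> M * (D * \<delta> u v)"
      unfolding abs_mult using M(1) D(3)[OF uv] M(2)[of v] uv by (intro mult_mono) (auto simp: res_Y)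
    moreover have "f u * hh u - f v * hh v = (f u - f v) * hh u + f v * (hh u - hh v)" by (simp add: algebra_simps)
    ultimately have "\<bar>f u * hh u - f v * hh v\<bar> \<le> (C * \<delta> u v) * N + M * (D * \<delta> u v)" by linarith
    then show "\<bar>f u * hh u - f v * hh v\<bar> \<le> (C * N + M * D) * \<delta> u v" by (simp add: algebra_simps)
  qed (use C D M N in \<open>auto intro: continuous_on_mult\<close>)
qed

lemma FL_const: "(\<lambda>x. b) \<in> FL" by (rule FL_I[where C=0]) auto

lemma FL_infdist: "(\<lambda>x. infdist x S) \<in> FL"
proof (rule FL_I[where C="max D 0"])
  fix u v assume uv: "u \<in> Y" "v \<in> Y"
  have "\<bar>infdist u S - infdist v S\<bar> \<le> dist u v" by (rule infdist_triangle_abs)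
  also have "\<dots> \<le> D * \<delta> u v" by (rule dist_le[OF uv])
  also have "\<dots> \<le> max D 0 * \<delta> u v" using \<delta>_nonneg[OF uv] by (intro mult_right_mono) auto
  finally show "\<bar>infdist u S - infdist v S\<bar> \<le> max D 0 * \<delta> u v" .
qed (auto intro!: continuous_intros)

lemma FL_max: assumes "f \<in> FL" shows "(\<lambda>x. max 0 (f x)) \<in> FL"
proof -
  obtain C where C: "continuous_on Y f" "0 \<le> C" "\<And>u v. u \<in> Y \<Longrightarrow> v \<in> Y \<Longrightarrow> \<bar>f u - f v\<bar> \<le> C * \<delta> u v"
    using FL_E[OF assms(1)] by blast
  show ?thesis
  proof (rule FL_I[OF _ C(2)])
    fix u v assume "u \<in> Y" "v \<in> Y"
    from C(3)[OF this] show "\<bar>max 0 (f u) - max 0 (f v)\<bar> \<le> C * \<delta> u v" by linarith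
  qed (intro continuous_intros C)
qed

lemma FL_scale: "f \<in> FL \<Longrightarrow> (\<lambda>x. b * f x) \<in> FL"
  using FL_mult[OF FL_const] .

text \<open>Stone-Weierstrass: \<open>FL\<close> is an algebra containing the constants, and
  \<open>infdist\<close> to a point separates that point from every other one.\<close>

lemma Y_approx: assumes "f \<in> CY" "0 < e" shows "\<exists>g\<in>FL. \<forall>x\<in>Y. \<bar>f x - g x\<bar> < e"
proof -
  interpret function_ring_on FL Y
  proof
    fix x y assume xy: "x \<in> Y" "y \<in> Y" "x \<noteq> y"
    have "infdist x {x} \<noteq> infdist y {x}" using xy by simp
    then show "\<exists>f\<in>FL. f x \<noteq> f y" by (intro bexI[OF _ FL_infdist[of "{x}"]])
  qed (use compact_Y FL_add FL_mult FL_const in \<open>auto elim: FL_E\<close>)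
  show ?thesis by (rule Stone_Weierstrass_basic[OF CY_cont[OF assms(1)] assms(2)])
qed

definition Lam :: "('a \<Rightarrow> real) \<Rightarrow> real" where "Lam f = nuF (res f)"

lemma positive_functional_Lam: "positive_functional Y FL Lam"
proof
  fix f hh :: "'a \<Rightarrow> real" and b :: real
  assume f: "f \<in> FL" and hh: "hh \<in> FL"
  show "Lam (\<lambda>x. f x + hh x) = Lam f + Lam hh"
    using nuF_add[OF res_FX[OF f] res_FX[OF hh]] by (simp add: Lam_def res_def[abs_def] distrib_left)
  show "Lam f \<le> Lam hh" if "\<And>x. x \<in> Y \<Longrightarrow> f x \<le> hh x"
    unfolding Lam_def using that inY by (intro nuF_mono res_FX f hh) (auto simp: res_Y)
next
  fix f :: "'a \<Rightarrow> real" and b :: real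
  assume f: "f \<in> FL"
  show "Lam (\<lambda>x. b * f x) = b * Lam f"
    using nuF_scale[OF res_FX[OF f], of b] by (simp add: Lam_def res_def[abs_def] mult.left_commute)
next
  have "res (\<lambda>x. 1) = one" by (simp add: res_def fun_eq_iff)
  then show "Lam (\<lambda>x. 1) = 1" by (simp add: Lam_def nuF_one)
qed (use compact_Y Y_ne FL_add FL_scale FL_const FL_infdist FL_max in \<open>auto elim: FL_E\<close>)

interpretation Rz: positive_functional Y FL Lam by (rule positive_functional_Lam)

definition nuM :: "'a measure" where
  "nuM = restrict_space (positive_functional.rep_measure Y FL Lam) Y"

lemma sets_nuM: "sets nuM = sets (restrict_space borel Y)"
  unfolding nuM_def by (rule sets_restrict_space_cong) simp

lemma prob_nuM: "prob_space nuM"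
proof -
  interpret p: prob_space Rz.rep_measure by (rule Rz.prob_space_rep_measure)
  have "emeasure Rz.rep_measure Y = 1"
    using p.prob_eq_1[of Y] Rz.AE_rep_measure by (simp add: p.emeasure_eq_measure)
  then show ?thesis unfolding nuM_def by (intro prob_space_restrict_space) auto
qed

lemma integral_nuM: "(\<integral>x. f x \<partial>nuM) = (\<integral>x. indicator Y x * f x \<partial>Rz.rep_measure)" for f :: "'a \<Rightarrow> real"
  unfolding nuM_def by (subst integral_restrict_space) auto

lemma nuM_FL: "f \<in> FL \<Longrightarrow> (\<integral>x. f x \<partial>nuM) = nuF (res f)"
  unfolding integral_nuM by (simp add: Rz.integral_rep Lam_def)

section \<open>Integration against a probability measure on \<open>Y\<close>\<close>

context
  fixes \<eta> :: "'a measure"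
  assumes prob_eta: "prob_space \<eta>" and sets_eta: "sets \<eta> = sets (restrict_space borel Y)"
begin

lemma space_eta: "space \<eta> = Y"
  using sets_eq_imp_space_eq[OF sets_eta] by (simp add: space_restrict_space)

lemma CY_meas_eta: "f \<in> CY \<Longrightarrow> f \<in> borel_measurable \<eta>"
  using measurable_restrict_space1[OF CY_meas, of f Y] measurable_cong_sets[OF sets_eta refl] by auto

lemma CY_int_eta: assumes "f \<in> CY" shows "integrable \<eta> f"
proof -
  interpret e: prob_space \<eta> by (rule prob_eta)
  obtain B where "\<And>v. \<bar>f v\<bar> \<le> B" using CY_bdd[OF assms] by auto
  then show ?thesis by (intro e.integrable_const_bound[of _ B] CY_meas_eta assms) auto
qed

lemma eta_bound: assumes "f \<in> CY" "\<And>x. x \<in> Y \<Longrightarrow> \<bar>f x\<bar> \<le> B" shows "\<bar>\<integral>x. f x \<partial>\<eta>\<bar> \<le> B"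
proof -
  interpret e: prob_space \<eta> by (rule prob_eta)
  have "norm (\<integral>x. f x \<partial>\<eta>) \<le> (\<integral>x. B \<partial>\<eta>)"
    using assms by (intro integral_norm_bound_AE CY_int_eta e.integrable_const) (auto simp: space_eta)
  then show ?thesis by (simp add: e.prob_space)
qed

lemma eta_one: "(\<integral>x. one x \<partial>\<eta>) = 1"
proof -
  interpret e: prob_space \<eta> by (rule prob_eta)
  have "(\<integral>x. one x \<partial>\<eta>) = (\<integral>x. 1 \<partial>\<eta>)"
    by (intro Bochner_Integration.integral_cong) (auto simp: space_eta one_def)
  then show ?thesis using e.prob_space by simp
qed

lemma eta_res: "(\<integral>x. res f x \<partial>\<eta>) = (\<integral>x. f x \<partial>\<eta>)"
  by (intro Bochner_Integration.integral_cong) (auto simp: space_eta res_Y)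

end

lemma nuM_FX: assumes "f \<in> FL" "f \<in> CY" shows "(\<integral>x. f x \<partial>nuM) = nuF f"
  using nuM_FL[OF assms(1)] res_CY_id[OF assms(2)] by simp

text \<open>For Lipschitz functions this is \<open>nuF_P\<close>, because \<open>P\<close> maps
  \<open>FX\<close> into \<open>FL\<close>, where integrals are given by \<open>nuF\<close>. Both
  sides are continuous in the supremum norm, with constants \<open>Wbar\<close> and
  \<open>k\<close>, so density extends the identity to \<open>CY\<close>.\<close>

lemma nuM_P: assumes f: "f \<in> CY" shows "(\<integral>x. P f x \<partial>nuM) = k * (\<integral>x. f x \<partial>nuM)"
proof -
  note [simp] = CY_int_eta[OF prob_nuM sets_nuM]
  have "\<bar>(\<integral>x. P f x \<partial>nuM) - k * (\<integral>x. f x \<partial>nuM)\<bar> \<le> 0 + d" if d: "0 < d" for d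
  proof -
    define e where "e = d / (Wbar + k)"
    have Wk: "0 < Wbar + k" using Wbar_nonneg k_pos by simp
    have e: "0 < e" using d Wk by (simp add: e_def)
    obtain g where g: "g \<in> FL" "\<And>x. x \<in> Y \<Longrightarrow> \<bar>f x - g x\<bar> < e" using Y_approx[OF f e] by blast
    define q where "q = res g"
    have q: "q \<in> FX" "q \<in> CY" using res_FX[OF g(1)] FX_CY by (auto simp: q_def)
    have fq: "\<bar>f x - q x\<bar> \<le> e" if "x \<in> Y" for x using g(2)[OF that] that by (simp add: q_def res_Y)
    have "(\<integral>x. P q x \<partial>nuM) = nuF (P q)" by (intro nuM_FX P_FL P_CY q)
    also have "\<dots> = k * (\<integral>x. q x \<partial>nuM)"
      using nuM_FL[OF g(1)] eta_res[OF prob_nuM sets_nuM, of g] by (simp add: q_def nuF_P res_FX g)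
    finally have 1: "(\<integral>x. P q x \<partial>nuM) = k * (\<integral>x. q x \<partial>nuM)" .
    have "\<bar>\<integral>x. P (\<lambda>x. f x - q x) x \<partial>nuM\<bar> \<le> Wbar * e"
      using fq inY by (intro eta_bound[OF prob_nuM sets_nuM] P_CY CY_diff f q P_bound) auto
    then have 2: "\<bar>(\<integral>x. P f x \<partial>nuM) - (\<integral>x. P q x \<partial>nuM)\<bar> \<le> Wbar * e"
      by (simp add: P_diff f q P_CY)
    have "\<bar>\<integral>x. f x - q x \<partial>nuM\<bar> \<le> e"
      using fq by (intro eta_bound[OF prob_nuM sets_nuM] CY_diff f q) auto
    then have "\<bar>(\<integral>x. f x \<partial>nuM) - (\<integral>x. q x \<partial>nuM)\<bar> \<le> e" by (simp add: f q)
    then have "\<bar>k * ((\<integral>x. f x \<partial>nuM) - (\<integral>x. q x \<partial>nuM))\<bar> \<le> k * e" using k_pos by (simp add: abs_mult)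
    with 1 2 have "\<bar>(\<integral>x. P f x \<partial>nuM) - k * (\<integral>x. f x \<partial>nuM)\<bar> \<le> Wbar * e + k * e"
      unfolding right_diff_distrib by linarith
    also have "\<dots> = d" unfolding distrib_right[symmetric] using Wk by (simp add: e_def)
    finally show ?thesis by simp
  qed
  then have "\<bar>(\<integral>x. P f x \<partial>nuM) - k * (\<integral>x. f x \<partial>nuM)\<bar> \<le> 0" by (rule field_le_epsilon)
  then show ?thesis by simp
qed

text \<open>\<open>nuF\<close> sees only values on \<open>X\<close>, so it annihilates the distance
  to \<open>X\<close>; a nonnegative function with integral 0 vanishes almost everywhere.\<close>

lemma AE_nuM_X: "AE x in nuM. x \<in> X"
proof -
  have cl: "closed X" using compact_X by (rule compact_imp_closed)
  define f where "f = res (\<lambda>x. infdist x X)"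
  have f: "f \<in> FX" "f \<in> CY" unfolding f_def using res_FX[OF FL_infdist] FX_CY by auto
  have "nuF f \<le> 0" "0 \<le> nuF f"
    by (intro nuF_le nuF_ge f; simp add: f_def res_Y inY)+
  then have "(\<integral>x. f x \<partial>nuM) = 0"
    using nuM_FL[OF FL_infdist, of X] eta_res[OF prob_nuM sets_nuM, of "\<lambda>x. infdist x X"] by (simp add: f_def)
  moreover have "AE x in nuM. 0 \<le> f x" by (simp add: f_def res_def one_def infdist_nonneg)
  ultimately have "AE x in nuM. f x = 0"
    using integral_nonneg_eq_0_iff_AE[OF CY_int_eta[OF prob_nuM sets_nuM f(2)]] by simp
  moreover have "AE x in nuM. x \<in> Y"
    using AE_space[of nuM] by (simp add: space_eta[OF prob_nuM sets_nuM])
  ultimately show ?thesis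
  proof eventually_elim
    case (elim x)
    then have "infdist x X = 0" by (simp add: f_def res_Y)
    then show ?case using in_closed_iff_infdist_zero[OF cl X_ne] by simp
  qed
qed

lemma r_FL: "r \<in> FL"
proof -
  have "(\<lambda>v. (1 / k) * P r v) \<in> FL" by (intro FL_scale P_FL r_FX)
  then show ?thesis using k_pos by (simp add: P_r)
qed

lemma nuM_r: "(\<integral>x. r x \<partial>nuM) = 1"
  using nuM_FX[OF r_FL r_CY] nuF_r by simp

text \<open>For an eigenmeasure the integral of \<open>R n q\<close> is \<open>k ^ n\<close> times a
  number independent of \<open>n\<close>, yet it is bounded by a multiple of
  \<open>(k * \<theta>) ^ n\<close>. That number is therefore 0, and \<open>\<eta>\<close> is
  proportional to \<open>nuF\<close>; the choice \<open>q = one\<close> fixes the factor.\<close>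

lemma integral_eigenmeasure:
  assumes prob: "prob_space \<eta>" and sets: "sets \<eta> = sets (restrict_space borel Y)"
    and eig: "\<And>f. f \<in> CY \<Longrightarrow> (\<integral>x. P f x \<partial>\<eta>) = k * (\<integral>x. f x \<partial>\<eta>)"
    and g: "g \<in> FL"
  shows "(\<integral>x. g x \<partial>\<eta>) = nuF (res g)"
proof -
  note int = CY_int_eta[OF prob sets]
  have key: "(\<integral>x. q x \<partial>\<eta>) = nuF q * (\<integral>x. r x \<partial>\<eta>)" if q: "q \<in> FX" for q
  proof -
    have qC: "q \<in> CY" by (rule FX_CY[OF q])
    obtain a where a: "0 \<le> a" "\<And>x. x \<in> X \<Longrightarrow> \<bar>q x\<bar> \<le> a" "\<And>u v. u \<in> X \<Longrightarrow> v \<in> X \<Longrightarrow> \<bar>q u - q v\<bar> \<le> a * \<delta> u v"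
      using FX_bounds[OF q] by blast
    have it: "(\<integral>x. (P ^^ n) q x \<partial>\<eta>) = k ^ n * (\<integral>x. q x \<partial>\<eta>)" for n
      by (induction n) (auto simp: eig P_iter_CY qC)
    define z where "z = \<bar>(\<integral>x. q x \<partial>\<eta>) - nuF q * (\<integral>x. r x \<partial>\<eta>)\<bar>"
    have "z \<le> CS * a * \<theta> ^ n" if n: "1 \<le> n" for n
    proof -
      have "\<bar>\<integral>x. R n q x \<partial>\<eta>\<bar> \<le> CS * a * (k * \<theta>) ^ n"
        by (intro eta_bound[OF prob sets] R_CY qC R_bounds(1)[OF qC a _ _ n])
      also have "(\<integral>x. R n q x \<partial>\<eta>) = k ^ n * ((\<integral>x. q x \<partial>\<eta>) - nuF q * (\<integral>x. r x \<partial>\<eta>))"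
        unfolding R_def using int[OF P_iter_CY[OF qC]] int[OF r_CY] by (simp add: it right_diff_distrib)
      finally have "k ^ n * z \<le> k ^ n * (CS * a * \<theta> ^ n)"
        using k_pos by (simp add: abs_mult z_def power_mult_distrib mult_ac)
      then show ?thesis using k_pos by simp
    qed
    moreover have "(\<lambda>n. CS * a * \<theta> ^ n) \<longlonglongrightarrow> CS * a * 0"
      using \<theta> by (intro tendsto_mult_left LIMSEQ_power_zero) auto
    ultimately have "z \<le> 0" by (intro LIMSEQ_le_const[of _ "0::real" z]) auto
    then show ?thesis by (simp add: z_def)
  qed
  have "(\<integral>x. r x \<partial>\<eta>) = 1" using key[OF FX_one] eta_one[OF prob sets] by (simp add: nuF_one)
  then show ?thesis using key[OF res_FX[OF g]] eta_res[OF prob sets] by simp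
qed

text \<open>Bumps belong to \<open>FL\<close>, on which the two integrals agree, and converge to
  indicators of open sets; these generate the sigma-algebra and are stable under
  intersection.\<close>

lemma eigenmeasure_unique:
  assumes prob: "prob_space \<eta>" and sets: "sets \<eta> = sets (restrict_space borel Y)"
    and eig: "\<And>f. f \<in> CY \<Longrightarrow> (\<integral>x. P f x \<partial>\<eta>) = k * (\<integral>x. f x \<partial>\<eta>)"
  shows "\<eta> = nuM"
proof (rule measure_eqI_open_restrict[OF borel_Y sets sets_nuM])
  interpret e: prob_space \<eta> by (rule prob)
  show "emeasure \<eta> Y \<noteq> \<infinity>" by simp
  fix U :: "'a set" assume U: "open U"
  have lim: "(\<lambda>n. \<integral>x. Rz.bump U n x \<partial>M) \<longlonglongrightarrow> measure M (Y \<inter> U)"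
    if M: "prob_space M" "sets M = sets (restrict_space borel Y)" for M
  proof -
    interpret m: prob_space M by (rule M)
    have sp: "space M = Y" by (rule space_eta[OF M])
    have b: "0 \<le> Rz.bump U n x" "Rz.bump U n x \<le> 1" "x \<notin> U \<Longrightarrow> Rz.bump U n x = 0" if "x \<in> Y" for n x
      using Rz.bump_tests[of U n] that by (auto simp: Rz.tests_def)
    have YU: "Y \<inter> U \<in> sets M" using U by (auto simp: M(2) sets_restrict_space)
    have "(\<lambda>n. \<integral>x. Rz.bump U n x \<partial>M) \<longlonglongrightarrow> (\<integral>x. indicator (Y \<inter> U) x \<partial>M)"
    proof (rule integral_dominated_convergence[where w="\<lambda>_. 1"])
      show "(\<lambda>x. Rz.bump U n x) \<in> borel_measurable M" for n
      proof -
        have "Rz.bump U n \<in> borel_measurable borel"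
          unfolding Rz.bump_def[abs_def] by (cases "U = UNIV") (auto intro!: borel_measurable_continuous_onI continuous_intros)
        then have "Rz.bump U n \<in> borel_measurable (restrict_space borel Y)" by (rule measurable_restrict_space1)
        then show ?thesis by (simp only: measurable_cong_sets[OF M(2) refl])
      qed
      show "AE x in M. (\<lambda>n. Rz.bump U n x) \<longlonglongrightarrow> indicator (Y \<inter> U) x"
      proof (rule AE_I2)
        fix x assume "x \<in> space M"
        then have x: "x \<in> Y" by (simp add: sp)
        show "(\<lambda>n. Rz.bump U n x) \<longlonglongrightarrow> indicator (Y \<inter> U) x"
        proof (cases "x \<in> U")
          case True
          then obtain N where N: "Rz.bump U N x = 1" using Rz.bump_tendsto[OF U] by blast
          have "Rz.bump U n x = 1" if "N \<le> n" for n
            using Rz.bump_mono[OF that, of U x] b(2)[OF x, of n] N by linarith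
          then show ?thesis using True x
            by (intro tendsto_eventually) (auto simp: eventually_sequentially)
        qed (use b(3)[OF x] in simp)
      qed
      show "AE x in M. norm (Rz.bump U n x) \<le> 1" for n
        using b by (intro AE_I2) (auto simp: sp)
    qed (use YU in auto)
    then show ?thesis using YU by (simp add: sets.Int_space_eq2)
  qed
  have "(\<integral>x. Rz.bump U n x \<partial>\<eta>) = (\<integral>x. Rz.bump U n x \<partial>nuM)" for n
    using Rz.bump_tests[of U n] integral_eigenmeasure[OF prob sets eig] nuM_FL by (simp add: Rz.tests_def)
  then have "measure \<eta> (Y \<inter> U) = measure nuM (Y \<inter> U)"
    using LIMSEQ_unique[OF lim[OF prob sets]] lim[OF prob_nuM sets_nuM] by simp
  then show "emeasure \<eta> (Y \<inter> U) = emeasure nuM (Y \<inter> U)"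
    by (simp add: e.emeasure_eq_measure finite_measure.emeasure_eq_measure[OF prob_space.finite_measure[OF prob_nuM]])
qed

text \<open>Positivity on the compact set \<open>X\<close> gives \<open>nuF f > 0\<close>, and
  \<open>nuF\<close> applied to the eigenvalue equation forces \<open>b = k\<close>. Then
  \<open>R n f\<close> is \<open>k ^ n\<close> times \<open>f - nuF f * r\<close> and decays faster
  than \<open>k ^ n\<close>.\<close>

lemma eigenfunction_unique:
  assumes f: "f \<in> FX" and pos: "\<And>x. x \<in> X \<Longrightarrow> 0 < f x" and eig: "P f = (\<lambda>v. b * f v)"
  shows "b = k" "0 < nuF f" "v \<in> Y \<Longrightarrow> f v = nuF f * r v"
proof -
  have fC: "f \<in> CY" by (rule FX_CY[OF f])
  obtain x1 where x1: "x1 \<in> X" "\<And>x. x \<in> X \<Longrightarrow> f x1 \<le> f x"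
    using continuous_attains_inf[OF compact_X X_ne continuous_on_subset[OF CY_cont[OF fC] XY]] by blast
  have "f x1 \<le> nuF f" by (intro nuF_ge f x1)
  then show p: "0 < nuF f" using pos[OF x1(1)] by linarith
  show b: "b = k" using nuF_P[OF f] nuF_scale[OF f, of b] p by (simp add: eig)
  show "f v = nuF f * r v" if v: "v \<in> Y"
  proof -
    obtain a where a: "0 \<le> a" "\<And>x. x \<in> X \<Longrightarrow> \<bar>f x\<bar> \<le> a" "\<And>u v. u \<in> X \<Longrightarrow> v \<in> X \<Longrightarrow> \<bar>f u - f v\<bar> \<le> a * \<delta> u v"
      using FX_bounds[OF f] by blast
    have it: "(P ^^ n) f = (\<lambda>v. k ^ n * f v)" for n by (induction n) (auto simp: eig b P_scale)
    define z where "z = \<bar>f v - nuF f * r v\<bar>"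
    have "z \<le> CS * a * \<theta> ^ n" if n: "1 \<le> n" for n
    proof -
      have "\<bar>R n f v\<bar> \<le> CS * a * (k * \<theta>) ^ n" by (rule R_bounds(1)[OF fC a v v n])
      also have "R n f v = k ^ n * (f v - nuF f * r v)" by (simp add: R_def it right_diff_distrib)
      finally have "k ^ n * z \<le> k ^ n * (CS * a * \<theta> ^ n)"
        using k_pos by (simp add: abs_mult z_def power_mult_distrib mult_ac)
      then show ?thesis using k_pos by simp
    qed
    moreover have "(\<lambda>n. CS * a * \<theta> ^ n) \<longlonglongrightarrow> CS * a * 0"
      using \<theta> by (intro tendsto_mult_left LIMSEQ_power_zero) auto
    ultimately have "z \<le> 0" by (intro LIMSEQ_le_const[of _ "0::real" z]) auto
    then show ?thesis by (simp add: z_def)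
  qed
qed

end

subsection \<open>Products of positive random matrices\<close>

lemma continuous_on_matrix_vector_mult [continuous_intros]:
  fixes f :: "'a::topological_space \<Rightarrow> real^'n^'m"
  assumes "continuous_on S f" "continuous_on S h"
  shows "continuous_on S (\<lambda>x. f x *v h x)"
  unfolding matrix_vector_mult_def using assms
  by (intro continuous_on_vec_lambda continuous_intros) auto

lemma continuous_on_matrix_matrix_mult [continuous_intros]:
  fixes f :: "'a::topological_space \<Rightarrow> real^'n^'m"
  assumes "continuous_on S f" "continuous_on S h"
  shows "continuous_on S (\<lambda>x. f x ** h x)"
  unfolding matrix_matrix_mult_def using assms
  by (intro continuous_on_vec_lambda continuous_intros) auto

lemma continuous_on_vnorm [continuous_intros]:
  "continuous_on S f \<Longrightarrow> continuous_on S (\<lambda>x. vnorm (f x))"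
  unfolding vnorm_def by (intro continuous_intros)

lemma borel_measurable_matrix_vector_mult [measurable (raw)]:
  fixes f :: "'a \<Rightarrow> real^'n^'m"
  assumes "f \<in> borel_measurable M" "h \<in> borel_measurable M"
  shows "(\<lambda>x. f x *v h x) \<in> borel_measurable M"
  by (rule borel_measurable_continuous_Pair[OF assms]) (intro continuous_intros)

lemma borel_measurable_matrix_matrix_mult [measurable (raw)]:
  fixes f :: "'a \<Rightarrow> real^'n^'m"
  assumes "f \<in> borel_measurable M" "h \<in> borel_measurable M"
  shows "(\<lambda>x. f x ** h x) \<in> borel_measurable M"
  by (rule borel_measurable_continuous_Pair[OF assms]) (intro continuous_intros)

lemma borel_measurable_vnorm [measurable (raw)]:
  "f \<in> borel_measurable M \<Longrightarrow> (\<lambda>x. vnorm (f x)) \<in> borel_measurable M"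
  by (rule borel_measurable_continuous_on[of vnorm]) (intro continuous_intros)

lemma borel_measurable_mnorm [measurable]: "mnorm \<in> borel_measurable borel"
  unfolding mnorm_def[abs_def] by (intro borel_measurable_continuous_onI continuous_intros)

lemma borel_measurable_transpose [measurable]:
  "(transpose :: real^'n^'m \<Rightarrow> real^'m^'n) \<in> borel_measurable borel"
  unfolding transpose_def[abs_def]
  by (intro borel_measurable_continuous_onI continuous_on_vec_lambda continuous_intros)

lemma borel_measurable_act [measurable (raw)]:
  assumes "f \<in> borel_measurable M" "h \<in> borel_measurable M"
  shows "(\<lambda>x. act (f x) (h x)) \<in> borel_measurable M"
  unfolding act_def using assms by measurable

section \<open>The simplex and its inner part\<close>

lemma compact_simplex: "compact (simplex_S :: (real^'d) set)"
proof (rule compact_eq_bounded_closed[THEN iffD2], rule conjI)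
  show "bounded (simplex_S :: (real^'d) set)"
    unfolding bounded_iff
  proof (intro exI ballI)
    fix x :: "real^'d" assume "x \<in> simplex_S"
    then have "vnorm x = 1" by (simp add: simplex_S_def)
    then show "norm x \<le> 1" using norm_le_l1_cart[of x] unfolding vnorm_def by linarith
  qed
  have "closed {v :: real^'d. \<forall>i. 0 \<le> v $ i}" "closed {v :: real^'d. vnorm v = 1}"
    by (intro closed_Collect_all closed_Collect_le closed_Collect_eq continuous_intros)+
  then show "closed (simplex_S :: (real^'d) set)"
    unfolding simplex_S_def Collect_conj_eq by (rule closed_Int)
qed

definition barycenter :: "real^'d" where
  "barycenter = (\<chi> i. 1 / real CARD('d))"

lemma barycenter_in_simplex: "barycenter \<in> simplex_S"
  by (simp add: simplex_S_def vnorm_def barycenter_def)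

text \<open>The compact part of the interior of the simplex into which matrices with \<open>\<kappa>\<close>-comparable
  entries in each column send everything.\<close>

definition simplex_K :: "real \<Rightarrow> (real^'d) set" where
  "simplex_K \<kappa> = {v \<in> simplex_S. \<forall>i j. v $ i \<le> \<kappa> * v $ j}"

lemma compact_simplex_K: "compact (simplex_K \<kappa> :: (real^'d) set)"
proof -
  have "closed {v :: real^'d. \<forall>i j. v $ i \<le> \<kappa> * v $ j}"
    by (intro closed_Collect_all closed_Collect_le continuous_intros)
  then have "compact (simplex_S \<inter> {v :: real^'d. \<forall>i j. v $ i \<le> \<kappa> * v $ j})"
    by (rule compact_Int_closed[OF compact_simplex])
  also have "simplex_S \<inter> {v :: real^'d. \<forall>i j. v $ i \<le> \<kappa> * v $ j} = simplex_K \<kappa>"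
    by (auto simp: simplex_K_def)
  finally show ?thesis .
qed

lemma barycenter_in_simplex_K: "1 \<le> \<kappa> \<Longrightarrow> barycenter \<in> simplex_K \<kappa>"
  using barycenter_in_simplex by (auto simp: simplex_K_def barycenter_def divide_right_mono)

lemma simplex_K_ge:
  fixes v :: "real^'d"
  assumes "v \<in> simplex_K \<kappa>" "0 < \<kappa>"
  shows "1 / (\<kappa> * real CARD('d)) \<le> v $ j"
proof -
  have "1 = (\<Sum>i\<in>UNIV. v $ i)" using assms simplex_D(2)[of v] by (simp add: simplex_K_def)
  also have "\<dots> \<le> (\<Sum>i\<in>(UNIV::'d set). \<kappa> * v $ j)" using assms by (intro sum_mono) (auto simp: simplex_K_def)
  finally show ?thesis using assms(2) by (simp add: field_simps)
qed

text \<open>Here \<open>y\<close> stands for \<open>m_ratio u v * m_ratio v u\<close>. The two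
  numbers agree up to the factor \<open>y\<close>, their powers up to \<open>y ^ N\<close>, and
  Bernoulli's inequality makes \<open>1 - y ^ N\<close> linear in \<open>1 - y\<close>; the natural
  number \<open>N \<ge> \<bar>s\<bar>\<close> brings the real exponent within its reach. The case
  \<open>y = 0\<close> has to be covered, since it occurs for points with different zero
  sets.\<close>

lemma powr_diff_bound:
  fixes a b y s M :: real
  assumes ab: "0 \<le> a" "0 \<le> b" and neg: "s < 0 \<Longrightarrow> 0 < a \<and> 0 < b" and s: "s \<noteq> 0"
    and y: "0 \<le> y" "y \<le> 1" "y * b \<le> a" "y * a \<le> b" and N: "\<bar>s\<bar> \<le> real N"
    and M: "a powr s \<le> M" "b powr s \<le> M"
  shows "\<bar>a powr s - b powr s\<bar> \<le> M * real N * (1 - y)"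
proof -
  have bern: "1 - real N * (1 - y) \<le> y ^ N"
    using Bernoulli_inequality[of "y - 1" N] y by (simp add: algebra_simps)
  have N0: "0 < N" using N s by (cases N) auto
  have half: "y ^ N * p powr s \<le> q powr s"
    if pq: "0 \<le> p" "0 \<le> q" "s < 0 \<Longrightarrow> 0 < p \<and> 0 < q" "y * p \<le> q" "y * q \<le> p" for p q
  proof (cases "y = 0")
    case True then show ?thesis using N0 by (simp add: zero_power)
  next
    case False
    then have y0: "0 < y" using y by simp
    have "y ^ N = y powr real N" using y0 by (simp add: powr_realpow)
    also have "\<dots> \<le> y powr \<bar>s\<bar>" using y0 y N by (intro powr_mono') auto
    finally have "y ^ N \<le> y powr \<bar>s\<bar>" .
    then have "y ^ N * p powr s \<le> y powr \<bar>s\<bar> * p powr s" by (intro mult_right_mono) auto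
    also have "\<dots> \<le> q powr s"
    proof (cases "s < 0")
      case False
      then have "y powr \<bar>s\<bar> * p powr s = (y * p) powr s" using y0 pq by (simp add: powr_mult)
      also have "\<dots> \<le> q powr s" using False y0 pq by (intro powr_mono2) auto
      finally show ?thesis .
    next
      case True
      then have p: "0 < p" "0 < q" using pq by auto
      have "p powr s \<le> (y * q) powr s" using True pq p y0 by (intro powr_mono2') auto
      also have "\<dots> = y powr s * q powr s" using p y0 by (simp add: powr_mult)
      finally have "y powr \<bar>s\<bar> * p powr s \<le> y powr \<bar>s\<bar> * (y powr s * q powr s)"
        by (intro mult_left_mono) auto
      also have "\<dots> = q powr s" using True y0 by (simp add: powr_minus field_simps)
      finally show ?thesis .
    qed
    finally show ?thesis .
  qed
  have fin: "p - q \<le> M * real N * (1 - y)" if "y ^ N * p \<le> q" "0 \<le> p" "p \<le> M" for p q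
  proof -
    have "p - q \<le> (1 - y ^ N) * p" using that by (simp add: algebra_simps)
    also have "\<dots> \<le> (real N * (1 - y)) * M"
      using bern that y by (intro mult_mono) auto
    finally show ?thesis by (simp add: mult_ac)
  qed
  show ?thesis
    using fin[OF half[OF ab neg y(4,3)] _ M(1)] fin[OF half[OF ab(2,1) _ y(3,4)] _ M(2)] neg
    by (auto simp: abs_le_iff)
qed

text \<open>Unlike an additive bound, one for logarithms involves the quotient of the two numbers,
  which must be bounded by some \<open>B\<close>. This is the source of the restriction of
  \<open>w_log\<close> to \<open>X\<close>.\<close>

lemma powr_log_bound:
  fixes a b y s B :: real
  assumes ab: "0 < a" "0 < b" and y: "y \<le> 1" "y * b \<le> a" "y * a \<le> b" and B: "a \<le> B * b" "b \<le> B * a"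
  shows "a powr s \<le> exp (\<bar>s\<bar> * B * (1 - y)) * b powr s"
proof -
  have half: "ln p - ln q \<le> B * (1 - y)" if pq: "0 < p" "0 < q" "y * p \<le> q" "p \<le> B * q" for p q
  proof -
    have "ln p - ln q = ln (p / q)" using pq by (simp add: ln_div)
    also have "\<dots> \<le> p / q - 1" using pq by (intro ln_le_minus_one) auto
    also have "\<dots> = (p - q) / q" using pq by (simp add: field_simps)
    also have "\<dots> \<le> ((1 - y) * p) / q" using pq by (intro divide_right_mono) (auto simp: algebra_simps)
    also have "\<dots> = (1 - y) * (p / q)" by simp
    also have "\<dots> \<le> (1 - y) * B" using pq y by (intro mult_left_mono) (auto simp: field_simps)
    finally show ?thesis by (simp add: mult.commute)
  qed
  have "\<bar>ln a - ln b\<bar> \<le> B * (1 - y)" using half[of a b] half[of b a] ab y B by (auto simp: abs_le_iff)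
  then have "\<bar>s * (ln a - ln b)\<bar> \<le> \<bar>s\<bar> * (B * (1 - y))" unfolding abs_mult by (intro mult_left_mono) auto
  then have "s * ln a \<le> \<bar>s\<bar> * B * (1 - y) + s * ln b" by (simp add: algebra_simps abs_le_iff)
  then have "exp (s * ln a) \<le> exp (\<bar>s\<bar> * B * (1 - y) + s * ln b)" by simp
  then show ?thesis using ab by (simp add: powr_def exp_add mult.commute)
qed

lemma m_ratio_vnorm:
  fixes h :: "real^'d^'d"
  assumes h: "pos_matrix h" and u: "u \<in> simplex_S" and v: "v \<in> simplex_S"
  shows "m_ratio u v * vnorm (h *v v) \<le> vnorm (h *v u)"
proof -
  have nn: "0 \<le> (h *v w) $ i" if "w \<in> simplex_S" for w i
    using pos_matrix_mult_pos(1)[OF h that] by (simp add: less_imp_le)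
  have "m_ratio u v * (h *v v) $ i \<le> (h *v u) $ i" for i
  proof -
    have "m_ratio u v * (h *v v) $ i = (\<Sum>j\<in>UNIV. h $ i $ j * (m_ratio u v * v $ j))"
      by (simp add: matrix_vector_mult_def sum_distrib_left mult_ac)
    also have "\<dots> \<le> (h *v u) $ i" unfolding matrix_vector_mult_def
      using h m_ratio_mult_le[OF u v] by (auto intro!: sum_mono mult_left_mono simp: pos_matrix_def less_imp_le)
    finally show ?thesis .
  qed
  then have "(\<Sum>i\<in>UNIV. m_ratio u v * (h *v v) $ i) \<le> (\<Sum>i\<in>UNIV. (h *v u) $ i)" by (intro sum_mono)
  then show ?thesis using nn u v by (simp add: vnorm_eq_sum sum_distrib_left)
qed

text \<open>The Lipschitz constant \<open>2 * N * B\<close> serves the additive and the logarithmic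
  estimate at once: 2 comes from replacing \<open>1 - m_ratio u v * m_ratio v u\<close> by
  \<open>d_hilbert\<close>, \<open>N\<close> from the power \<open>s\<close>, and \<open>B\<close>
  from comparability of the norms on \<open>X\<close>.\<close>

lemma transfer_instance:
  fixes \<mu> :: "(real^'d^'d) measure" and X :: "(real^'d) set"
  assumes prob: "prob_space \<mu>" and sets: "sets \<mu> = sets borel"
    and mom: "integrable \<mu> (\<lambda>g. mnorm g powr s)"
    and s: "s \<noteq> 0" and \<gamma>: "0 < \<gamma>" "\<gamma> \<le> 1"
    and X: "compact X" "X \<subseteq> simplex_S" "X \<noteq> {}"
    and good: "AE g in \<mu>. good g" "\<And>g. good g \<Longrightarrow> pos_matrix g"
    and T: "\<And>g v. good g \<Longrightarrow> v \<in> simplex_S \<Longrightarrow> act g v \<in> X"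
    and C: "\<And>g v. good g \<Longrightarrow> v \<in> simplex_S \<Longrightarrow> vnorm (g *v v) powr s \<le> C * mnorm g powr s"
    and c0: "0 \<le> c0" "c0 < 1"
      "\<And>g u v. good g \<Longrightarrow> u \<in> simplex_S \<Longrightarrow> v \<in> simplex_S \<Longrightarrow> d_hilbert (act g u) (act g v) \<le> c0 * d_hilbert u v"
    and B: "1 \<le> B" "\<And>g u v. good g \<Longrightarrow> u \<in> X \<Longrightarrow> v \<in> X \<Longrightarrow> vnorm (g *v u) \<le> B * vnorm (g *v v)"
    and N: "\<bar>s\<bar> \<le> real N"
  shows "contracting_transfer \<mu> X simplex_S act (\<lambda>g v. vnorm (g *v v) powr s) (\<lambda>g. C * mnorm g powr s)
    (\<lambda>u v. d_hilbert u v powr \<gamma>) (c0 powr \<gamma>) (2 * real N * B) (2 * real CARD('d)) good"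
proof -
  interpret prob_space \<mu> by (rule prob)
  have d_le: "d_hilbert u v \<le> d_hilbert u v powr \<gamma>" if "u \<in> simplex_S" "v \<in> simplex_S" for u v :: "real^'d"
  proof -
    have d: "0 \<le> d_hilbert u v" "d_hilbert u v \<le> 1" using d_hilbert_nonneg d_hilbert_le_1 that by auto
    show ?thesis
    proof (cases "d_hilbert u v = 0")
      case False
      then have "d_hilbert u v powr 1 \<le> d_hilbert u v powr \<gamma>" using d \<gamma> by (intro powr_mono') auto
      then show ?thesis using d by simp
    qed simp
  qed
  have y_le: "1 - m_ratio u v * m_ratio v u \<le> 2 * d_hilbert u v powr \<gamma>"
    if "u \<in> simplex_S" "v \<in> simplex_S" for u v :: "real^'d"
    using one_minus_m_ratio_prod_le[OF that] d_le[OF that] by linarith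
  have ratio: "(m_ratio u v * m_ratio v u) * vnorm (g *v v) \<le> vnorm (g *v u)"
      "(m_ratio u v * m_ratio v u) * vnorm (g *v u) \<le> vnorm (g *v v)"
    if g: "good g" and uv: "u \<in> simplex_S" "v \<in> simplex_S" for g and u v :: "real^'d"
  proof -
    note p = good(2)[OF g]
    have "(m_ratio u v * m_ratio v u) * vnorm (g *v v) \<le> m_ratio u v * vnorm (g *v v)"
      using m_ratio_prod[OF uv] vnorm_nonneg by (intro mult_right_mono) auto
    also have "\<dots> \<le> vnorm (g *v u)" by (rule m_ratio_vnorm[OF p uv])
    finally show "(m_ratio u v * m_ratio v u) * vnorm (g *v v) \<le> vnorm (g *v u)" .
    have "(m_ratio u v * m_ratio v u) * vnorm (g *v u) \<le> m_ratio v u * vnorm (g *v u)"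
      using m_ratio_prod[OF uv] vnorm_nonneg by (intro mult_right_mono) auto
    also have "\<dots> \<le> vnorm (g *v v)" by (rule m_ratio_vnorm[OF p uv(2,1)])
    finally show "(m_ratio u v * m_ratio v u) * vnorm (g *v u) \<le> vnorm (g *v v)" .
  qed
  have XS: "x \<in> X \<Longrightarrow> x \<in> simplex_S" for x using X(2) by auto
  have NB: "real N \<le> real N * B" using B(1) by (simp add: mult_left_mono[of 1 B "real N", simplified])
  show ?thesis
  proof
    fix v :: "real^'d" assume "v \<in> simplex_S"
    have [measurable_cong]: "sets \<mu> = sets borel" by (rule sets)
    show "(\<lambda>g. act g v) \<in> borel_measurable \<mu>" by measurable
    show "(\<lambda>g. vnorm (g *v v) powr s) \<in> borel_measurable \<mu>" by measurable
  next
    show "integrable \<mu> (\<lambda>g. C * mnorm g powr s)" using mom by simp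
  next
    fix g assume g: "good g"
    note p = good(2)[OF g]
    have nz: "vnorm (g *v v) \<noteq> 0" if "v \<in> simplex_S" for v
      using pos_matrix_mult_pos(2)[OF p that] by simp
    show "continuous_on simplex_S (act g)"
      unfolding act_def[abs_def] using nz by (intro continuous_intros) auto
    show "continuous_on simplex_S (\<lambda>v. vnorm (g *v v) powr s)"
      using nz by (intro continuous_intros) auto
    fix u :: "real^'d" assume u: "u \<in> simplex_S"
    show "act g u \<in> X" by (rule T[OF g u])
    show "0 < vnorm (g *v u) powr s" using nz[OF u] by simp
    show "vnorm (g *v u) powr s \<le> C * mnorm g powr s" by (rule C[OF g u])
    fix v :: "real^'d" assume v: "v \<in> simplex_S"
    have "d_hilbert (act g u) (act g v) powr \<gamma> \<le> (c0 * d_hilbert u v) powr \<gamma>"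
      using c0(3)[OF g u v] d_hilbert_nonneg act_in_simplex[OF p] u v \<gamma> by (intro powr_mono2) auto
    then show "d_hilbert (act g u) (act g v) powr \<gamma> \<le> c0 powr \<gamma> * d_hilbert u v powr \<gamma>"
      using c0 d_hilbert_nonneg[OF u v] by (simp add: powr_mult)
    have W: "0 \<le> C * mnorm g powr s" using C[OF g u] by (meson order_trans powr_ge_zero)
    have "\<bar>vnorm (g *v u) powr s - vnorm (g *v v) powr s\<bar> \<le> C * mnorm g powr s * real N * (1 - m_ratio u v * m_ratio v u)"
      using pos_matrix_mult_pos(2)[OF p] u v m_ratio_prod[OF u v] ratio[OF g u v] C[OF g]
      by (intro powr_diff_bound s N vnorm_nonneg) auto
    also have "\<dots> \<le> C * mnorm g powr s * real N * (2 * d_hilbert u v powr \<gamma>)"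
      using y_le[OF u v] W by (intro mult_left_mono) auto
    also have "\<dots> \<le> C * mnorm g powr s * (real N * B) * (2 * d_hilbert u v powr \<gamma>)"
      using NB W by (intro mult_right_mono mult_left_mono) auto
    finally show "\<bar>vnorm (g *v u) powr s - vnorm (g *v v) powr s\<bar>
        \<le> C * mnorm g powr s * (2 * real N * B) * d_hilbert u v powr \<gamma>" by (simp add: mult_ac)
  next
    fix g u v assume g: "good g" and uX: "u \<in> X" and vX: "v \<in> X"
    note p = good(2)[OF g] and u = XS[OF uX] and v = XS[OF vX]
    have "vnorm (g *v u) powr s \<le> exp (\<bar>s\<bar> * B * (1 - m_ratio u v * m_ratio v u)) * vnorm (g *v v) powr s"
      using pos_matrix_mult_pos(2)[OF p] u v m_ratio_prod[OF u v] ratio[OF g u v] B(2)[OF g] uX vX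
      by (intro powr_log_bound) auto
    also have "\<dots> \<le> exp (2 * real N * B * d_hilbert u v powr \<gamma>) * vnorm (g *v v) powr s"
    proof -
      have "\<bar>s\<bar> * B * (1 - m_ratio u v * m_ratio v u) \<le> (real N * B) * (2 * d_hilbert u v powr \<gamma>)"
        using y_le[OF u v] m_ratio_prod[OF u v] N B(1) by (intro mult_mono) auto
      then show ?thesis by (intro mult_right_mono) (auto simp: mult_ac)
    qed
    finally show "vnorm (g *v u) powr s \<le> exp (2 * real N * B * d_hilbert u v powr \<gamma>) * vnorm (g *v v) powr s" .
  next
    fix u v :: "real^'d" assume u: "u \<in> simplex_S" and v: "v \<in> simplex_S"
    show "0 \<le> d_hilbert u v powr \<gamma>" by simp
    show "d_hilbert u v powr \<gamma> \<le> 1"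
      using d_hilbert_nonneg[OF u v] d_hilbert_le_1[OF u v] \<gamma> by (intro powr_le1) auto
    have "dist u v \<le> 2 * real CARD('d) * d_hilbert u v" by (rule norm_diff_le_d_hilbert[OF u v])
    also have "\<dots> \<le> 2 * real CARD('d) * d_hilbert u v powr \<gamma>"
      using d_le[OF u v] by (intro mult_left_mono) auto
    finally show "dist u v \<le> 2 * real CARD('d) * d_hilbert u v powr \<gamma>" .
  next
    fix u v :: "real^'d"
    show "d_hilbert u v powr \<gamma> = d_hilbert v u powr \<gamma>" by (simp add: d_hilbert_commute)
  next
    have "c0 powr \<gamma> < 1 powr \<gamma>" using c0 \<gamma> by (intro powr_less_mono2) auto
    then show "c0 powr \<gamma> < 1" by simp
  qed (use X compact_simplex good(1) B(1) in auto)
qed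

section \<open>Matrices with comparable entries in columns or in rows\<close>

definition col_comparable :: "real \<Rightarrow> real^'d^'d \<Rightarrow> bool" where
  "col_comparable \<kappa> h \<longleftrightarrow> pos_matrix h \<and> (\<forall>i i' j. h $ i $ j \<le> \<kappa> * h $ i' $ j)"

definition row_comparable :: "real \<Rightarrow> real^'d^'d \<Rightarrow> bool" where
  "row_comparable \<kappa> h \<longleftrightarrow> pos_matrix h \<and> (\<forall>i j j'. h $ i $ j \<le> \<kappa> * h $ i $ j')"

lemma vnorm_add_scaleR:
  assumes "\<And>i. 0 \<le> x $ i" "\<And>i. 0 \<le> y $ i" "0 \<le> c"
  shows "vnorm (x + c *\<^sub>R y) = vnorm x + c * vnorm y"
  using assms by (simp add: vnorm_eq_sum sum.distrib sum_distrib_left)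

lemma col_comparable_mult:
  assumes h: "col_comparable \<kappa> h" and x: "\<And>i. 0 \<le> x $ i"
  shows "(h *v x) $ i \<le> \<kappa> * (h *v x) $ i'"
proof -
  have "h $ i $ j * x $ j \<le> \<kappa> * (h $ i' $ j * x $ j)" for j
    using h mult_right_mono[OF _ x[of j], of "h $ i $ j" "\<kappa> * h $ i' $ j"] by (simp add: col_comparable_def mult.assoc)
  then show ?thesis unfolding matrix_vector_mult_def by (simp add: sum_distrib_left sum_mono)
qed

text \<open>The coordinates of \<open>h *v x\<close> agree up to the factor \<open>\<kappa>\<close>,
  so each is at least the fraction \<open>1 / (\<kappa> * real CARD('d))\<close> of their sum; this
  fraction is the contraction parameter. The last claim holds on \<open>simplex_K\<close>, where the
  coordinates of the arguments are bounded below.\<close>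

lemma col_comparable_facts:
  fixes h :: "real^'d^'d"
  assumes h: "col_comparable \<kappa> h" and \<kappa>: "1 < \<kappa>"
  shows "v \<in> simplex_S \<Longrightarrow> act h v \<in> simplex_K \<kappa>"
    and "u \<in> simplex_S \<Longrightarrow> v \<in> simplex_S \<Longrightarrow>
      d_hilbert (act h u) (act h v) \<le> (1 - (1 / (\<kappa> * real CARD('d)))\<^sup>2) * d_hilbert u v"
    and "u \<in> simplex_K \<kappa> \<Longrightarrow> v \<in> simplex_K \<kappa> \<Longrightarrow> vnorm (h *v u) \<le> (\<kappa> * real CARD('d)) * vnorm (h *v v)"
proof -
  have p: "pos_matrix h" using h by (simp add: col_comparable_def)
  have pn: "\<And>i j. 0 \<le> h $ i $ j" using p by (simp add: pos_matrix_def less_imp_le)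
  note nn = matrix_vector_mult_nonneg[OF pn]
  show "act h v \<in> simplex_K \<kappa>" if v: "v \<in> simplex_S"
    using act_in_simplex[OF p v] col_comparable_mult[OF h simplex_D(1)[OF v]] pos_matrix_mult_pos(2)[OF p v]
    by (auto simp: simplex_K_def act_nth divide_right_mono)
  have card: "1 \<le> real CARD('d)" by (simp add: Suc_leI)
  have kd: "1 \<le> \<kappa> * real CARD('d)" using \<kappa> card mult_mono[of 1 \<kappa> 1 "real CARD('d)"] by simp
  show "d_hilbert (act h u) (act h v) \<le> (1 - (1 / (\<kappa> * real CARD('d)))\<^sup>2) * d_hilbert u v"
    if uv: "u \<in> simplex_S" "v \<in> simplex_S" for u v
  proof (rule d_hilbert_contraction[OF p, where l="\<lambda>x. vnorm (h *v x)"])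
    show "0 < 1 / (\<kappa> * real CARD('d))" "1 / (\<kappa> * real CARD('d)) \<le> 1" using kd by auto
    show "0 < vnorm (h *v v)" if "v \<in> simplex_S" for v using pos_matrix_mult_pos(2)[OF p that] .
    show "vnorm (h *v (x + c *\<^sub>R y)) = vnorm (h *v x) + c * vnorm (h *v y)"
      if "\<And>i. 0 \<le> x $ i" "\<And>i. 0 \<le> y $ i" "0 \<le> c" for x y c
      using vnorm_add_scaleR[OF nn[OF that(1)] nn[OF that(2)] that(3)]
      by (simp add: matrix_vector_right_distrib matrix_vector_mult_scaleR)
    fix x y :: "real^'d" and i assume x: "\<And>i. 0 \<le> x $ i" and y: "y \<in> simplex_S"
    have hx: "0 \<le> (h *v x) $ i" by (rule nn[OF x])
    have "vnorm (h *v x) = (\<Sum>i'\<in>UNIV. (h *v x) $ i')" using nn[OF x] by (rule vnorm_eq_sum)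
    also have "\<dots> \<le> (\<Sum>i'\<in>(UNIV::'d set). \<kappa> * (h *v x) $ i)" by (intro sum_mono col_comparable_mult[OF h x])
    finally have 1: "1 / (\<kappa> * real CARD('d)) * vnorm (h *v x) \<le> (h *v x) $ i"
      using kd \<kappa> by (simp add: field_simps)
    have "(h *v y) $ i \<le> (\<Sum>i'\<in>UNIV. (h *v y) $ i')"
      using nn[OF simplex_D(1)[OF y]] by (intro member_le_sum) auto
    also have "\<dots> = vnorm (h *v y)" using nn[OF simplex_D(1)[OF y]] by (rule vnorm_eq_sum[symmetric])
    finally have 2: "(h *v y) $ i \<le> vnorm (h *v y)" .
    show "1 / (\<kappa> * real CARD('d)) * vnorm (h *v x) * (h *v y) $ i \<le> (h *v x) $ i * vnorm (h *v y)"
      using 1 2 hx nn[OF simplex_D(1)[OF y]] by (intro mult_mono) auto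
  qed (use uv in auto)
  show "vnorm (h *v u) \<le> (\<kappa> * real CARD('d)) * vnorm (h *v v)" if u: "u \<in> simplex_K \<kappa>" and v: "v \<in> simplex_K \<kappa>"
  proof -
    have S: "u \<in> simplex_S" "v \<in> simplex_S" using u v by (auto simp: simplex_K_def)
    have "u $ j \<le> (\<kappa> * real CARD('d)) * v $ j" for j
      using simplex_D(3)[OF S(1), of j] simplex_K_ge[OF v, of j] \<kappa> kd by (simp add: field_simps)
    then have "(h *v u) $ i \<le> (\<kappa> * real CARD('d)) * (h *v v) $ i" for i
      unfolding matrix_vector_mult_def using mult_left_mono[OF _ pn]
      by (force intro: sum_mono simp: sum_distrib_left mult.left_commute[of "\<kappa> * real CARD('d)"])
    then have "(\<Sum>i\<in>UNIV. (h *v u) $ i) \<le> (\<Sum>i\<in>UNIV. (\<kappa> * real CARD('d)) * (h *v v) $ i)"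
      by (intro sum_mono)
    then show ?thesis
      using nn[OF simplex_D(1)[OF S(1)]] nn[OF simplex_D(1)[OF S(2)]] by (simp add: vnorm_eq_sum sum_distrib_left)
  qed
qed

text \<open>On the simplex each coordinate of \<open>h *v y\<close> is a weighted mean of a row of
  \<open>h\<close>, hence agrees with any entry of that row up to the factor
  \<open>\<kappa>\<close>. The bounds are therefore free of the dimension and hold up to the
  boundary.\<close>

lemma row_comparable_facts:
  fixes h :: "real^'d^'d"
  assumes h: "row_comparable \<kappa> h" and \<kappa>: "1 < \<kappa>"
  shows "u \<in> simplex_S \<Longrightarrow> v \<in> simplex_S \<Longrightarrow>
      d_hilbert (act h u) (act h v) \<le> (1 - (1 / \<kappa>)\<^sup>2) * d_hilbert u v"
    and "u \<in> simplex_S \<Longrightarrow> v \<in> simplex_S \<Longrightarrow> vnorm (h *v u) \<le> \<kappa> * vnorm (h *v v)"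
proof -
  have p: "pos_matrix h" using h by (simp add: row_comparable_def)
  have pn: "\<And>i j. 0 \<le> h $ i $ j" using p by (simp add: pos_matrix_def less_imp_le)
  note nn = matrix_vector_mult_nonneg[OF pn]
  have cmp: "1 / \<kappa> * vnorm x * (h *v y) $ i \<le> (h *v x) $ i * vnorm y"
    if x: "\<And>i. 0 \<le> x $ i" and y: "y \<in> simplex_S" for x y i
  proof -
    have le: "(h *v y) $ i \<le> \<kappa> * h $ i $ j" for j
    proof -
      have "(h *v y) $ i \<le> (\<Sum>j'\<in>UNIV. (\<kappa> * h $ i $ j) * y $ j')"
        unfolding matrix_vector_mult_def using h simplex_D(1)[OF y]
        by (auto intro!: sum_mono mult_right_mono simp: row_comparable_def)
      also have "\<dots> = \<kappa> * h $ i $ j" using simplex_D(2)[OF y] by (simp flip: sum_distrib_left)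
      finally show ?thesis .
    qed
    have "1 / \<kappa> * vnorm x * (h *v y) $ i = (\<Sum>j\<in>UNIV. x $ j * ((h *v y) $ i / \<kappa>))"
      using x by (simp add: vnorm_eq_sum sum_distrib_right sum_divide_distrib)
    also have "\<dots> \<le> (\<Sum>j\<in>UNIV. x $ j * h $ i $ j)"
      using le \<kappa> x by (intro sum_mono mult_left_mono) (auto simp: field_simps)
    also have "\<dots> = (h *v x) $ i * vnorm y"
      using y by (simp add: matrix_vector_mult_def simplex_S_def mult.commute)
    finally show ?thesis .
  qed
  show "d_hilbert (act h u) (act h v) \<le> (1 - (1 / \<kappa>)\<^sup>2) * d_hilbert u v"
    if uv: "u \<in> simplex_S" "v \<in> simplex_S" for u v
  proof (rule d_hilbert_contraction[OF p, where l=vnorm])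
    show "0 < 1 / \<kappa>" "1 / \<kappa> \<le> 1" using \<kappa> by auto
    show "vnorm (x + c *\<^sub>R y) = vnorm x + c * vnorm y"
      if "\<And>i. 0 \<le> x $ i" "\<And>i. 0 \<le> y $ i" "0 \<le> c" for x y :: "real^'d" and c
      by (rule vnorm_add_scaleR[OF that])
  qed (use uv cmp in \<open>auto simp: simplex_S_def\<close>)
  show "vnorm (h *v u) \<le> \<kappa> * vnorm (h *v v)" if u: "u \<in> simplex_S" and v: "v \<in> simplex_S"
  proof -
    have "(h *v u) $ i \<le> \<kappa> * (h *v v) $ i" for i
      using cmp[OF simplex_D(1)[OF v] u, of i] u v \<kappa> by (simp add: simplex_S_def field_simps)
    then have "(\<Sum>i\<in>UNIV. (h *v u) $ i) \<le> (\<Sum>i\<in>UNIV. \<kappa> * (h *v v) $ i)" by (intro sum_mono)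
    then show ?thesis
      using nn[OF simplex_D(1)[OF u]] nn[OF simplex_D(1)[OF v]] by (simp add: vnorm_eq_sum sum_distrib_left)
  qed
qed

lemma vnorm_mult_le_mnorm:
  fixes h :: "real^'d^'d"
  assumes h: "pos_matrix h" and v: "v \<in> simplex_S"
  shows "vnorm (h *v v) \<le> mnorm h"
proof -
  have "(h *v v) $ i \<le> (\<Sum>j\<in>UNIV. h $ i $ j)" for i
    unfolding matrix_vector_mult_def using h simplex_D(3)[OF v]
    by (auto intro!: sum_mono mult_left_le simp: pos_matrix_def less_imp_le)
  then have "(\<Sum>i\<in>UNIV. (h *v v) $ i) \<le> mnorm h" unfolding mnorm_def by (intro sum_mono)
  then show ?thesis using pos_matrix_mult_pos(1)[OF h v] by (simp add: vnorm_eq_sum less_imp_le)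
qed

text \<open>Negative powers reverse inequalities: to dominate \<open>vnorm (h *v v) powr s\<close>
  by a multiple of \<open>mnorm h powr s\<close> one then needs \<open>vnorm (h *v v)\<close>
  bounded below, also at the vertices, and so comparability across columns.\<close>

lemma mnorm_le_vnorm_mult:
  fixes h :: "real^'d^'d"
  assumes h: "pos_matrix h" "\<And>i j i' j'. h $ i $ j \<le> \<kappa> * h $ i' $ j'" and \<kappa>: "1 < \<kappa>" and v: "v \<in> simplex_S"
  shows "mnorm h \<le> \<kappa> * real CARD('d) * vnorm (h *v v)"
proof -
  have row: "(\<Sum>j\<in>UNIV. h $ i $ j) \<le> \<kappa> * real CARD('d) * (h *v v) $ i" for i
  proof -
    have "h $ i $ j \<le> \<kappa> * (h *v v) $ i" for j
    proof -
      have "h $ i $ j = (\<Sum>j'\<in>UNIV. h $ i $ j * v $ j')" using simplex_D(2)[OF v] by (simp flip: sum_distrib_left)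
      also have "\<dots> \<le> (\<Sum>j'\<in>UNIV. (\<kappa> * h $ i $ j') * v $ j')"
        using h(2) simplex_D(1)[OF v] by (intro sum_mono mult_right_mono) auto
      finally show ?thesis by (simp add: matrix_vector_mult_def sum_distrib_left mult.assoc)
    qed
    then have "(\<Sum>j\<in>UNIV. h $ i $ j) \<le> (\<Sum>j\<in>(UNIV::'d set). \<kappa> * (h *v v) $ i)" by (intro sum_mono)
    then show ?thesis by (simp add: mult_ac)
  qed
  have "mnorm h \<le> (\<Sum>i\<in>UNIV. \<kappa> * real CARD('d) * (h *v v) $ i)" unfolding mnorm_def by (intro sum_mono row)
  then show ?thesis using pos_matrix_mult_pos(1)[OF h(1) v] by (simp add: vnorm_eq_sum less_imp_le sum_distrib_left)
qed

locale matrix_transfer =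
  contracting_transfer \<mu> X simplex_S act "\<lambda>g v. vnorm (g *v v) powr s" "\<lambda>g. C * mnorm g powr s"
    "\<lambda>u v. d_hilbert u v powr \<gamma>" c L D good
  for \<mu> :: "(real^'d^'d) measure" and X :: "(real^'d) set" and s C \<gamma> c L D :: real and good +
  assumes sets_mu [measurable_cong]: "sets \<mu> = sets borel"
    and s_nz: "s \<noteq> 0" and \<gamma>_pos: "0 < \<gamma>"
    and good_pos: "good g \<Longrightarrow> pos_matrix g"
begin

abbreviation "S \<equiv> simplex_S :: (real^'d) set"

lemma P_op_of_real: "P_op \<mu> s (\<lambda>v. complex_of_real (f v)) = (\<lambda>v. complex_of_real (P f v))"
  by (simp add: P_op_def P_def fun_eq_iff flip: of_real_mult)

lemma P_op_of_real_mult: "P_op \<mu> s (\<lambda>v. z * \<phi> v) = (\<lambda>v. z * P_op \<mu> s \<phi> v)"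
proof (rule ext)
  fix v
  have "(\<integral>g. complex_of_real (vnorm (g *v v) powr s) * (z * \<phi> (act g v)) \<partial>\<mu>)
      = (\<integral>g. z * (complex_of_real (vnorm (g *v v) powr s) * \<phi> (act g v)) \<partial>\<mu>)"
    by (simp add: mult.left_commute)
  then show "P_op \<mu> s (\<lambda>v. z * \<phi> v) v = z * P_op \<mu> s \<phi> v" by (simp add: P_op_def)
qed

definition CC :: "(real^'d \<Rightarrow> complex) set" where
  "CC = {\<phi>. continuous_on S \<phi> \<and> (\<forall>v. v \<notin> S \<longrightarrow> \<phi> v = 0)}"

lemma CC_Re: "\<phi> \<in> CC \<Longrightarrow> (\<lambda>v. Re (\<phi> v)) \<in> CY" and CC_Im: "\<phi> \<in> CC \<Longrightarrow> (\<lambda>v. Im (\<phi> v)) \<in> CY"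
  by (auto simp: CC_def CY_def intro!: continuous_intros)

lemma CC_of_real: "f \<in> CY \<Longrightarrow> (\<lambda>v. complex_of_real (f v)) \<in> CC"
  by (auto simp: CC_def CY_def intro!: continuous_intros)

lemma P_op_complex:
  assumes "\<phi> \<in> CC"
  shows "P_op \<mu> s \<phi> v = complex_of_real (P (\<lambda>v. Re (\<phi> v)) v) + \<i> * complex_of_real (P (\<lambda>v. Im (\<phi> v)) v)"
proof (cases "v \<in> S")
  case True
  have "(\<integral>g. complex_of_real (vnorm (g *v v) powr s) * \<phi> (act g v) \<partial>\<mu>)
    = (\<integral>g. complex_of_real (vnorm (g *v v) powr s * Re (\<phi> (act g v)))
          + \<i> * complex_of_real (vnorm (g *v v) powr s * Im (\<phi> (act g v))) \<partial>\<mu>)"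
    by (rule Bochner_Integration.integral_cong[OF refl]) (simp add: complex_eq_iff)
  also have "\<dots> = complex_of_real (\<integral>g. vnorm (g *v v) powr s * Re (\<phi> (act g v)) \<partial>\<mu>)
      + \<i> * complex_of_real (\<integral>g. vnorm (g *v v) powr s * Im (\<phi> (act g v)) \<partial>\<mu>)"
    using P_int[OF CC_Re[OF assms] True] P_int[OF CC_Im[OF assms] True]
    by (subst Bochner_Integration.integral_add) (auto simp del: of_real_mult)
  finally show ?thesis using True by (simp add: P_op_def P_def del: of_real_mult)
qed (simp add: P_op_def P_def)

text \<open>Complex test functions split into real and imaginary parts, for which
  \<open>eigenmeasure_unique\<close> and \<open>nuM_P\<close> give the two directions. As an
  equivalence it also evaluates the \<open>THE\<close> in \<open>nu\<close>.\<close>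

lemma prob_eigenmeasure_iff:
  "prob_eigenmeasure (P_op \<mu> s) k \<eta> \<longleftrightarrow> \<eta> = nuM"
proof
  assume eig: "prob_eigenmeasure (P_op \<mu> s) k \<eta>"
  show "\<eta> = nuM"
  proof (rule eigenmeasure_unique)
    fix f assume "f \<in> CY"
    then have "(\<integral>v. P_op \<mu> s (\<lambda>v. complex_of_real (f v)) v \<partial>\<eta>) = complex_of_real k * (\<integral>v. complex_of_real (f v) \<partial>\<eta>)"
      using eig CC_of_real[of f] by (simp add: prob_eigenmeasure_def CC_def)
    then have "complex_of_real (\<integral>v. P f v \<partial>\<eta>) = complex_of_real (k * (\<integral>v. f v \<partial>\<eta>))"
      by (simp add: P_op_of_real)
    then show "(\<integral>v. P f v \<partial>\<eta>) = k * (\<integral>v. f v \<partial>\<eta>)" by (simp only: of_real_eq_iff)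
  qed (use eig in \<open>auto simp: prob_eigenmeasure_def\<close>)
next
  note int = CY_int_eta[OF prob_nuM sets_nuM]
  have split: "(\<integral>v. complex_of_real (f v) + \<i> * complex_of_real (q v) \<partial>nuM)
      = complex_of_real (\<integral>v. f v \<partial>nuM) + \<i> * complex_of_real (\<integral>v. q v \<partial>nuM)"
    if "f \<in> CY" "q \<in> CY" for f q
    using int[OF that(1)] int[OF that(2)] by (subst Bochner_Integration.integral_add) auto
  assume "\<eta> = nuM"
  moreover have "(\<integral>v. P_op \<mu> s \<phi> v \<partial>nuM) = complex_of_real k * (\<integral>v. \<phi> v \<partial>nuM)" if \<phi>: "\<phi> \<in> CC" for \<phi>
  proof -
    have "(\<integral>v. P_op \<mu> s \<phi> v \<partial>nuM) = complex_of_real (k * (\<integral>v. Re (\<phi> v) \<partial>nuM)) + \<i> * complex_of_real (k * (\<integral>v. Im (\<phi> v) \<partial>nuM))"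
      unfolding P_op_complex[OF \<phi>] using CC_Re[OF \<phi>] CC_Im[OF \<phi>] by (simp add: split P_CY nuM_P)
    also have "\<dots> = complex_of_real k * (\<integral>v. complex_of_real (Re (\<phi> v)) + \<i> * complex_of_real (Im (\<phi> v)) \<partial>nuM)"
      using CC_Re[OF \<phi>] CC_Im[OF \<phi>] by (simp add: split algebra_simps)
    also have "(\<lambda>v. complex_of_real (Re (\<phi> v)) + \<i> * complex_of_real (Im (\<phi> v))) = \<phi>"
      by (simp add: fun_eq_iff complex_eq_iff)
    finally show ?thesis .
  qed
  ultimately show "prob_eigenmeasure (P_op \<mu> s) k \<eta>"
    using prob_nuM sets_nuM by (auto simp: prob_eigenmeasure_def CC_def)
qed

lemma nu_eq: "nu \<mu> k s = nuM"
  unfolding nu_def prob_eigenmeasure_iff by simp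

section \<open>Moments of the matrix products and the value of \<open>kappa\<close>\<close>

lemma borel_measurable_Gprod:
  fixes G :: "nat \<Rightarrow> 'w \<Rightarrow> real^'d^'d"
  assumes "\<And>i. i \<in> {1..n} \<Longrightarrow> G i \<in> borel_measurable M"
  shows "Gprod G n \<in> borel_measurable M"
  using assms
proof (induction n)
  case (Suc n)
  have "(\<lambda>\<omega>. G (Suc n) \<omega> ** Gprod G n \<omega>) \<in> borel_measurable M"
    using Suc by (intro borel_measurable_matrix_matrix_mult) auto
  also have "(\<lambda>\<omega>. G (Suc n) \<omega> ** Gprod G n \<omega>) = Gprod G (Suc n)" by (rule ext) simp
  finally show ?case .
next
  case 0
  have "Gprod G 0 = (\<lambda>\<omega>. mat 1)" by (rule ext) simp
  then show ?case by simp
qed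

text \<open>Integrating out the last factor, which is independent of the preceding product, replaces
  \<open>f\<close> by \<open>P f\<close>; hence the induction runs over arbitrary \<open>f\<close>.
  With nonnegative integrals Tonelli's theorem applies before any joint moment is known to be
  finite.\<close>

lemma nn_integral_Gprod:
  fixes W :: "'w measure" and G :: "nat \<Rightarrow> 'w \<Rightarrow> real^'d^'d"
  assumes iid: "iid_with_law W G \<mu>" and v: "v \<in> S" and f: "f \<in> CY" "\<And>x. 0 \<le> f x"
  shows "AE \<omega> in W. 0 < vnorm (Gprod G n \<omega> *v v) \<and> act (Gprod G n \<omega>) v \<in> S"
    and "(\<integral>\<^sup>+\<omega>. ennreal (vnorm (Gprod G n \<omega> *v v) powr s * f (act (Gprod G n \<omega>) v)) \<partial>W) = ennreal ((P ^^ n) f v)"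
proof -
  interpret W: prob_space W using iid by (simp add: iid_with_law_def)
  have ind: "W.indep_vars (\<lambda>_. borel) G {1..}" using iid by (simp add: iid_with_law_def)
  have Gm: "G i \<in> borel_measurable W" if "1 \<le> i" for i
    using ind that by (auto simp: W.indep_vars_def2)
  have law: "distr W borel (G i) = \<mu>" if "1 \<le> i" for i using iid that by (simp add: iid_with_law_def)
  have AEG: "AE \<omega> in W. good (G i \<omega>)" if "1 \<le> i" for i
  proof -
    have "AE g in distr W borel (G i). good g" unfolding law[OF that] by (rule AE_good)
    then show ?thesis by (rule AE_distrD[OF Gm[OF that]])
  qed
  have Gp: "Gprod G n \<in> borel_measurable W" for n by (rule borel_measurable_Gprod) (use Gm in auto)
  \<comment> \<open>The cocycle identity. It needs a nonzero image under \<open>b\<close>, because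
    \<open>act\<close> divides by its norm; \<open>posS\<close> provides this almost surely.\<close>
  have act_step: "act (a ** b) v = act a (act b v)" "vnorm ((a ** b) *v v) = vnorm (b *v v) * vnorm (a *v act b v)"
    if "0 < vnorm (b *v v)" for a b :: "real^'d^'d"
  proof -
    have e: "(a ** b) *v v = vnorm (b *v v) *\<^sub>R (a *v act b v)"
      using that by (simp add: act_def matrix_vector_mult_scaleR matrix_vector_mul_assoc)
    have sc: "vnorm (t *\<^sub>R x) = \<bar>t\<bar> * vnorm x" for t and x :: "real^'d"
      by (simp add: vnorm_def abs_mult sum_distrib_left)
    show "vnorm ((a ** b) *v v) = vnorm (b *v v) * vnorm (a *v act b v)"
      unfolding e sc using that by simp
    then show "act (a ** b) v = act a (act b v)"
      unfolding act_def[of "a ** b"] e using that by (simp add: act_def[of a] sc)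
  qed
  have posS: "AE \<omega> in W. 0 < vnorm (Gprod G n \<omega> *v v) \<and> act (Gprod G n \<omega>) v \<in> S" for n
  proof (induction n)
    case 0
    have "vnorm v = 1" using v by (simp add: simplex_S_def)
    then show ?case using v by (simp add: act_def)
  next
    case (Suc n)
    have "AE \<omega> in W. good (G (Suc n) \<omega>)" by (rule AEG) simp
    with Suc show ?case
    proof (eventually_elim, goal_cases)
      case (1 \<omega>)
      have p: "pos_matrix (G (Suc n) \<omega>)" using 1 good_pos by auto
      then show ?case
        using 1 act_step[of "Gprod G n \<omega>" "G (Suc n) \<omega>"] act_in_simplex[OF p] pos_matrix_mult_pos(2)[OF p] by simp
    qed
  qed
  then show "AE \<omega> in W. 0 < vnorm (Gprod G n \<omega> *v v) \<and> act (Gprod G n \<omega>) v \<in> S" .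
  show "(\<integral>\<^sup>+\<omega>. ennreal (vnorm (Gprod G n \<omega> *v v) powr s * f (act (Gprod G n \<omega>) v)) \<partial>W) = ennreal ((P ^^ n) f v)"
    using f
  proof (induction n arbitrary: f)
    case 0
    have "vnorm v = 1" using v by (simp add: simplex_S_def)
    then show ?case by (simp add: act_def W.emeasure_space_1)
  next
    case (Suc n)
    note fm [measurable] = CY_meas[OF Suc.prems(1)]
    have Pnn: "0 \<le> P f x" for x
      using P_mono[of "\<lambda>x. 0" f x] Suc.prems by (simp add: P_zero CY_def)
    \<comment> \<open>\<open>Gprod G n\<close> is rewritten as a function of the family restricted
      to the indices 1 to \<open>n\<close>, which is independent of the factor with index
      \<open>Suc n\<close>. This is why its measurability was stated from the measurability of these
      factors alone.\<close>
    have indep: "W.indep_var borel (Gprod G n) borel (G (Suc n))"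
    proof -
      have "W.indep_var (PiM {1..n} (\<lambda>_. borel)) (\<lambda>\<omega>. restrict (\<lambda>i. G i \<omega>) {1..n})
          (PiM {Suc n} (\<lambda>_. borel)) (\<lambda>\<omega>. restrict (\<lambda>i. G i \<omega>) {Suc n})"
        by (rule W.indep_var_restrict[OF ind]) auto
      then have "W.indep_var borel (Gprod (\<lambda>i y. y i) n \<circ> (\<lambda>\<omega>. restrict (\<lambda>i. G i \<omega>) {1..n}))
          borel ((\<lambda>y. y (Suc n)) \<circ> (\<lambda>\<omega>. restrict (\<lambda>i. G i \<omega>) {Suc n}))"
        by (rule W.indep_var_compose) (auto intro!: borel_measurable_Gprod)
      moreover have "Gprod (\<lambda>i y. y i) m (restrict (\<lambda>i. G i \<omega>) {1..n}) = Gprod G m \<omega>" if "m \<le> n" for m \<omega>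
        using that by (induction m) auto
      ultimately show ?thesis by (simp add: comp_def)
    qed
    define H where "H = (\<lambda>(a, g). ennreal (vnorm (a *v v) powr s) * ennreal (vnorm (g *v act a v) powr s * f (act g (act a v))))"
    have Hm [measurable]: "H \<in> borel_measurable (borel \<Otimes>\<^sub>M borel)" unfolding H_def by measurable
    have Hm': "H \<in> borel_measurable (distr W borel (Gprod G n) \<Otimes>\<^sub>M distr W borel (G (Suc n)))"
      using Hm by (simp add: measurable_cong_sets[OF sets_pair_measure_cong[OF sets_distr sets_distr] refl])
    have "(\<integral>\<^sup>+\<omega>. ennreal (vnorm (Gprod G (Suc n) \<omega> *v v) powr s * f (act (Gprod G (Suc n) \<omega>) v)) \<partial>W)
        = (\<integral>\<^sup>+\<omega>. H (Gprod G n \<omega>, G (Suc n) \<omega>) \<partial>W)"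
    proof (rule nn_integral_cong_AE)
      show "AE \<omega> in W. ennreal (vnorm (Gprod G (Suc n) \<omega> *v v) powr s * f (act (Gprod G (Suc n) \<omega>) v))
          = H (Gprod G n \<omega>, G (Suc n) \<omega>)"
        using posS[of n]
      proof eventually_elim
        case (elim \<omega>)
        then show ?case using act_step[of "Gprod G n \<omega>" "G (Suc n) \<omega>"] Suc.prems(2)
          by (simp add: H_def powr_mult vnorm_nonneg mult.assoc flip: ennreal_mult)
      qed
    qed
    also have "\<dots> = (\<integral>\<^sup>+p. H p \<partial>distr W (borel \<Otimes>\<^sub>M borel) (\<lambda>\<omega>. (Gprod G n \<omega>, G (Suc n) \<omega>)))"
      using Gp[of n] Gm[of "Suc n"] by (intro nn_integral_distr[symmetric]) auto
    also have "distr W (borel \<Otimes>\<^sub>M borel) (\<lambda>\<omega>. (Gprod G n \<omega>, G (Suc n) \<omega>))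
        = distr W borel (Gprod G n) \<Otimes>\<^sub>M distr W borel (G (Suc n))"
      using indep by (simp add: W.indep_var_distribution_eq)
    also have "(\<integral>\<^sup>+p. H p \<partial>\<dots>) = (\<integral>\<^sup>+a. \<integral>\<^sup>+g. H (a, g) \<partial>distr W borel (G (Suc n)) \<partial>distr W borel (Gprod G n))"
    proof -
      interpret D: prob_space "distr W borel (G (Suc n))" using Gm[of "Suc n"] by (intro W.prob_space_distr) auto
      show ?thesis by (rule D.nn_integral_fst[symmetric, OF Hm'])
    qed
    also have "\<dots> = (\<integral>\<^sup>+a. \<integral>\<^sup>+g. H (a, g) \<partial>\<mu> \<partial>distr W borel (Gprod G n))" by (simp add: law)
    also have "\<dots> = (\<integral>\<^sup>+\<omega>. \<integral>\<^sup>+g. H (Gprod G n \<omega>, g) \<partial>\<mu> \<partial>W)"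
    proof -
      have "H \<in> borel_measurable (borel \<Otimes>\<^sub>M \<mu>)"
        using Hm by (simp add: measurable_cong_sets[OF sets_pair_measure_cong[OF refl sets_mu] refl])
      then have "(\<lambda>a. \<integral>\<^sup>+g. H (a, g) \<partial>\<mu>) \<in> borel_measurable borel"
        by (intro borel_measurable_nn_integral) simp
      then show ?thesis by (subst nn_integral_distr[OF Gp]) auto
    qed
    also have "\<dots> = (\<integral>\<^sup>+\<omega>. ennreal (vnorm (Gprod G n \<omega> *v v) powr s * P f (act (Gprod G n \<omega>) v)) \<partial>W)"
    proof (rule nn_integral_cong_AE)
      show "AE \<omega> in W. (\<integral>\<^sup>+g. H (Gprod G n \<omega>, g) \<partial>\<mu>)
          = ennreal (vnorm (Gprod G n \<omega> *v v) powr s * P f (act (Gprod G n \<omega>) v))"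
        using posS[of n]
      proof eventually_elim
        case (elim \<omega>)
        define u where "u = act (Gprod G n \<omega>) v"
        have u: "u \<in> S" using elim by (simp add: u_def)
        have "(\<integral>\<^sup>+g. ennreal (vnorm (g *v u) powr s * f (act g u)) \<partial>\<mu>) = ennreal (P f u)"
          using P_int[OF Suc.prems(1) u] Suc.prems(2) u by (simp add: P_in nn_integral_eq_integral)
        moreover have "(\<integral>\<^sup>+g. H (Gprod G n \<omega>, g) \<partial>\<mu>)
           = ennreal (vnorm (Gprod G n \<omega> *v v) powr s) * (\<integral>\<^sup>+g. ennreal (vnorm (g *v u) powr s * f (act g u)) \<partial>\<mu>)"
          unfolding H_def u_def by (simp add: nn_integral_cmult)
        ultimately show ?case by (simp add: u_def ennreal_mult Pnn)
      qed
    qed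
    also have "\<dots> = ennreal ((P ^^ n) (P f) v)" by (rule Suc.IH[OF P_CY[OF Suc.prems(1)] Pnn])
    finally show ?case by (simp add: funpow_swap1)
  qed
qed

text \<open>For a nonnegative matrix the image of the barycenter has norm exactly
  \<open>mnorm\<close> divided by the dimension, so moments of the products are values of the
  iterates of \<open>P\<close>.\<close>

lemma moment_Gprod:
  fixes W :: "'w measure" and G :: "nat \<Rightarrow> 'w \<Rightarrow> real^'d^'d"
  assumes iid: "iid_with_law W G \<mu>"
  shows "(\<integral>\<omega>. mnorm (Gprod G n \<omega>) powr s \<partial>W) = real CARD('d) powr s * (P ^^ n) one barycenter"
proof -
  let ?b = "barycenter :: real^'d"
  interpret W: prob_space W using iid by (simp add: iid_with_law_def)
  have ind: "W.indep_vars (\<lambda>_. borel) G {1..}" using iid by (simp add: iid_with_law_def)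
  have Gm: "G i \<in> borel_measurable W" if "1 \<le> i" for i
    using ind that by (auto simp: W.indep_vars_def2)
  have Gp [measurable]: "Gprod G n \<in> borel_measurable W" by (rule borel_measurable_Gprod) (use Gm in auto)
  have one_nn: "0 \<le> one x" for x by (simp add: one_def)
  have b: "?b \<in> S" by (rule barycenter_in_simplex)
  note ae = nn_integral_Gprod(1)[OF iid b CY_one one_nn, of n]
  have "AE \<omega> in W. \<forall>i j. 0 \<le> G (Suc m) \<omega> $ i $ j" for m
  proof -
    have "distr W borel (G (Suc m)) = \<mu>" using iid by (simp add: iid_with_law_def)
    then have "AE g in distr W borel (G (Suc m)). good g" using AE_good by (simp only:)
    moreover have "G (Suc m) \<in> borel_measurable W" by (rule Gm) simp
    ultimately have "AE \<omega> in W. good (G (Suc m) \<omega>)" by (metis AE_distrD)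
    then show ?thesis by eventually_elim (use good_pos in \<open>auto simp: pos_matrix_def less_imp_le\<close>)
  qed
  then have nonneg: "AE \<omega> in W. \<forall>i j. 0 \<le> Gprod G n \<omega> $ i $ j"
  proof (induction n)
    case 0 then show ?case by (simp add: mat_def)
  next
    case (Suc n)
    from Suc.IH[OF Suc.prems] Suc.prems[of n] show ?case
      by eventually_elim (auto simp: matrix_matrix_mult_def intro!: sum_nonneg)
  qed
  have "(\<integral>\<omega>. mnorm (Gprod G n \<omega>) powr s \<partial>W)
      = (\<integral>\<omega>. real CARD('d) powr s * (vnorm (Gprod G n \<omega> *v ?b) powr s * one (act (Gprod G n \<omega>) ?b)) \<partial>W)"
  proof (rule integral_cong_AE)
    show "AE \<omega> in W. mnorm (Gprod G n \<omega>) powr s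
        = real CARD('d) powr s * (vnorm (Gprod G n \<omega> *v ?b) powr s * one (act (Gprod G n \<omega>) ?b))"
      using ae nonneg
    proof eventually_elim
      case (elim \<omega>)
      have "vnorm (Gprod G n \<omega> *v ?b) = mnorm (Gprod G n \<omega>) / real CARD('d)"
        using elim by (simp add: vnorm_eq_sum matrix_vector_mult_nonneg barycenter_def)
          (simp add: matrix_vector_mult_def mnorm_def sum_divide_distrib)
      then have "mnorm (Gprod G n \<omega>) = real CARD('d) * vnorm (Gprod G n \<omega> *v ?b)" by simp
      then show ?case using elim by (simp add: one_def powr_mult vnorm_nonneg)
    qed
    show "(\<lambda>\<omega>. mnorm (Gprod G n \<omega>) powr s) \<in> borel_measurable W" by measurable
    have [measurable]: "one \<in> borel_measurable borel" by (rule CY_meas[OF CY_one])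
    show "(\<lambda>\<omega>. real CARD('d) powr s * (vnorm (Gprod G n \<omega> *v ?b) powr s * one (act (Gprod G n \<omega>) ?b))) \<in> borel_measurable W"
      by measurable
  qed
  also have "\<dots> = real CARD('d) powr s * (\<integral>\<omega>. vnorm (Gprod G n \<omega> *v ?b) powr s * one (act (Gprod G n \<omega>) ?b) \<partial>W)" by simp
  also have "(\<integral>\<omega>. vnorm (Gprod G n \<omega> *v ?b) powr s * one (act (Gprod G n \<omega>) ?b) \<partial>W) = (P ^^ n) one ?b"
  proof -
    have [measurable]: "one \<in> borel_measurable borel" by (rule CY_meas[OF CY_one])
    have nn: "0 \<le> (P ^^ n) one ?b"
    proof (cases n)
      case (Suc m)
      have "0 < P ((P ^^ m) one) ?b" by (intro P_pos P_iter_CY CY_one one_iter_pos b)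
      then show ?thesis using Suc by simp
    qed (simp add: one_nn)
    have "(\<integral>\<omega>. vnorm (Gprod G n \<omega> *v ?b) powr s * one (act (Gprod G n \<omega>) ?b) \<partial>W)
        = enn2real (\<integral>\<^sup>+\<omega>. ennreal (vnorm (Gprod G n \<omega> *v ?b) powr s * one (act (Gprod G n \<omega>) ?b)) \<partial>W)"
      by (rule integral_eq_nn_integral) (auto simp: one_nn)
    also have "\<dots> = (P ^^ n) one ?b" using nn_integral_Gprod(2)[OF iid b CY_one one_nn, of n] nn by simp
    finally show ?thesis .
  qed
  finally show ?thesis .
qed

text \<open>The moments are \<open>k ^ n\<close> times a sequence with a positive limit, and the
  \<open>n\<close>-th roots of such a sequence tend to 1. The computation runs along
  \<open>Suc n\<close>, which avoids \<open>1 / real 0\<close> and matches the convergence of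
  \<open>h (Suc n)\<close>.\<close>

lemma kappa_eq:
  fixes W :: "'w measure" and G :: "nat \<Rightarrow> 'w \<Rightarrow> real^'d^'d"
  assumes iid: "iid_with_law W G \<mu>"
  shows "kappa W G s = k"
  unfolding kappa_def
proof (rule limI)
  let ?b = "barycenter :: real^'d"
  have b: "?b \<in> S" by (rule barycenter_in_simplex)
  define x where "x n = real CARD('d) powr s * h (Suc n) ?b" for n
  have d: "0 < real CARD('d) powr s" by simp
  have x: "x \<longlonglongrightarrow> real CARD('d) powr s * r ?b" unfolding x_def by (intro tendsto_mult_left r_tendsto b)
  have "(\<lambda>n. x n powr (1 / real (Suc n)) * k) \<longlonglongrightarrow> (real CARD('d) powr s * r ?b) powr 0 * k"
    using r_pos[OF b] d LIMSEQ_Suc[OF lim_1_over_n]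
    by (intro tendsto_mult_right tendsto_powr x) (auto simp: inverse_eq_divide)
  moreover have "(\<integral>\<omega>. mnorm (Gprod G (Suc n) \<omega>) powr s \<partial>W) powr (1 / real (Suc n)) = x n powr (1 / real (Suc n)) * k" for n
  proof -
    have hn: "0 \<le> h (Suc n) ?b"
    proof -
      have "0 < P ((P ^^ n) one) ?b" by (intro P_pos P_iter_CY CY_one one_iter_pos b)
      then show ?thesis using k_pos by (simp add: h_def)
    qed
    have "(P ^^ Suc n) one ?b = k ^ Suc n * h (Suc n) ?b" using k_pos by (simp add: h_def)
    then have "(\<integral>\<omega>. mnorm (Gprod G (Suc n) \<omega>) powr s \<partial>W) = x n * k powr real (Suc n)"
      unfolding moment_Gprod[OF iid] x_def using k_pos by (subst powr_realpow) (auto simp: mult_ac)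
    then have "(\<integral>\<omega>. mnorm (Gprod G (Suc n) \<omega>) powr s \<partial>W) powr (1 / real (Suc n))
        = x n powr (1 / real (Suc n)) * (k powr real (Suc n)) powr (1 / real (Suc n))"
      using hn by (simp add: powr_mult x_def)
    also have "(k powr real (Suc n)) powr (1 / real (Suc n)) = k" using k_pos by (simp add: powr_powr)
    finally show ?thesis .
  qed
  ultimately have "(\<lambda>n. (\<integral>\<omega>. mnorm (Gprod G (Suc n) \<omega>) powr s \<partial>W) powr (1 / real (Suc n))) \<longlonglongrightarrow> k"
    using r_pos[OF b] d by simp
  then show "(\<lambda>n. (\<integral>\<omega>. mnorm (Gprod G n \<omega>) powr s \<partial>W) powr (1 / real n)) \<longlonglongrightarrow> k"
    by (rule LIMSEQ_imp_Suc)
qed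

end

subsection \<open>Resolvents on the Hoelder space\<close>

text \<open>Dimension at least 2 supplies two distinct vertices of the simplex, so that
  \<open>hoelder_quotients\<close> is nonempty and its \<open>Sup\<close> is controlled by upper
  bounds of its elements.\<close>

lemma B_space_I:
  fixes \<phi> :: "real^'d \<Rightarrow> complex"
  assumes dim: "CARD('d) \<ge> 2" and out: "\<And>v. v \<notin> simplex_S \<Longrightarrow> \<phi> v = 0" and cont: "continuous_on simplex_S \<phi>"
    and a: "\<And>v. v \<in> simplex_S \<Longrightarrow> cmod (\<phi> v) \<le> a"
    and b: "\<And>u v. u \<in> simplex_S \<Longrightarrow> v \<in> simplex_S \<Longrightarrow> cmod (\<phi> u - \<phi> v) \<le> b * d_hilbert u v powr \<gamma>"
  shows "\<phi> \<in> B_space \<gamma>" "B_norm \<gamma> \<phi> \<le> a + b"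
proof -
  have q: "q \<le> b" if "q \<in> hoelder_quotients \<gamma> \<phi>" for q
  proof -
    obtain u v where uv: "u \<in> simplex_S" "v \<in> simplex_S" "u \<noteq> v" "q = cmod (\<phi> u - \<phi> v) / d_hilbert u v powr \<gamma>"
      using \<open>q \<in> _\<close> by (auto simp: hoelder_quotients_def)
    then show ?thesis using b[OF uv(1,2)] d_hilbert_pos[OF uv(1-3)] by (simp add: divide_le_eq)
  qed
  show "\<phi> \<in> B_space \<gamma>"
  proof -
    have "bdd_above ((\<lambda>v. cmod (\<phi> v)) ` simplex_S)" using a by (intro bdd_aboveI[of _ a]) auto
    moreover have "bdd_above (hoelder_quotients \<gamma> \<phi>)" using q by (rule bdd_aboveI)
    ultimately show ?thesis unfolding B_space_def using out cont by simp
  qed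
  obtain i j :: 'd where ij: "i \<noteq> j"
    using dim by (metis UNIV_I card_2_iff' card_le_Suc0_iff_eq finite numeral_2_eq_2 not_less_eq_eq)
  have ax: "axis i 1 \<in> (simplex_S :: (real^'d) set)" for i
    by (simp add: simplex_S_def vnorm_def axis_def if_distrib[of abs] cong: if_cong)
  have "axis i (1::real) \<noteq> axis j 1" using ij by (simp add: axis_eq_axis)
  then have ne: "hoelder_quotients \<gamma> \<phi> \<noteq> {}" using ax[of i] ax[of j] unfolding hoelder_quotients_def by blast
  have "(SUP v\<in>simplex_S. cmod (\<phi> v)) \<le> a" using a ax by (intro cSUP_least) auto
  moreover have "Sup (hoelder_quotients \<gamma> \<phi>) \<le> b" using ne q by (intro cSup_least) auto
  ultimately show "B_norm \<gamma> \<phi> \<le> a + b" by (simp add: B_norm_def)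
qed

lemma B_space_D:
  fixes \<phi> :: "real^'d \<Rightarrow> complex"
  assumes dim: "CARD('d) \<ge> 2" and \<phi>: "\<phi> \<in> B_space \<gamma>" and \<gamma>: "0 < \<gamma>"
  shows "v \<notin> simplex_S \<Longrightarrow> \<phi> v = 0" "continuous_on simplex_S \<phi>"
    "v \<in> simplex_S \<Longrightarrow> cmod (\<phi> v) \<le> B_norm \<gamma> \<phi>"
    "u \<in> simplex_S \<Longrightarrow> v \<in> simplex_S \<Longrightarrow> cmod (\<phi> u - \<phi> v) \<le> B_norm \<gamma> \<phi> * d_hilbert u v powr \<gamma>"
    "0 \<le> B_norm \<gamma> \<phi>"
proof -
  note d = \<phi>[unfolded B_space_def, simplified]
  obtain i j :: 'd where ij: "i \<noteq> j"
    using dim by (metis UNIV_I card_2_iff' card_le_Suc0_iff_eq finite numeral_2_eq_2 not_less_eq_eq)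
  have ax: "axis i 1 \<in> (simplex_S :: (real^'d) set)" for i
    by (simp add: simplex_S_def vnorm_def axis_def if_distrib[of abs] cong: if_cong)
  have "axis i (1::real) \<noteq> axis j 1" using ij by (simp add: axis_eq_axis)
  then obtain q where q: "q \<in> hoelder_quotients \<gamma> \<phi>" using ax[of i] ax[of j] unfolding hoelder_quotients_def by blast
  then have "0 \<le> q" by (auto simp: hoelder_quotients_def)
  also have "q \<le> Sup (hoelder_quotients \<gamma> \<phi>)" using q d by (intro cSup_upper) auto
  finally have H0: "0 \<le> Sup (hoelder_quotients \<gamma> \<phi>)" .
  have sup: "cmod (\<phi> v) \<le> (SUP v\<in>simplex_S. cmod (\<phi> v))" if "v \<in> simplex_S" for v
    using d that by (intro cSUP_upper) auto
  have S0: "0 \<le> (SUP v\<in>simplex_S. cmod (\<phi> v))"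
    using sup[OF ax[of i]] norm_ge_zero order_trans by blast
  show "v \<notin> simplex_S \<Longrightarrow> \<phi> v = 0" "continuous_on simplex_S \<phi>" using d by auto
  show "v \<in> simplex_S \<Longrightarrow> cmod (\<phi> v) \<le> B_norm \<gamma> \<phi>" using sup[of v] H0 by (simp add: B_norm_def)
  show "0 \<le> B_norm \<gamma> \<phi>" using S0 H0 by (simp add: B_norm_def)
  show "cmod (\<phi> u - \<phi> v) \<le> B_norm \<gamma> \<phi> * d_hilbert u v powr \<gamma>" if uv: "u \<in> simplex_S" "v \<in> simplex_S"
  proof (cases "u = v")
    case True
    have "0 \<le> B_norm \<gamma> \<phi> * d_hilbert v v powr \<gamma>" using S0 H0 by (simp add: B_norm_def)
    then show ?thesis using True by simp
  next
    case False
    have "cmod (\<phi> u - \<phi> v) / d_hilbert u v powr \<gamma> \<le> Sup (hoelder_quotients \<gamma> \<phi>)"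
      using d uv False by (intro cSup_upper) (auto simp: hoelder_quotients_def)
    then have "cmod (\<phi> u - \<phi> v) / d_hilbert u v powr \<gamma> \<le> B_norm \<gamma> \<phi>" using S0 by (simp add: B_norm_def)
    then show ?thesis using d_hilbert_pos[OF uv False] by (simp add: divide_le_eq)
  qed
qed

text \<open>The parameter \<open>dummy\<close> fixes the dimension type, which
  \<open>\<gamma>\<close> does not determine.\<close>

locale hoelder_space =
  fixes \<gamma> :: real and dummy :: "'d::finite itself"
  assumes dim: "CARD('d) \<ge> 2" and \<gamma>_pos: "0 < \<gamma>"
begin

abbreviation "BS \<equiv> B_space \<gamma> :: (real^'d \<Rightarrow> complex) set"

lemmas BS_I = B_space_I[OF dim, where \<gamma>=\<gamma>]
lemmas BS_D = B_space_D[OF dim _ \<gamma>_pos]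

lemma BS_add: assumes "\<phi> \<in> BS" "\<psi> \<in> BS" shows "(\<lambda>v. \<phi> v + \<psi> v) \<in> BS"
proof (rule BS_I(1)[where a="B_norm \<gamma> \<phi> + B_norm \<gamma> \<psi>" and b="B_norm \<gamma> \<phi> + B_norm \<gamma> \<psi>"])
  note D = BS_D[OF assms(1)] and E = BS_D[OF assms(2)]
  show "v \<notin> simplex_S \<Longrightarrow> \<phi> v + \<psi> v = 0" for v using D(1) E(1) by simp
  show "continuous_on simplex_S (\<lambda>v. \<phi> v + \<psi> v)" by (intro continuous_on_add D E)
  show "cmod (\<phi> v + \<psi> v) \<le> B_norm \<gamma> \<phi> + B_norm \<gamma> \<psi>" if "v \<in> simplex_S" for v
    using D(3)[OF that] E(3)[OF that] norm_triangle_ineq[of "\<phi> v" "\<psi> v"] by linarith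
  show "cmod (\<phi> u + \<psi> u - (\<phi> v + \<psi> v)) \<le> (B_norm \<gamma> \<phi> + B_norm \<gamma> \<psi>) * d_hilbert u v powr \<gamma>"
    if "u \<in> simplex_S" "v \<in> simplex_S" for u v
  proof -
    have "cmod (\<phi> u + \<psi> u - (\<phi> v + \<psi> v)) = cmod ((\<phi> u - \<phi> v) + (\<psi> u - \<psi> v))" by (simp add: algebra_simps)
    also have "\<dots> \<le> cmod (\<phi> u - \<phi> v) + cmod (\<psi> u - \<psi> v)" by (rule norm_triangle_ineq)
    finally show ?thesis using D(4)[OF that] E(4)[OF that] unfolding distrib_right by linarith
  qed
qed

lemma BS_scale: assumes "\<phi> \<in> BS" shows "(\<lambda>v. c * \<phi> v) \<in> BS"
proof (rule BS_I(1)[where a="cmod c * B_norm \<gamma> \<phi>" and b="cmod c * B_norm \<gamma> \<phi>"])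
  note D = BS_D[OF assms(1)]
  show "v \<notin> simplex_S \<Longrightarrow> c * \<phi> v = 0" for v using D(1) by simp
  show "continuous_on simplex_S (\<lambda>v. c * \<phi> v)" by (intro continuous_on_mult continuous_on_const D)
  show "cmod (c * \<phi> v) \<le> cmod c * B_norm \<gamma> \<phi>" if "v \<in> simplex_S" for v
    unfolding norm_mult using D(3)[OF that] by (intro mult_left_mono) auto
  show "cmod (c * \<phi> u - c * \<phi> v) \<le> cmod c * B_norm \<gamma> \<phi> * d_hilbert u v powr \<gamma>"
    if "u \<in> simplex_S" "v \<in> simplex_S" for u v
    using mult_left_mono[OF D(4)[OF that], of "cmod c"] by (simp add: mult.assoc flip: right_diff_distrib norm_mult)
qed

lemma BS_diff: "\<phi> \<in> BS \<Longrightarrow> \<psi> \<in> BS \<Longrightarrow> (\<lambda>v. \<phi> v - \<psi> v) \<in> BS"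
  using BS_add[of \<phi> "\<lambda>v. -1 * \<psi> v"] BS_scale[of \<psi> "-1"] by simp

lemma BS_zero: "(\<lambda>v. 0) \<in> BS"
  by (rule BS_I(1)[where a=0 and b=0]) auto

lemma BS_sum: "finite I \<Longrightarrow> (\<And>i. i \<in> I \<Longrightarrow> f i \<in> BS) \<Longrightarrow> (\<lambda>v. \<Sum>i\<in>I. f i v) \<in> BS"
  by (induction I rule: finite_induct) (auto simp: BS_zero BS_add)

lemma op_D:
  assumes "T \<in> bounded_ops \<gamma>" "\<phi> \<in> BS"
  shows "T \<phi> \<in> BS" "\<psi> \<in> BS \<Longrightarrow> T (\<lambda>v. \<phi> v + \<psi> v) = (\<lambda>v. T \<phi> v + T \<psi> v)"
    "T (\<lambda>v. c * \<phi> v) = (\<lambda>v. c * T \<phi> v)"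
  using assms by (auto simp: bounded_ops_def)

lemma op_diff:
  assumes T: "T \<in> bounded_ops \<gamma>" and "\<phi> \<in> BS" "\<psi> \<in> BS"
  shows "T (\<lambda>v. \<phi> v - \<psi> v) = (\<lambda>v. T \<phi> v - T \<psi> v)"
  using op_D(2)[OF T assms(2) BS_scale[OF assms(3), of "-1"]] op_D(3)[OF T assms(3), of "-1"] by simp

lemma op_zero: "T \<in> bounded_ops \<gamma> \<Longrightarrow> T (\<lambda>v. 0) = ((\<lambda>v. 0) :: real^'d \<Rightarrow> complex)"
  using op_D(3)[OF _ BS_zero, of T 0] by simp

lemma op_sum:
  assumes T: "T \<in> bounded_ops \<gamma>" and "finite I" "\<And>i. i \<in> I \<Longrightarrow> f i \<in> BS"
  shows "T (\<lambda>v. \<Sum>i\<in>I. f i v) = (\<lambda>v. \<Sum>i\<in>I. T (f i) v)"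
  using assms(2,3) by (induction I rule: finite_induct) (auto simp: op_zero[OF T] op_D(2)[OF T] BS_sum)

lemma op_iter:
  assumes T: "T \<in> bounded_ops \<gamma>" and "\<phi> \<in> BS"
  shows "(T ^^ n) \<phi> \<in> BS" "\<psi> \<in> BS \<Longrightarrow> (T ^^ n) (\<lambda>v. \<phi> v + \<psi> v) = (\<lambda>v. (T ^^ n) \<phi> v + (T ^^ n) \<psi> v)"
    "(T ^^ n) (\<lambda>v. c * \<phi> v) = (\<lambda>v. c * (T ^^ n) \<phi> v)"
proof -
  have *: "(T ^^ n) \<phi> \<in> BS" if "\<phi> \<in> BS" for \<phi> n
    using that by (induction n) (auto simp: op_D[OF T])
  show "(T ^^ n) \<phi> \<in> BS" by (rule *[OF assms(2)])
  show "(T ^^ n) (\<lambda>v. c * \<phi> v) = (\<lambda>v. c * (T ^^ n) \<phi> v)"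
    by (induction n) (auto simp: op_D(3)[OF T *[OF assms(2)]])
  show "(T ^^ n) (\<lambda>v. \<phi> v + \<psi> v) = (\<lambda>v. (T ^^ n) \<phi> v + (T ^^ n) \<psi> v)" if "\<psi> \<in> BS"
    by (induction n) (auto simp: op_D(2)[OF T *[OF assms(2)] *[OF that]])
qed

text \<open>The Neumann series at a point \<open>z\<close> outside the disc of radius
  \<open>\<rho>\<close>. Supremum and Hoelder bounds for the iterates are given separately;
  \<open>supc\<close>, continuity for the supremum norm, lets \<open>T\<close> pass through the
  uniformly convergent series, so uniform convergence suffices for the resolvent identities.\<close>

context
  fixes T :: "(real^'d \<Rightarrow> complex) \<Rightarrow> real^'d \<Rightarrow> complex" and C C' \<rho> :: real and z :: complex
  assumes T: "T \<in> bounded_ops \<gamma>" and C: "0 \<le> C" and \<rho>: "0 < \<rho>" and z: "\<rho> < cmod z"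
    and sup: "\<And>n \<phi> v. \<phi> \<in> BS \<Longrightarrow> v \<in> simplex_S \<Longrightarrow> cmod ((T ^^ n) \<phi> v) \<le> C * \<rho> ^ n * B_norm \<gamma> \<phi>"
    and hoe: "\<And>n \<phi> u v. \<phi> \<in> BS \<Longrightarrow> u \<in> simplex_S \<Longrightarrow> v \<in> simplex_S \<Longrightarrow>
       cmod ((T ^^ n) \<phi> u - (T ^^ n) \<phi> v) \<le> C * \<rho> ^ n * B_norm \<gamma> \<phi> * d_hilbert u v powr \<gamma>"
    and supc: "\<And>\<phi> b v. \<phi> \<in> BS \<Longrightarrow> (\<And>v. v \<in> simplex_S \<Longrightarrow> cmod (\<phi> v) \<le> b) \<Longrightarrow> v \<in> simplex_S \<Longrightarrow> cmod (T \<phi> v) \<le> C' * b"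
begin

definition res_term :: "nat \<Rightarrow> (real^'d \<Rightarrow> complex) \<Rightarrow> real^'d \<Rightarrow> complex" where
  "res_term n \<phi> v = (1 / z ^ Suc n) * (T ^^ n) \<phi> v"

definition resolvent :: "(real^'d \<Rightarrow> complex) \<Rightarrow> real^'d \<Rightarrow> complex" where
  "resolvent \<phi> v = (\<Sum>n. res_term n \<phi> v)"

definition q :: real where "q = \<rho> / cmod z"

definition K :: real where "K = C / cmod z / (1 - q)"

lemma q: "0 < q" "q < 1" and z0: "0 < cmod z" "z \<noteq> 0"
proof -
  show "0 < cmod z" using \<rho> z by linarith
  then show "z \<noteq> 0" "0 < q" "q < 1" using \<rho> z by (auto simp: q_def simp del: zero_less_norm_iff)
qed

lemma res_term_BS: "\<phi> \<in> BS \<Longrightarrow> res_term n \<phi> \<in> BS"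
  unfolding res_term_def[abs_def] by (intro BS_scale op_iter T)

lemma scaled_bound: assumes "cmod x \<le> C * \<rho> ^ n * b" shows "cmod ((1 / z ^ Suc n) * x) \<le> C / cmod z * b * q ^ n"
proof -
  have "cmod ((1 / z ^ Suc n) * x) = (1 / cmod z ^ Suc n) * cmod x" by (simp add: norm_mult norm_divide norm_power)
  also have "\<dots> \<le> (1 / cmod z ^ Suc n) * (C * \<rho> ^ n * b)" using assms by (intro mult_left_mono) auto
  also have "\<dots> = C / cmod z * b * q ^ n" using z0 by (simp add: q_def power_divide field_simps)
  finally show ?thesis .
qed

lemma res_term_sup: "\<phi> \<in> BS \<Longrightarrow> v \<in> simplex_S \<Longrightarrow> cmod (res_term n \<phi> v) \<le> C / cmod z * B_norm \<gamma> \<phi> * q ^ n"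
  unfolding res_term_def by (rule scaled_bound[OF sup])

lemma res_term_hoe:
  assumes "\<phi> \<in> BS" "u \<in> simplex_S" "v \<in> simplex_S"
  shows "cmod (res_term n \<phi> u - res_term n \<phi> v) \<le> C / cmod z * (B_norm \<gamma> \<phi> * d_hilbert u v powr \<gamma>) * q ^ n"
proof -
  have "cmod ((1 / z ^ Suc n) * ((T ^^ n) \<phi> u - (T ^^ n) \<phi> v)) \<le> C / cmod z * (B_norm \<gamma> \<phi> * d_hilbert u v powr \<gamma>) * q ^ n"
    by (rule scaled_bound) (use hoe[OF assms] in \<open>simp add: mult.assoc\<close>)
  then show ?thesis by (simp only: res_term_def right_diff_distrib)
qed

lemma geom_summable: "summable (\<lambda>n. b * q ^ n)" and geom_sum: "(\<Sum>n. C / cmod z * b * q ^ n) = K * b"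
proof -
  show "summable (\<lambda>n. b * q ^ n)" for b using q by (intro summable_mult summable_geometric) auto
  have "(\<Sum>n. C / cmod z * b * q ^ n) = C / cmod z * b * (1 / (1 - q))"
    using q by (subst suminf_mult) (auto simp: summable_geometric suminf_geometric)
  then show "(\<Sum>n. C / cmod z * b * q ^ n) = K * b" by (simp add: K_def)
qed

lemma res_summable: assumes "\<phi> \<in> BS" shows "summable (\<lambda>n. res_term n \<phi> v)"
proof (cases "v \<in> simplex_S")
  case True
  show ?thesis by (rule summable_comparison_test'[OF geom_summable[of "C / cmod z * B_norm \<gamma> \<phi>"], where N=0])
      (rule res_term_sup[OF assms True])
next
  case False
  have "(\<lambda>n. res_term n \<phi> v) = (\<lambda>n. 0)" using BS_D(1)[OF res_term_BS[OF assms] False] by auto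
  then show ?thesis by simp
qed

lemma resolvent_uniform: "\<phi> \<in> BS \<Longrightarrow> uniform_limit simplex_S (\<lambda>n v. \<Sum>i<n. res_term i \<phi> v) (resolvent \<phi>) sequentially"
  unfolding resolvent_def[abs_def] by (rule Weierstrass_m_test[OF res_term_sup geom_summable])

lemma resolvent_BS:
  assumes \<phi>: "\<phi> \<in> BS" shows "resolvent \<phi> \<in> BS" "B_norm \<gamma> (resolvent \<phi>) \<le> (K + K) * B_norm \<gamma> \<phi>"
proof -
  have out: "v \<notin> simplex_S \<Longrightarrow> resolvent \<phi> v = 0" for v
    using BS_D(1)[OF res_term_BS[OF \<phi>]] by (simp add: resolvent_def)
  have cont: "continuous_on simplex_S (resolvent \<phi>)"
    by (rule uniform_limit_theorem[OF _ resolvent_uniform[OF \<phi>]])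
      (auto intro!: always_eventually BS_D(2) BS_sum res_term_BS \<phi>)
  have a: "cmod (resolvent \<phi> v) \<le> K * B_norm \<gamma> \<phi>" if v: "v \<in> simplex_S" for v
  proof -
    have sn: "summable (\<lambda>n. cmod (res_term n \<phi> v))"
      by (rule summable_comparison_test'[OF geom_summable[of "C / cmod z * B_norm \<gamma> \<phi>"], where N=0])
        (use res_term_sup[OF \<phi> v] in simp)
    have "cmod (resolvent \<phi> v) \<le> (\<Sum>n. cmod (res_term n \<phi> v))" unfolding resolvent_def by (rule summable_norm[OF sn])
    also have "\<dots> \<le> (\<Sum>n. C / cmod z * B_norm \<gamma> \<phi> * q ^ n)"
      by (rule suminf_le[OF res_term_sup[OF \<phi> v] sn geom_summable])
    finally show ?thesis by (simp only: geom_sum)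
  qed
  have b: "cmod (resolvent \<phi> u - resolvent \<phi> v) \<le> (K * B_norm \<gamma> \<phi>) * d_hilbert u v powr \<gamma>"
    if uv: "u \<in> simplex_S" "v \<in> simplex_S" for u v
  proof -
    have sn: "summable (\<lambda>n. cmod (res_term n \<phi> u - res_term n \<phi> v))"
      by (rule summable_comparison_test'[OF geom_summable[of "C / cmod z * (B_norm \<gamma> \<phi> * d_hilbert u v powr \<gamma>)"], where N=0])
        (use res_term_hoe[OF \<phi> uv] in simp)
    have "resolvent \<phi> u - resolvent \<phi> v = (\<Sum>n. res_term n \<phi> u - res_term n \<phi> v)"
      unfolding resolvent_def by (rule suminf_diff[OF res_summable[OF \<phi>] res_summable[OF \<phi>]])
    also have "cmod \<dots> \<le> (\<Sum>n. cmod (res_term n \<phi> u - res_term n \<phi> v))" by (rule summable_norm[OF sn])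
    also have "\<dots> \<le> (\<Sum>n. C / cmod z * (B_norm \<gamma> \<phi> * d_hilbert u v powr \<gamma>) * q ^ n)"
      by (rule suminf_le[OF res_term_hoe[OF \<phi> uv] sn geom_summable])
    finally show ?thesis unfolding geom_sum by (simp only: mult.assoc)
  qed
  show "resolvent \<phi> \<in> BS" by (rule BS_I(1)[OF out cont a b])
  have "B_norm \<gamma> (resolvent \<phi>) \<le> K * B_norm \<gamma> \<phi> + K * B_norm \<gamma> \<phi>" by (rule BS_I(2)[OF out cont a b])
  then show "B_norm \<gamma> (resolvent \<phi>) \<le> (K + K) * B_norm \<gamma> \<phi>" by (simp only: distrib_right)
qed

lemma resolvent_bounded_op: "resolvent \<in> bounded_ops \<gamma>"
proof -
  have "resolvent (\<lambda>v. \<phi> v + \<psi> v) = (\<lambda>v. resolvent \<phi> v + resolvent \<psi> v)" if "\<phi> \<in> BS" "\<psi> \<in> BS" for \<phi> \<psi>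
  proof
    fix v
    have "res_term n (\<lambda>v. \<phi> v + \<psi> v) v = res_term n \<phi> v + res_term n \<psi> v" for n
      by (simp only: res_term_def op_iter(2)[OF T that] distrib_left)
    then show "resolvent (\<lambda>v. \<phi> v + \<psi> v) v = resolvent \<phi> v + resolvent \<psi> v"
      by (simp add: resolvent_def suminf_add[OF res_summable res_summable] that)
  qed
  moreover have "resolvent (\<lambda>v. c * \<phi> v) = (\<lambda>v. c * resolvent \<phi> v)" if "\<phi> \<in> BS" for \<phi> c
  proof
    fix v
    have "res_term n (\<lambda>v. c * \<phi> v) v = c * res_term n \<phi> v" for n
      by (simp add: res_term_def op_iter(3)[OF T that])
    then show "resolvent (\<lambda>v. c * \<phi> v) v = c * resolvent \<phi> v"
      by (simp add: resolvent_def suminf_mult[OF res_summable] that)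
  qed
  ultimately show ?thesis unfolding bounded_ops_def using resolvent_BS by blast
qed

lemma tail_tendsto: assumes "\<phi> \<in> BS" shows "(\<lambda>n. (T ^^ n) \<phi> v / z ^ n) \<longlonglongrightarrow> 0"
proof -
  have "(\<lambda>n. z * res_term n \<phi> v) \<longlonglongrightarrow> z * 0"
    by (intro tendsto_mult_left summable_LIMSEQ_zero res_summable assms)
  moreover have "z * res_term n \<phi> v = (T ^^ n) \<phi> v / z ^ n" for n
    using z0 by (simp add: res_term_def)
  ultimately show ?thesis by simp
qed

text \<open>The terms of the series telescope to the zeroth one, because
  \<open>(T ^^ n) \<phi> v / z ^ n\<close> tends to 0.\<close>

lemma resolvent_left:
  assumes \<phi>: "\<phi> \<in> BS" shows "resolvent (\<lambda>v. z * \<phi> v - T \<phi> v) = \<phi>"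
proof
  fix v
  have it: "(T ^^ n) (\<lambda>v. z * \<phi> v - T \<phi> v) v = z * (T ^^ n) \<phi> v - (T ^^ Suc n) \<phi> v" for n
  proof -
    have "(\<lambda>v. z * \<phi> v - T \<phi> v) = (\<lambda>v. z * \<phi> v + (-1) * T \<phi> v)" by simp
    moreover have "(T ^^ n) (\<lambda>v. z * \<phi> v + (-1) * T \<phi> v) = (\<lambda>v. z * (T ^^ n) \<phi> v + (-1) * (T ^^ n) (T \<phi>) v)"
      using \<phi> op_D(1)[OF T \<phi>] by (simp only: op_iter(2,3)[OF T] BS_scale)
    ultimately show ?thesis by (simp add: funpow_swap1)
  qed
  have "(\<lambda>n. (T ^^ n) \<phi> v / z ^ n - (T ^^ Suc n) \<phi> v / z ^ Suc n) sums ((T ^^ 0) \<phi> v / z ^ 0 - 0)"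
    by (rule telescope_sums'[OF tail_tendsto[OF \<phi>]])
  moreover have "(T ^^ n) \<phi> v / z ^ n - (T ^^ Suc n) \<phi> v / z ^ Suc n = res_term n (\<lambda>v. z * \<phi> v - T \<phi> v) v" for n
    using z0 unfolding res_term_def it by (simp add: field_simps)
  ultimately show "resolvent (\<lambda>v. z * \<phi> v - T \<phi> v) v = \<phi> v"
    unfolding resolvent_def by (simp add: sums_iff)
qed

lemma resolvent_right:
  assumes \<phi>: "\<phi> \<in> BS" shows "(\<lambda>v. z * resolvent \<phi> v - T (resolvent \<phi>) v) = \<phi>"
proof
  fix v
  show "z * resolvent \<phi> v - T (resolvent \<phi>) v = \<phi> v"
  proof (cases "v \<in> simplex_S")
    case False
    then show ?thesis
      using BS_D(1)[OF resolvent_BS(1)[OF \<phi>] False] BS_D(1)[OF op_D(1)[OF T resolvent_BS(1)[OF \<phi>]] False] BS_D(1)[OF \<phi> False]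
      by simp
  next
    case True
    define S where "S n = (\<lambda>v. \<Sum>i<n. res_term i \<phi> v)" for n
    have SB: "S n \<in> BS" for n unfolding S_def by (intro BS_sum res_term_BS \<phi>) auto
    have lim1: "(\<lambda>n. S n v) \<longlonglongrightarrow> resolvent \<phi> v"
      using tendsto_uniform_limitI[OF resolvent_uniform[OF \<phi>] True] by (simp add: S_def)
    have lim2: "(\<lambda>n. T (S n) v) \<longlonglongrightarrow> T (resolvent \<phi>) v"
    proof (rule LIMSEQ_I)
      fix e :: real assume e: "0 < e"
      define d where "d = e / (\<bar>C'\<bar> + 1)"
      have d: "0 < d" using e by (simp add: d_def)
      have "\<forall>\<^sub>F n in sequentially. \<forall>x\<in>simplex_S. dist (S n x) (resolvent \<phi> x) < d"
        using resolvent_uniform[OF \<phi>] d unfolding uniform_limit_iff S_def by blast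
      then obtain N where N: "\<And>n x. N \<le> n \<Longrightarrow> x \<in> simplex_S \<Longrightarrow> dist (S n x) (resolvent \<phi> x) < d"
        unfolding eventually_sequentially by blast
      have "norm (T (S n) v - T (resolvent \<phi>) v) < e" if n: "N \<le> n" for n
      proof -
        have "T (S n) v - T (resolvent \<phi>) v = T (\<lambda>v. S n v - resolvent \<phi> v) v"
          by (simp add: op_diff[OF T SB resolvent_BS(1)[OF \<phi>]])
        also have "cmod \<dots> \<le> C' * d"
          using N[OF n] by (intro supc BS_diff SB resolvent_BS(1) \<phi> True) (auto simp: dist_norm less_imp_le)
        also have "\<dots> \<le> \<bar>C'\<bar> * d" using d by (intro mult_right_mono) auto
        also have "\<dots> < e" using e by (simp add: d_def field_simps)
        finally show ?thesis .
      qed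
      then show "\<exists>no. \<forall>n\<ge>no. norm (T (S n) v - T (resolvent \<phi>) v) < e" by blast
    qed
    have eq: "z * S n v - T (S n) v = \<phi> v - (T ^^ n) \<phi> v / z ^ n" for n
    proof -
      have "T (S n) = (\<lambda>v. \<Sum>i<n. T (res_term i \<phi>) v)"
        unfolding S_def by (rule op_sum[OF T]) (auto intro: res_term_BS \<phi>)
      moreover have "T (res_term i \<phi>) v = (T ^^ Suc i) \<phi> v / z ^ Suc i" for i
        using op_D(3)[OF T op_iter(1)[OF T \<phi>], of "1 / z ^ Suc i" i] by (simp add: res_term_def[abs_def])
      ultimately have "z * S n v - T (S n) v = (\<Sum>i<n. (T ^^ i) \<phi> v / z ^ i - (T ^^ Suc i) \<phi> v / z ^ Suc i)"
        using z0 by (simp add: S_def sum_distrib_left sum_subtractf res_term_def)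
      also have "\<dots> = (T ^^ 0) \<phi> v / z ^ 0 - (T ^^ n) \<phi> v / z ^ n"
        by (rule sum_lessThan_telescope')
      finally show ?thesis by simp
    qed
    have "(\<lambda>n. z * S n v - T (S n) v) \<longlonglongrightarrow> z * resolvent \<phi> v - T (resolvent \<phi>) v"
      by (intro tendsto_intros lim1 lim2)
    moreover have "(\<lambda>n. \<phi> v - (T ^^ n) \<phi> v / z ^ n) \<longlonglongrightarrow> \<phi> v - 0"
      by (intro tendsto_diff tendsto_const tail_tendsto \<phi>)
    ultimately show ?thesis unfolding eq using LIMSEQ_unique by fastforce
  qed
qed

lemma not_in_spectrum: "z \<notin> op_spectrum \<gamma> T"
  unfolding op_spectrum_def using resolvent_bounded_op resolvent_left resolvent_right by blast

end

text \<open>\<open>spec_radius\<close> is a supremum over the spectrum, so bounding its points is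
  informative only once the spectrum is known to be nonempty; the kernel vector
  \<open>\<psi>\<close> puts 0 into it.\<close>

lemma spec_radius_le:
  fixes T :: "(real^'d \<Rightarrow> complex) \<Rightarrow> real^'d \<Rightarrow> complex"
  assumes T: "T \<in> bounded_ops \<gamma>" and C: "0 \<le> C" and \<rho>: "0 < \<rho>"
    and sup: "\<And>n \<phi> v. \<phi> \<in> BS \<Longrightarrow> v \<in> simplex_S \<Longrightarrow> cmod ((T ^^ n) \<phi> v) \<le> C * \<rho> ^ n * B_norm \<gamma> \<phi>"
    and hoe: "\<And>n \<phi> u v. \<phi> \<in> BS \<Longrightarrow> u \<in> simplex_S \<Longrightarrow> v \<in> simplex_S \<Longrightarrow>
       cmod ((T ^^ n) \<phi> u - (T ^^ n) \<phi> v) \<le> C * \<rho> ^ n * B_norm \<gamma> \<phi> * d_hilbert u v powr \<gamma>"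
    and supc: "\<And>\<phi> b v. \<phi> \<in> BS \<Longrightarrow> (\<And>v. v \<in> simplex_S \<Longrightarrow> cmod (\<phi> v) \<le> b) \<Longrightarrow> v \<in> simplex_S \<Longrightarrow> cmod (T \<phi> v) \<le> C' * b"
    and ker: "\<psi> \<in> BS" "\<psi> \<noteq> (\<lambda>v. 0)" "T \<psi> = (\<lambda>v. 0)"
  shows "spec_radius \<gamma> T \<le> \<rho>"
proof -
  have "0 \<in> op_spectrum \<gamma> T"
  proof -
    have "R (\<lambda>v. 0 * \<psi> v - T \<psi> v) \<noteq> \<psi>" if "R \<in> bounded_ops \<gamma>" for R
      using op_zero[OF that] ker by simp
    then show ?thesis unfolding op_spectrum_def using ker(1) by blast
  qed
  moreover have "cmod z \<le> \<rho>" if "z \<in> op_spectrum \<gamma> T" for z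
  proof (rule ccontr)
    assume "\<not> cmod z \<le> \<rho>"
    then have "\<rho> < cmod z" by simp
    from not_in_spectrum[OF T C \<rho> this sup hoe supc] that show False by blast
  qed
  ultimately show ?thesis unfolding spec_radius_def by (intro cSUP_least) auto
qed

end

subsection \<open>Duality and the spectral decomposition\<close>

text \<open>The bounds on scalar products make the kernel \<open>(v \<bullet> u) powr s\<close>
  usable for both signs of \<open>s\<close>: \<open>\<epsilon>\<close> keeps it off its singularity
  when \<open>s < 0\<close>, \<open>M\<close> dominates it, and \<open>e\<close> will make the
  eigenfunction positive on \<open>X1\<close>. They concern \<open>u\<close> in \<open>X2\<close>,
  since the dual eigenmeasure lives there.\<close>

locale dual_pair =
  A: matrix_transfer \<mu> X1 s C1 \<gamma> c1 L1 D1 good1 +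
  B: matrix_transfer "distr \<mu> borel transpose" X2 s C2 \<gamma> c2 L2 D2 good2
  for \<mu> :: "(real^'d^'d) measure" and s \<gamma> :: real and X1 C1 c1 L1 D1 good1 X2 C2 c2 L2 D2 good2 +
  fixes \<epsilon> e M :: real
  assumes dim: "CARD('d) \<ge> 2" and \<gamma>_le: "\<gamma> \<le> 1"
    and \<epsilon>: "0 \<le> \<epsilon>" "s < 0 \<Longrightarrow> 0 < \<epsilon>" "\<And>v u. v \<in> simplex_S \<Longrightarrow> u \<in> X2 \<Longrightarrow> \<epsilon> \<le> v \<bullet> u"
    and e: "0 < e" "\<And>v u. v \<in> X1 \<Longrightarrow> u \<in> X2 \<Longrightarrow> e \<le> (v \<bullet> u) powr s"
    and M: "\<And>v u. v \<in> simplex_S \<Longrightarrow> u \<in> X2 \<Longrightarrow> (v \<bullet> u) powr s \<le> M"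
begin

sublocale hoelder_space \<gamma> "TYPE('d)"
  by standard (use dim A.\<gamma>_pos in auto)

interpretation N: prob_space B.nuM by (rule B.prob_nuM)

text \<open>The truncation at \<open>\<epsilon>\<close> changes nothing on \<open>X2\<close>, where the measure lives, but makes the kernel
  continuous on the whole simplex also for negative \<open>s\<close>.\<close>

definition truncp :: "real^'d \<Rightarrow> real^'d \<Rightarrow> real" where "truncp v u = (max \<epsilon> (v \<bullet> u)) powr s"

text \<open>The candidate for \<open>r_fun\<close>, formed with the constructed measure before that
  is known to be \<open>nu_star\<close>.\<close>

definition rs :: "real^'d \<Rightarrow> real" where
  "rs v = (if v \<in> simplex_S then (\<integral>u. (v \<bullet> u) powr s \<partial>B.nuM) else 0)"

lemma truncp_X2: "v \<in> simplex_S \<Longrightarrow> u \<in> X2 \<Longrightarrow> truncp v u = (v \<bullet> u) powr s"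
  using \<epsilon>(3)[of v u] by (simp add: truncp_def max_def)

lemma truncp_cont: "continuous_on simplex_S (truncp v)"
  unfolding truncp_def
proof (rule continuous_on_powr')
  have "max \<epsilon> (v \<bullet> u) = 0 \<Longrightarrow> 0 < s" for u using \<epsilon>(1,2) A.s_nz by (cases "s < 0") (auto simp: max_def split: if_splits)
  then show "\<forall>x\<in>simplex_S. 0 \<le> max \<epsilon> (v \<bullet> x) \<and> (max \<epsilon> (v \<bullet> x) = 0 \<longrightarrow> 0 < s)" using \<epsilon>(1) by (auto simp: le_max_iff_disj)
  show "continuous_on simplex_S (\<lambda>u. max \<epsilon> (v \<bullet> u))"
    by (intro continuous_on_max continuous_on_inner continuous_on_const continuous_on_id)
  show "continuous_on simplex_S (\<lambda>u. s)" by (rule continuous_on_const)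
qed

lemma res_truncp: "B.res (truncp v) \<in> B.CY" by (rule B.res_CY[OF truncp_cont])

lemma id_nuM: "(\<lambda>u. u) \<in> measurable B.nuM borel"
  using measurable_ident_sets[OF refl, of "restrict_space borel simplex_S"]
  by (subst measurable_cong_sets[OF B.sets_nuM refl]) (rule measurable_restrict_space1, simp)

lemma inner_meas: "(\<lambda>u. (x \<bullet> u) powr s) \<in> borel_measurable B.nuM"
  using id_nuM by measurable

lemma inner_int:
  assumes v: "v \<in> simplex_S" shows "integrable B.nuM (\<lambda>u. (v \<bullet> u) powr s)"
proof (rule N.integrable_const_bound[where B=M])
  show "AE u in B.nuM. norm ((v \<bullet> u) powr s) \<le> M" using B.AE_nuM_X by eventually_elim (use M v in auto)
  show "(\<lambda>u. (v \<bullet> u) powr s) \<in> borel_measurable B.nuM" by (rule inner_meas)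
qed

lemma integral_res_truncp: assumes "v \<in> simplex_S" shows "(\<integral>u. B.res (truncp v) u \<partial>B.nuM) = rs v"
proof -
  have "(\<integral>u. B.res (truncp v) u \<partial>B.nuM) = (\<integral>u. (v \<bullet> u) powr s \<partial>B.nuM)"
  proof (rule integral_cong_AE[OF B.CY_meas_eta[OF B.prob_nuM B.sets_nuM res_truncp] inner_meas])
    show "AE u in B.nuM. B.res (truncp v) u = (v \<bullet> u) powr s"
      using B.AE_nuM_X by eventually_elim (use assms in \<open>auto simp: B.res_Y B.inY truncp_X2\<close>)
  qed
  then show ?thesis using assms by (simp add: rs_def)
qed

text \<open>Coordinatewise domination survives the scalar product with a nonnegative
  \<open>u\<close>, so \<open>v \<bullet> u\<close> and \<open>w \<bullet> u\<close> agree up to the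
  factor \<open>m_ratio v w * m_ratio w v\<close>, and \<open>powr_diff_bound\<close> applies under
  the integral. It puts \<open>rs\<close> into \<open>A.FX\<close>, the class in which
  eigenfunctions are unique.\<close>

lemma rs_diff:
  assumes v: "v \<in> simplex_S" and w: "w \<in> simplex_S" and N: "\<bar>s\<bar> \<le> real n"
  shows "\<bar>rs v - rs w\<bar> \<le> 2 * M * real n * d_hilbert v w powr \<gamma>"
proof -
  have d: "0 \<le> d_hilbert v w" "d_hilbert v w \<le> 1" using d_hilbert_nonneg d_hilbert_le_1 v w by auto
  have dg: "d_hilbert v w \<le> d_hilbert v w powr \<gamma>"
  proof (cases "d_hilbert v w = 0")
    case False
    then have "d_hilbert v w powr 1 \<le> d_hilbert v w powr \<gamma>" using d \<gamma>_le by (intro powr_mono') auto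
    then show ?thesis using d by simp
  qed simp
  have M0: "0 \<le> M"
  proof -
    obtain x where "x \<in> X2" using B.X_ne by auto
    from M[OF v this] show ?thesis by (meson order_trans powr_ge_zero)
  qed
  have le: "m_ratio a b * (b \<bullet> u) \<le> a \<bullet> u" if "a \<in> simplex_S" "b \<in> simplex_S" "u \<in> simplex_S" for a b u :: "real^'d"
  proof -
    have "m_ratio a b * (b $ i * u $ i) \<le> a $ i * u $ i" for i
      using mult_right_mono[OF m_ratio_mult_le[OF that(1,2), of i] simplex_D(1)[OF that(3), of i]] by (simp add: mult.assoc)
    then show ?thesis unfolding inner_vec_def by (simp add: sum_distrib_left sum_mono)
  qed
  let ?y = "m_ratio v w * m_ratio w v"
  have pt: "\<bar>(v \<bullet> u) powr s - (w \<bullet> u) powr s\<bar> \<le> M * real n * (1 - ?y)" if u: "u \<in> X2" for u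
  proof (rule powr_diff_bound)
    have uS: "u \<in> simplex_S" using u B.inY by auto
    have vu: "\<epsilon> \<le> v \<bullet> u" and wu: "\<epsilon> \<le> w \<bullet> u" using \<epsilon>(3) u v w by auto
    then show "0 \<le> v \<bullet> u" "0 \<le> w \<bullet> u" using \<epsilon>(1) by auto
    show "s < 0 \<Longrightarrow> 0 < v \<bullet> u \<and> 0 < w \<bullet> u" using \<epsilon>(2) vu wu by auto
    have "?y * (w \<bullet> u) \<le> m_ratio v w * (w \<bullet> u)"
      using m_ratio_prod[OF v w] \<open>0 \<le> w \<bullet> u\<close> by (intro mult_right_mono) auto
    then show "?y * (w \<bullet> u) \<le> v \<bullet> u" using le[OF v w uS] by linarith
    have "?y * (v \<bullet> u) \<le> m_ratio w v * (v \<bullet> u)"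
      using m_ratio_prod[OF v w] \<open>0 \<le> v \<bullet> u\<close> by (intro mult_right_mono) auto
    then show "?y * (v \<bullet> u) \<le> w \<bullet> u" using le[OF w v uS] by linarith
  qed (use M u v w A.s_nz N m_ratio_prod[OF v w] in auto)
  have "norm (\<integral>u. (v \<bullet> u) powr s - (w \<bullet> u) powr s \<partial>B.nuM) \<le> (\<integral>u. M * real n * (1 - ?y) \<partial>B.nuM)"
  proof (rule integral_norm_bound_AE)
    show "AE u in B.nuM. norm ((v \<bullet> u) powr s - (w \<bullet> u) powr s) \<le> M * real n * (1 - ?y)"
      using B.AE_nuM_X by eventually_elim (use pt in auto)
  qed (intro Bochner_Integration.integrable_diff inner_int v w N.integrable_const)+
  then have "\<bar>rs v - rs w\<bar> \<le> M * real n * (1 - ?y)"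
    using inner_int v w N.prob_space by (simp add: rs_def)
  also have "\<dots> \<le> M * real n * (2 * d_hilbert v w powr \<gamma>)"
    using one_minus_m_ratio_prod_le[OF v w] dg M0 by (intro mult_left_mono) auto
  finally show ?thesis by (simp add: mult_ac)
qed

lemma rs_CY: "rs \<in> A.CY"
proof -
  have "continuous_on simplex_S rs"
    unfolding continuous_on_sequentially
  proof (intro allI ballI impI)
    fix x :: "nat \<Rightarrow> real^'d" and a assume a: "a \<in> simplex_S" and x: "(\<forall>n. x n \<in> simplex_S) \<and> x \<longlonglongrightarrow> a"
    have "(\<lambda>n. \<integral>u. (x n \<bullet> u) powr s \<partial>B.nuM) \<longlonglongrightarrow> (\<integral>u. (a \<bullet> u) powr s \<partial>B.nuM)"
    proof (rule integral_dominated_convergence[where w="\<lambda>_. M"])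
      show "AE u in B.nuM. (\<lambda>n. (x n \<bullet> u) powr s) \<longlonglongrightarrow> (a \<bullet> u) powr s"
        using B.AE_nuM_X
      proof eventually_elim
        case (elim u)
        have "(\<lambda>n. max \<epsilon> (x n \<bullet> u) powr s) \<longlonglongrightarrow> max \<epsilon> (a \<bullet> u) powr s"
        proof (rule tendsto_powr')
          show "(\<lambda>n. max \<epsilon> (x n \<bullet> u)) \<longlonglongrightarrow> max \<epsilon> (a \<bullet> u)" using x by (intro tendsto_intros) auto
          show "max \<epsilon> (a \<bullet> u) \<noteq> 0 \<or> 0 < s \<and> (\<forall>\<^sub>F n in sequentially. 0 \<le> max \<epsilon> (x n \<bullet> u))"
            using \<epsilon>(1,2) A.s_nz by (cases "s < 0") (auto simp: le_max_iff_disj)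
        qed simp
        then show ?case using truncp_X2[OF _ elim] a x unfolding truncp_def by simp
      qed
      show "AE u in B.nuM. norm ((x n \<bullet> u) powr s) \<le> M" for n
        using B.AE_nuM_X by eventually_elim (use M x in auto)
    qed (use inner_meas in auto)
    then show "(rs \<circ> x) \<longlonglongrightarrow> rs a" using a x by (simp add: rs_def comp_def)
  qed
  then show ?thesis by (simp add: A.CY_def rs_def)
qed

lemma rs_FX: "rs \<in> A.FX"
proof -
  obtain n where n: "\<bar>s\<bar> \<le> real n" using real_arch_simple by blast
  obtain x where "x \<in> X2" using B.X_ne by auto
  from M[OF barycenter_in_simplex this] have "0 \<le> M" by (meson order_trans powr_ge_zero)
  then show ?thesis
    by (intro A.FX_I[OF rs_CY, of "2 * M * real n"] rs_diff n A.inY) auto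
qed

lemma rs_pos: assumes "v \<in> X1" shows "0 < rs v"
proof -
  have "e \<le> (\<integral>u. (v \<bullet> u) powr s \<partial>B.nuM)"
    using inner_int[OF A.inY[OF assms]]
    by (rule N.integral_ge_const) (use B.AE_nuM_X in eventually_elim, use e(2) assms in auto)
  then show ?thesis using e(1) A.inY[OF assms] by (simp add: rs_def)
qed

section \<open>Duality through Fubini's theorem\<close>

lemma inner_act:
  fixes g :: "real^'d^'d"
  assumes "pos_matrix g" "v \<in> simplex_S" "u \<in> simplex_S"
  shows "vnorm (g *v v) powr s * (act g v \<bullet> u) powr s = ((g *v v) \<bullet> u) powr s"
proof -
  have p: "0 < vnorm (g *v v)" using pos_matrix_mult_pos(2)[OF assms(1,2)] .
  have "0 \<le> act g v \<bullet> u"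
    using simplex_D(1)[OF act_in_simplex[OF assms(1,2)]] simplex_D(1)[OF assms(3)] by (simp add: inner_vec_def sum_nonneg)
  moreover have "(g *v v) \<bullet> u = vnorm (g *v v) * (act g v \<bullet> u)" using p by (simp add: act_def)
  ultimately show ?thesis using p by (simp add: powr_mult)
qed

lemma AE_good2: "AE g in \<mu>. good2 (transpose g)"
proof -
  have "transpose \<in> measurable \<mu> borel"
    by (simp add: measurable_cong_sets[OF A.sets_mu refl])
  then show ?thesis by (rule AE_distrD[OF _ B.AE_good])
qed

text \<open>The double integral of \<open>((g *v v) \<bullet> u) powr s\<close> is read in two ways:
  with \<open>g\<close> acting on \<open>v\<close> it is \<open>A.P rs v\<close>, and with
  \<open>transpose g\<close> acting on \<open>u\<close> it is the integral of the dual operator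
  applied to the kernel, where the eigenmeasure produces the factor \<open>B.k\<close>.\<close>

lemma A_P_rs: assumes v: "v \<in> simplex_S" shows "A.P rs v = B.k * rs v"
proof -
  interpret pair_prob_space \<mu> B.nuM ..
  note [measurable_cong] = A.sets_mu
  define F where "F g u = ((g *v v) \<bullet> u) powr s" for g :: "real^'d^'d" and u
  have snd_m [measurable]: "(\<lambda>p. snd p) \<in> borel_measurable (\<mu> \<Otimes>\<^sub>M B.nuM)"
    by (rule measurable_compose[OF measurable_snd id_nuM])
  have fst_m [measurable]: "(\<lambda>p. fst p) \<in> borel_measurable (\<mu> \<Otimes>\<^sub>M B.nuM)" by measurable
  have Fm: "(\<lambda>p. F (fst p) (snd p)) \<in> borel_measurable (\<mu> \<Otimes>\<^sub>M B.nuM)" unfolding F_def by measurable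
  have vb: "F g u = vnorm (g *v v) powr s * (act g v \<bullet> u) powr s" if "good1 g" "u \<in> X2" for g u
    unfolding F_def using inner_act[OF A.good_pos[OF that(1)] v] B.inY[OF that(2)] by simp
  have inner1: "(\<integral>u. F g u \<partial>B.nuM) = vnorm (g *v v) powr s * rs (act g v)" if g: "good1 g" for g
  proof -
    have aS: "act g v \<in> simplex_S" using A.T_X[OF g v] A.inY by auto
    have "(\<integral>u. F g u \<partial>B.nuM) = (\<integral>u. vnorm (g *v v) powr s * (act g v \<bullet> u) powr s \<partial>B.nuM)"
    proof (rule integral_cong_AE)
      show "AE u in B.nuM. F g u = vnorm (g *v v) powr s * (act g v \<bullet> u) powr s"
        using B.AE_nuM_X by eventually_elim (use vb[OF g] in auto)
    qed (use inner_meas in \<open>auto simp: F_def\<close>)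
    then show ?thesis using aS by (simp add: rs_def)
  qed
  have int1: "integrable B.nuM (F g)" if g: "good1 g" for g
  proof -
    have "act g v \<in> simplex_S" using A.T_X[OF g v] A.inY by auto
    then have "integrable B.nuM (\<lambda>u. vnorm (g *v v) powr s * (act g v \<bullet> u) powr s)" using inner_int by simp
    then show ?thesis
    proof (rule Bochner_Integration.integrable_bound)
      show "F g \<in> borel_measurable B.nuM" unfolding F_def by (rule inner_meas)
      show "AE u in B.nuM. norm (F g u) \<le> norm (vnorm (g *v v) powr s * (act g v \<bullet> u) powr s)"
        using B.AE_nuM_X by eventually_elim (use vb[OF g] in auto)
    qed
  qed
  have intF: "integrable (\<mu> \<Otimes>\<^sub>M B.nuM) (\<lambda>p. F (fst p) (snd p))"
  proof (rule Fubini_integrable[OF Fm])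
    show "AE x in \<mu>. integrable B.nuM (\<lambda>y. F (fst (x, y)) (snd (x, y)))"
      using A.AE_good by eventually_elim (use int1 in auto)
    have "(\<lambda>x. \<integral>y. norm (F (fst (x, y)) (snd (x, y))) \<partial>B.nuM) \<in> borel_measurable \<mu>"
      using Fm by (intro N.borel_measurable_lebesgue_integral) (simp add: case_prod_beta')
    moreover have "AE g in \<mu>. (\<integral>y. norm (F (fst (g, y)) (snd (g, y))) \<partial>B.nuM) = vnorm (g *v v) powr s * rs (act g v)"
      using A.AE_good by eventually_elim (use inner1 in \<open>simp add: F_def\<close>)
    ultimately show "integrable \<mu> (\<lambda>x. \<integral>y. norm (F (fst (x, y)) (snd (x, y))) \<partial>B.nuM)"
      using A.P_int[OF rs_CY v] by (subst integrable_cong_AE) auto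
  qed
  have "A.P rs v = (\<integral>g. (\<integral>u. F g u \<partial>B.nuM) \<partial>\<mu>)"
  proof -
    have "(\<lambda>g. \<integral>u. F g u \<partial>B.nuM) \<in> borel_measurable \<mu>"
      using Fm by (intro N.borel_measurable_lebesgue_integral) (simp add: case_prod_beta')
    then have "(\<integral>g. vnorm (g *v v) powr s * rs (act g v) \<partial>\<mu>) = (\<integral>g. (\<integral>u. F g u \<partial>B.nuM) \<partial>\<mu>)"
      using A.AE_good A.meas_T[OF rs_CY v] by (intro integral_cong_AE) (auto elim!: eventually_mono simp: inner1)
    then show ?thesis using v by (simp add: A.P_in)
  qed
  also have "\<dots> = (\<integral>u. (\<integral>g. F g u \<partial>\<mu>) \<partial>B.nuM)"
    by (rule Fubini_integral[symmetric]) (use intF in \<open>simp add: case_prod_beta'\<close>)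
  \<comment> \<open>Almost every \<open>transpose g\<close> sends each \<open>u\<close> of the
    simplex into \<open>X2\<close>, where \<open>truncp v\<close> is the true kernel. The integrands
    therefore agree for every \<open>u\<close>, not just for those in \<open>X2\<close>.\<close>
  also have "\<dots> = (\<integral>u. B.P (B.res (truncp v)) u \<partial>B.nuM)"
  proof (rule Bochner_Integration.integral_cong[OF refl])
    fix u assume "u \<in> space B.nuM"
    then have u: "u \<in> simplex_S" by (simp add: B.space_eta[OF B.prob_nuM B.sets_nuM])
    note [measurable] = B.CY_meas[OF res_truncp[of v]]
    have "B.P (B.res (truncp v)) u = (\<integral>g. vnorm (transpose g *v u) powr s * B.res (truncp v) (act (transpose g) u) \<partial>\<mu>)"
      unfolding B.P_in[OF u] by (rule integral_distr) measurable
    also have "\<dots> = (\<integral>g. F g u \<partial>\<mu>)"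
    proof (rule integral_cong_AE)
      show "(\<lambda>g. vnorm (transpose g *v u) powr s * B.res (truncp v) (act (transpose g) u)) \<in> borel_measurable \<mu>"
        by measurable
      show "(\<lambda>g. F g u) \<in> borel_measurable \<mu>" unfolding F_def by measurable
      show "AE g in \<mu>. vnorm (transpose g *v u) powr s * B.res (truncp v) (act (transpose g) u) = F g u"
        using AE_good2
      proof eventually_elim
        case (elim g)
        have aX: "act (transpose g) u \<in> X2" by (rule B.T_X[OF elim u])
        have "vnorm (transpose g *v u) powr s * (act (transpose g) u \<bullet> v) powr s = ((transpose g *v u) \<bullet> v) powr s"
          by (rule inner_act[OF B.good_pos[OF elim] u v])
        also have "(transpose g *v u) \<bullet> v = (g *v v) \<bullet> u"
          by (metis dot_lmul_matrix inner_commute transpose_matrix_vector)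
        finally show ?case using truncp_X2[OF v aX] B.inY[OF aX] by (simp add: B.res_Y F_def inner_commute)
      qed
    qed
    finally show "(\<integral>g. F g u \<partial>\<mu>) = B.P (B.res (truncp v)) u" by simp
  qed
  also have "\<dots> = B.k * rs v" using B.nuM_P[OF res_truncp] integral_res_truncp[OF v] by simp
  finally show ?thesis .
qed

lemma A_P_rs_fun: "A.P rs = (\<lambda>v. B.k * rs v)"
proof
  fix v show "A.P rs v = B.k * rs v"
  proof (cases "v \<in> simplex_S")
    case False
    then show ?thesis unfolding A.P_out[OF False] A.CY_out[OF rs_CY False] by simp
  qed (rule A_P_rs)
qed

text \<open>Uniqueness of positive eigenfunctions of \<open>A.P\<close>, applied to
  \<open>rs\<close>, delivers the equality of the eigenvalues and the proportionality to
  \<open>A.r\<close> together.\<close>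

lemma k_eq: "B.k = A.k" and rs_eq: "rs v = A.nuF rs * A.r v" and nuF_rs: "0 < A.nuF rs"
proof -
  show "B.k = A.k" "0 < A.nuF rs" using A.eigenfunction_unique[OF rs_FX rs_pos A_P_rs_fun] by auto
  show "rs v = A.nuF rs * A.r v"
    using A.eigenfunction_unique(3)[OF rs_FX rs_pos A_P_rs_fun, of v] A.CY_out[OF rs_CY] A.CY_out[OF A.r_CY]
    by (cases "v \<in> simplex_S") auto
qed

text \<open>On continuous functions \<open>P_star\<close> is \<open>P_op\<close> for the law of the
  transposed matrices, and \<open>k_eq\<close> lets the uniqueness for \<open>B.k\<close> be used
  with \<open>A.k\<close>.\<close>

lemma nu_star_eq: "nu_star \<mu> A.k s = B.nuM"
proof -
  have eq: "P_star \<mu> s \<phi> = P_op (distr \<mu> borel transpose) s \<phi>"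
    if \<phi>: "continuous_on simplex_S \<phi> \<and> (\<forall>v. v \<notin> simplex_S \<longrightarrow> \<phi> v = 0)" for \<phi>
  proof (rule ext)
    fix v
    note [measurable_cong] = A.sets_mu
    have CC: "\<phi> \<in> B.CC" using \<phi> by (simp add: B.CC_def)
    have [measurable]: "\<phi> \<in> borel_measurable borel"
      using B.CY_meas[OF B.CC_Re[OF CC]] B.CY_meas[OF B.CC_Im[OF CC]] by (subst borel_measurable_complex_iff) auto
    have "(\<integral>g. complex_of_real (vnorm (g *v v) powr s) * \<phi> (act g v) \<partial>distr \<mu> borel transpose)
      = (\<integral>g. complex_of_real (vnorm (transpose g *v v) powr s) * \<phi> (act (transpose g) v) \<partial>\<mu>)"
      by (rule integral_distr) measurable
    then show "P_star \<mu> s \<phi> v = P_op (distr \<mu> borel transpose) s \<phi> v"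
      by (simp add: P_star_def P_op_def)
  qed
  have "prob_eigenmeasure (P_star \<mu> s) A.k \<eta> \<longleftrightarrow> prob_eigenmeasure (P_op (distr \<mu> borel transpose) s) A.k \<eta>" for \<eta>
    unfolding prob_eigenmeasure_def using eq by auto
  then have "prob_eigenmeasure (P_star \<mu> s) A.k \<eta> \<longleftrightarrow> \<eta> = B.nuM" for \<eta>
    using B.prob_eigenmeasure_iff[of \<eta>] by (simp add: k_eq)
  then show ?thesis unfolding nu_star_def by (intro the_equality) auto
qed

lemma r_fun_eq: "r_fun \<mu> A.k s = (\<lambda>v. complex_of_real (A.nuF rs * A.r v))"
proof
  fix v
  show "r_fun \<mu> A.k s v = complex_of_real (A.nuF rs * A.r v)"
    unfolding rs_eq[symmetric] by (simp add: r_fun_def nu_star_eq rs_def)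
qed

text \<open>\<open>r_fun\<close> is a positive multiple of \<open>A.r\<close>, whose integral is 1,
  so the quotient in \<open>M_op\<close> cancels the multiple.\<close>

lemma M_op_eq: "M_op \<mu> A.k s \<phi> = (\<lambda>v. (\<integral>u. \<phi> u \<partial>A.nuM) * complex_of_real (A.r v))"
proof -
  have "(\<integral>u. r_fun \<mu> A.k s u \<partial>A.nuM) = complex_of_real (A.nuF rs)"
    unfolding r_fun_eq by (simp add: A.nuM_r del: of_real_mult)
  then show ?thesis
    unfolding M_op_def A.nu_eq r_fun_eq using nuF_rs by (simp add: fun_eq_iff)
qed

section \<open>The projection and the complementary operator on the Hoelder space\<close>

definition MM :: "(real^'d \<Rightarrow> complex) \<Rightarrow> real^'d \<Rightarrow> complex" where
  "MM \<phi> = (\<lambda>v. (\<integral>u. \<phi> u \<partial>A.nuM) * complex_of_real (A.r v))"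

definition LL :: "(real^'d \<Rightarrow> complex) \<Rightarrow> real^'d \<Rightarrow> complex" where
  "LL \<phi> = (\<lambda>v. P_op \<mu> s \<phi> v - complex_of_real A.k * MM \<phi> v)"

lemma BS_CC: "\<phi> \<in> BS \<Longrightarrow> \<phi> \<in> A.CC"
  using BS_D(1,2)[of \<phi>] by (auto simp: A.CC_def)

lemma parts_bounds:
  assumes \<phi>: "\<phi> \<in> BS" and f: "f = (\<lambda>v. Re (\<phi> v)) \<or> f = (\<lambda>v. Im (\<phi> v))"
  shows "f \<in> A.CY" "v \<in> simplex_S \<Longrightarrow> \<bar>f v\<bar> \<le> B_norm \<gamma> \<phi>"
    "u \<in> simplex_S \<Longrightarrow> v \<in> simplex_S \<Longrightarrow> \<bar>f u - f v\<bar> \<le> B_norm \<gamma> \<phi> * d_hilbert u v powr \<gamma>"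
    "f \<in> A.FL"
proof -
  note D = BS_D[OF \<phi>]
  show C: "f \<in> A.CY" using A.CC_Re[OF BS_CC[OF \<phi>]] A.CC_Im[OF BS_CC[OF \<phi>]] f by auto
  show "\<bar>f v\<bar> \<le> B_norm \<gamma> \<phi>" if "v \<in> simplex_S"
    using D(3)[OF that] f abs_Re_le_cmod[of "\<phi> v"] abs_Im_le_cmod[of "\<phi> v"] by auto
  show L: "\<bar>f u - f v\<bar> \<le> B_norm \<gamma> \<phi> * d_hilbert u v powr \<gamma>" if "u \<in> simplex_S" "v \<in> simplex_S" for u v
    using D(4)[OF that] f abs_Re_le_cmod[of "\<phi> u - \<phi> v"] abs_Im_le_cmod[of "\<phi> u - \<phi> v"] by auto
  show "f \<in> A.FL" by (rule A.FL_I[OF A.CY_cont[OF C] D(5) L])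
qed

lemma combine_BS:
  assumes "f \<in> A.CY" "h \<in> A.CY"
    and "\<And>v. v \<in> simplex_S \<Longrightarrow> \<bar>f v\<bar> \<le> a" "\<And>v. v \<in> simplex_S \<Longrightarrow> \<bar>h v\<bar> \<le> a"
    and "\<And>u v. u \<in> simplex_S \<Longrightarrow> v \<in> simplex_S \<Longrightarrow> \<bar>f u - f v\<bar> \<le> b * d_hilbert u v powr \<gamma>"
    and "\<And>u v. u \<in> simplex_S \<Longrightarrow> v \<in> simplex_S \<Longrightarrow> \<bar>h u - h v\<bar> \<le> b * d_hilbert u v powr \<gamma>"
  defines "\<phi> \<equiv> \<lambda>v. complex_of_real (f v) + \<i> * complex_of_real (h v)"
  shows "\<phi> \<in> BS" "B_norm \<gamma> \<phi> \<le> 2 * a + 2 * b"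
    "v \<in> simplex_S \<Longrightarrow> cmod (\<phi> v) \<le> 2 * a"
    "u \<in> simplex_S \<Longrightarrow> v \<in> simplex_S \<Longrightarrow> cmod (\<phi> u - \<phi> v) \<le> 2 * b * d_hilbert u v powr \<gamma>"
proof -
  have out: "\<phi> v = 0" if "v \<notin> simplex_S" for v using that assms(1,2) by (simp add: \<phi>_def A.CY_def)
  have cont: "continuous_on simplex_S \<phi>" unfolding \<phi>_def using assms(1,2)
    by (intro continuous_intros) (auto simp: A.CY_def)
  have cm: "cmod (complex_of_real x + \<i> * complex_of_real y) \<le> \<bar>x\<bar> + \<bar>y\<bar>" for x y
    using norm_triangle_ineq[of "complex_of_real x" "\<i> * complex_of_real y"] by (simp add: norm_mult)
  show a: "cmod (\<phi> v) \<le> 2 * a" if "v \<in> simplex_S" for v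
    using assms(3,4)[OF that] cm[of "f v" "h v"] by (simp add: \<phi>_def)
  show b: "cmod (\<phi> u - \<phi> v) \<le> 2 * b * d_hilbert u v powr \<gamma>" if "u \<in> simplex_S" "v \<in> simplex_S" for u v
  proof -
    have "\<phi> u - \<phi> v = complex_of_real (f u - f v) + \<i> * complex_of_real (h u - h v)" by (simp add: \<phi>_def algebra_simps)
    then have "cmod (\<phi> u - \<phi> v) \<le> \<bar>f u - f v\<bar> + \<bar>h u - h v\<bar>"
      using cm[of "f u - f v" "h u - h v"] by simp
    then show ?thesis using assms(5,6)[OF that] by simp
  qed
  show "\<phi> \<in> BS" "B_norm \<gamma> \<phi> \<le> 2 * a + 2 * b" using BS_I[OF out cont a b] by auto
qed

lemma P_op_lin:
  assumes "\<phi> \<in> A.CC" "\<psi> \<in> A.CC"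
  shows "P_op \<mu> s (\<lambda>v. \<phi> v + \<psi> v) = (\<lambda>v. P_op \<mu> s \<phi> v + P_op \<mu> s \<psi> v)"
proof
  fix v
  have "(\<lambda>v. \<phi> v + \<psi> v) \<in> A.CC" using assms by (auto simp: A.CC_def intro: continuous_on_add)
  then show "P_op \<mu> s (\<lambda>v. \<phi> v + \<psi> v) v = P_op \<mu> s \<phi> v + P_op \<mu> s \<psi> v"
    using A.CC_Re[OF assms(1)] A.CC_Re[OF assms(2)] A.CC_Im[OF assms(1)] A.CC_Im[OF assms(2)]
    by (simp add: A.P_op_complex assms A.P_add algebra_simps)
qed

lemma integral_split:
  assumes "\<phi> \<in> A.CC"
  shows "(\<integral>u. \<phi> u \<partial>A.nuM) = complex_of_real (\<integral>u. Re (\<phi> u) \<partial>A.nuM) + \<i> * complex_of_real (\<integral>u. Im (\<phi> u) \<partial>A.nuM)"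
    and "integrable A.nuM \<phi>"
proof -
  note int = A.CY_int_eta[OF A.prob_nuM A.sets_nuM A.CC_Re[OF assms]] A.CY_int_eta[OF A.prob_nuM A.sets_nuM A.CC_Im[OF assms]]
  have eq: "\<phi> = (\<lambda>u. complex_of_real (Re (\<phi> u)) + \<i> * complex_of_real (Im (\<phi> u)))"
    by (simp add: fun_eq_iff complex_eq_iff)
  have i1: "integrable A.nuM (\<lambda>u. complex_of_real (Re (\<phi> u)))" "integrable A.nuM (\<lambda>u. \<i> * complex_of_real (Im (\<phi> u)))"
    using int by auto
  show "integrable A.nuM \<phi>" by (subst eq) (rule Bochner_Integration.integrable_add[OF i1])
  show "(\<integral>u. \<phi> u \<partial>A.nuM) = complex_of_real (\<integral>u. Re (\<phi> u) \<partial>A.nuM) + \<i> * complex_of_real (\<integral>u. Im (\<phi> u) \<partial>A.nuM)"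
    by (subst eq) (simp add: Bochner_Integration.integral_add[OF i1])
qed

lemma P_op_bounded: "P_op \<mu> s \<in> bounded_ops \<gamma>"
proof -
  define b where "b = A.Wbar * (L1 + c1)"
  have "P_op \<mu> s \<phi> \<in> BS \<and> B_norm \<gamma> (P_op \<mu> s \<phi>) \<le> (2 * A.Wbar + 2 * b) * B_norm \<gamma> \<phi>" if \<phi>: "\<phi> \<in> BS" for \<phi>
  proof -
    define n where "n = B_norm \<gamma> \<phi>"
    have n: "0 \<le> n" using BS_D(5)[OF \<phi>] by (simp add: n_def)
    have main: "A.P f \<in> A.CY" "\<And>v. v \<in> simplex_S \<Longrightarrow> \<bar>A.P f v\<bar> \<le> A.Wbar * n"
      "\<And>u v. u \<in> simplex_S \<Longrightarrow> v \<in> simplex_S \<Longrightarrow> \<bar>A.P f u - A.P f v\<bar> \<le> (b * n) * d_hilbert u v powr \<gamma>"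
      if f: "f = (\<lambda>v. Re (\<phi> v)) \<or> f = (\<lambda>v. Im (\<phi> v))" for f
    proof -
      note p = parts_bounds[OF \<phi> f, folded n_def]
      show "A.P f \<in> A.CY" by (rule A.P_CY[OF p(1)])
      show "\<bar>A.P f v\<bar> \<le> A.Wbar * n" if "v \<in> simplex_S" for v
        by (rule A.P_bound[OF p(1) p(2)[OF A.inY] that])
      show "\<bar>A.P f u - A.P f v\<bar> \<le> (b * n) * d_hilbert u v powr \<gamma>" if "u \<in> simplex_S" "v \<in> simplex_S" for u v
        using A.P_lip[OF p(1) p(2)[OF A.inY] p(3)[OF A.inY A.inY] n that] by (simp add: b_def algebra_simps)
    qed
    note c = combine_BS(1,2)[OF main(1)[of "\<lambda>v. Re (\<phi> v)"] main(1)[of "\<lambda>v. Im (\<phi> v)"]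
        main(2)[of "\<lambda>v. Re (\<phi> v)"] main(2)[of "\<lambda>v. Im (\<phi> v)"]
        main(3)[of "\<lambda>v. Re (\<phi> v)"] main(3)[of "\<lambda>v. Im (\<phi> v)"], simplified]
    have "P_op \<mu> s \<phi> = (\<lambda>v. complex_of_real (A.P (\<lambda>v. Re (\<phi> v)) v) + \<i> * complex_of_real (A.P (\<lambda>v. Im (\<phi> v)) v))"
      using A.P_op_complex[OF BS_CC[OF \<phi>]] by auto
    with c show ?thesis by (simp add: n_def algebra_simps)
  qed
  then show ?thesis
    unfolding bounded_ops_def using P_op_lin[OF BS_CC BS_CC] A.P_op_of_real_mult by blast
qed

lemma r_BS: "(\<lambda>v. complex_of_real (A.r v)) \<in> BS"
proof -
  have "\<exists>C\<ge>0. \<forall>u\<in>simplex_S. \<forall>v\<in>simplex_S. \<bar>A.r u - A.r v\<bar> \<le> C * d_hilbert u v powr \<gamma>"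
    using A.r_FL unfolding A.FL_def by simp
  then obtain C where C0: "\<forall>u\<in>simplex_S. \<forall>v\<in>simplex_S. \<bar>A.r u - A.r v\<bar> \<le> C * d_hilbert u v powr \<gamma>" by meson
  have C: "\<bar>A.r u - A.r v\<bar> \<le> C * d_hilbert u v powr \<gamma>" if "u \<in> simplex_S" "v \<in> simplex_S" for u v
    using C0 that by simp
  obtain B where "\<And>v. \<bar>A.r v\<bar> \<le> B" using A.CY_bdd[OF A.r_CY] by auto
  note B = this
  show ?thesis
  proof (rule BS_I(1)[where a=B and b=C])
    show "complex_of_real (A.r v) = 0" if "v \<notin> simplex_S" for v using A.CY_out[OF A.r_CY that] by simp
    show "continuous_on simplex_S (\<lambda>v. complex_of_real (A.r v))"
      by (intro continuous_intros A.CY_cont A.r_CY)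
    show "cmod (complex_of_real (A.r v)) \<le> B" for v unfolding norm_of_real by (rule B)
    show "cmod (complex_of_real (A.r u) - complex_of_real (A.r v)) \<le> C * d_hilbert u v powr \<gamma>"
      if "u \<in> simplex_S" "v \<in> simplex_S" for u v
      unfolding of_real_diff[symmetric] norm_of_real by (rule C[OF that])
  qed
qed

lemma MM_bounded: "MM \<in> bounded_ops \<gamma>"
proof -
  let ?r = "\<lambda>v. complex_of_real (A.r v)"
  note R = BS_D[OF r_BS]
  have int: "cmod (\<integral>u. \<phi> u \<partial>A.nuM) \<le> 2 * B_norm \<gamma> \<phi>" if \<phi>: "\<phi> \<in> BS" for \<phi>
  proof -
    have "\<bar>\<integral>u. Re (\<phi> u) \<partial>A.nuM\<bar> \<le> B_norm \<gamma> \<phi>" "\<bar>\<integral>u. Im (\<phi> u) \<partial>A.nuM\<bar> \<le> B_norm \<gamma> \<phi>"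
      using parts_bounds(1,2)[OF \<phi>] by (auto intro!: A.eta_bound[OF A.prob_nuM A.sets_nuM])
    then show ?thesis
      unfolding integral_split(1)[OF BS_CC[OF \<phi>]]
      using norm_triangle_ineq[of "complex_of_real (\<integral>u. Re (\<phi> u) \<partial>A.nuM)" "\<i> * complex_of_real (\<integral>u. Im (\<phi> u) \<partial>A.nuM)"]
      by (simp add: norm_mult)
  qed
  have mem: "MM \<phi> \<in> BS" if "\<phi> \<in> BS" for \<phi>
    unfolding MM_def by (rule BS_scale[OF r_BS])
  have "B_norm \<gamma> (MM \<phi>) \<le> (4 * B_norm \<gamma> ?r) * B_norm \<gamma> \<phi>" if \<phi>: "\<phi> \<in> BS" for \<phi>
  proof -
    let ?c = "2 * B_norm \<gamma> \<phi> * B_norm \<gamma> ?r"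
    have "B_norm \<gamma> (MM \<phi>) \<le> ?c + ?c"
    proof (rule BS_I(2))
      fix v :: "real^'d" assume v: "v \<in> simplex_S"
      show "cmod (MM \<phi> v) \<le> ?c"
        unfolding MM_def norm_mult using int[OF \<phi>] R(3)[OF v] BS_D(5)[OF \<phi>] by (intro mult_mono) auto
      fix u :: "real^'d" assume u: "u \<in> simplex_S"
      have "MM \<phi> u - MM \<phi> v = (\<integral>u. \<phi> u \<partial>A.nuM) * (?r u - ?r v)" by (simp add: MM_def algebra_simps)
      also have "cmod \<dots> \<le> (2 * B_norm \<gamma> \<phi>) * (B_norm \<gamma> ?r * d_hilbert u v powr \<gamma>)"
        unfolding norm_mult using int[OF \<phi>] R(4)[OF u v] BS_D(5)[OF \<phi>] by (intro mult_mono) auto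
      finally show "cmod (MM \<phi> u - MM \<phi> v) \<le> ?c * d_hilbert u v powr \<gamma>" by (simp add: mult_ac)
    qed (use BS_D(1,2)[OF mem[OF \<phi>]] in auto)
    then show ?thesis by (simp add: mult_ac)
  qed
  moreover have "MM (\<lambda>v. \<phi> v + \<psi> v) = (\<lambda>v. MM \<phi> v + MM \<psi> v)" if "\<phi> \<in> BS" "\<psi> \<in> BS" for \<phi> \<psi>
    using integral_split(2)[OF BS_CC] that by (simp add: MM_def distrib_right)
  moreover have "MM (\<lambda>v. c * \<phi> v) = (\<lambda>v. c * MM \<phi> v)" for \<phi> c
    by (simp add: MM_def mult.assoc)
  ultimately show ?thesis unfolding bounded_ops_def using mem by blast
qed

lemma MM_r: "MM (\<lambda>v. c * complex_of_real (A.r v)) = (\<lambda>v. c * complex_of_real (A.r v))"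
  by (simp add: MM_def A.nuM_r)

lemma MM_MM: "MM (MM \<phi>) = MM \<phi>"
  unfolding MM_def[of \<phi>] by (rule MM_r)

lemma P_op_MM: "P_op \<mu> s (MM \<phi>) = (\<lambda>v. complex_of_real A.k * MM \<phi> v)"
  unfolding MM_def A.P_op_of_real_mult A.P_op_of_real A.P_r by (simp add: mult_ac)

lemma MM_P_op: assumes "\<phi> \<in> BS" shows "MM (P_op \<mu> s \<phi>) = (\<lambda>v. complex_of_real A.k * MM \<phi> v)"
proof -
  have "(\<integral>v. P_op \<mu> s \<phi> v \<partial>A.nuM) = complex_of_real A.k * (\<integral>v. \<phi> v \<partial>A.nuM)"
    using iffD2[OF A.prob_eigenmeasure_iff refl] BS_CC[OF assms] by (auto simp: prob_eigenmeasure_def A.CC_def)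
  then show ?thesis by (simp add: MM_def mult.assoc)
qed

lemma LL_bounded: "LL \<in> bounded_ops \<gamma>"
proof -
  obtain C1 where C1: "\<And>\<phi>. \<phi> \<in> BS \<Longrightarrow> B_norm \<gamma> (P_op \<mu> s \<phi>) \<le> C1 * B_norm \<gamma> \<phi>"
    using P_op_bounded unfolding bounded_ops_def by blast
  obtain C2 where C2: "\<And>\<phi>. \<phi> \<in> BS \<Longrightarrow> B_norm \<gamma> (MM \<phi>) \<le> C2 * B_norm \<gamma> \<phi>"
    using MM_bounded unfolding bounded_ops_def by blast
  note Pd = op_D[OF P_op_bounded] and Md = op_D[OF MM_bounded]
  have k: "0 < A.k" by (rule A.k_pos)
  have mem: "LL \<phi> \<in> BS" if "\<phi> \<in> BS" for \<phi>
    unfolding LL_def by (intro BS_diff BS_scale Pd(1) Md(1) that)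
  have "B_norm \<gamma> (LL \<phi>) \<le> (2 * (C1 + A.k * C2)) * B_norm \<gamma> \<phi>" if \<phi>: "\<phi> \<in> BS" for \<phi>
  proof -
    note p = BS_D[OF Pd(1)[OF \<phi>]] and m = BS_D[OF Md(1)[OF \<phi>]]
    let ?c = "B_norm \<gamma> (P_op \<mu> s \<phi>) + A.k * B_norm \<gamma> (MM \<phi>)"
    have tri: "cmod (x - complex_of_real A.k * y) \<le> cmod x + A.k * cmod y" for x y
      using norm_triangle_ineq4[of x "complex_of_real A.k * y"] k by (simp add: norm_mult)
    have "B_norm \<gamma> (LL \<phi>) \<le> ?c + ?c"
    proof (rule BS_I(2))
      fix v :: "real^'d" assume v: "v \<in> simplex_S"
      have "A.k * cmod (MM \<phi> v) \<le> A.k * B_norm \<gamma> (MM \<phi>)" using m(3)[OF v] k by (intro mult_left_mono) auto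
      then show "cmod (LL \<phi> v) \<le> ?c" unfolding LL_def using p(3)[OF v] tri[of "P_op \<mu> s \<phi> v" "MM \<phi> v"] by linarith
      fix u :: "real^'d" assume u: "u \<in> simplex_S"
      have "LL \<phi> u - LL \<phi> v = (P_op \<mu> s \<phi> u - P_op \<mu> s \<phi> v) - complex_of_real A.k * (MM \<phi> u - MM \<phi> v)"
        by (simp add: LL_def algebra_simps)
      moreover have "A.k * cmod (MM \<phi> u - MM \<phi> v) \<le> A.k * (B_norm \<gamma> (MM \<phi>) * d_hilbert u v powr \<gamma>)"
        using m(4)[OF u v] k by (intro mult_left_mono) auto
      ultimately have "cmod (LL \<phi> u - LL \<phi> v)
          \<le> B_norm \<gamma> (P_op \<mu> s \<phi>) * d_hilbert u v powr \<gamma> + A.k * (B_norm \<gamma> (MM \<phi>) * d_hilbert u v powr \<gamma>)"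
        using p(4)[OF u v] tri[of "P_op \<mu> s \<phi> u - P_op \<mu> s \<phi> v" "MM \<phi> u - MM \<phi> v"] by simp
      then show "cmod (LL \<phi> u - LL \<phi> v) \<le> ?c * d_hilbert u v powr \<gamma>" by (simp add: algebra_simps)
    qed (use BS_D(1,2)[OF mem[OF \<phi>]] in auto)
    also have "\<dots> \<le> 2 * (C1 * B_norm \<gamma> \<phi> + A.k * (C2 * B_norm \<gamma> \<phi>))"
    proof -
      have "A.k * B_norm \<gamma> (MM \<phi>) \<le> A.k * (C2 * B_norm \<gamma> \<phi>)" using C2[OF \<phi>] k by (intro mult_left_mono) auto
      then have "?c \<le> C1 * B_norm \<gamma> \<phi> + A.k * (C2 * B_norm \<gamma> \<phi>)" by (intro add_mono C1 \<phi>)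
      from add_mono[OF this this] show ?thesis by (simp only: mult_2)
    qed
    finally show ?thesis by (simp add: algebra_simps)
  qed
  moreover have "LL (\<lambda>v. \<phi> v + \<psi> v) = (\<lambda>v. LL \<phi> v + LL \<psi> v)" if "\<phi> \<in> BS" "\<psi> \<in> BS" for \<phi> \<psi>
    unfolding LL_def Pd(2)[OF that] Md(2)[OF that] by (simp add: algebra_simps)
  moreover have "LL (\<lambda>v. c * \<phi> v) = (\<lambda>v. c * LL \<phi> v)" if "\<phi> \<in> BS" for \<phi> c
    unfolding LL_def Pd(3)[OF that] Md(3)[OF that] by (simp add: algebra_simps)
  ultimately show ?thesis unfolding bounded_ops_def using mem by blast
qed

lemma LL_MM: "LL (MM \<phi>) = (\<lambda>v. 0)"
  by (simp add: LL_def P_op_MM MM_MM)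

lemma MM_LL: assumes "\<phi> \<in> BS" shows "MM (LL \<phi>) = (\<lambda>v. 0)"
proof -
  note m = op_D(1)[OF MM_bounded assms] and p = op_D(1)[OF P_op_bounded assms]
  have "MM (LL \<phi>) = (\<lambda>v. MM (P_op \<mu> s \<phi>) v - MM (\<lambda>v. complex_of_real A.k * MM \<phi> v) v)"
    unfolding LL_def by (rule op_diff[OF MM_bounded p BS_scale[OF m]])
  then show ?thesis
    by (simp add: op_D(3)[OF MM_bounded m] MM_P_op[OF assms] MM_MM)
qed

text \<open>\<open>MM\<close> is idempotent and its products with \<open>P_op\<close> in either
  order equal \<open>A.k\<close> times \<open>MM\<close>, so the cross terms cancel. The formula
  starts at the first power: the zeroth power of \<open>LL\<close> is the identity, not the identity
  minus \<open>MM\<close>.\<close>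

lemma LL_iter:
  assumes \<phi>: "\<phi> \<in> BS"
  shows "(LL ^^ Suc n) \<phi> = (\<lambda>v. (P_op \<mu> s ^^ Suc n) \<phi> v - complex_of_real A.k ^ Suc n * MM \<phi> v)"
proof (induction n)
  case 0 show ?case by (simp only: LL_def funpow.simps comp_apply id_apply power_Suc0_right)
next
  case (Suc n)
  have MB: "MM \<phi> \<in> BS" by (rule op_D(1)[OF MM_bounded \<phi>])
  have PB: "(P_op \<mu> s ^^ Suc n) \<phi> \<in> BS" by (rule op_iter(1)[OF P_op_bounded \<phi>])
  have it: "MM ((P_op \<mu> s ^^ m) \<phi>) = (\<lambda>v. complex_of_real A.k ^ m * MM \<phi> v)" for m
    by (induction m) (auto simp: MM_P_op op_iter(1)[OF P_op_bounded \<phi>])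
  have "(LL ^^ Suc (Suc n)) \<phi> = LL ((LL ^^ Suc n) \<phi>)" by simp
  also have "\<dots> = LL (\<lambda>v. (P_op \<mu> s ^^ Suc n) \<phi> v - complex_of_real A.k ^ Suc n * MM \<phi> v)"
    by (simp only: Suc.IH)
  also have "\<dots> = (\<lambda>v. LL ((P_op \<mu> s ^^ Suc n) \<phi>) v - LL (\<lambda>v. complex_of_real A.k ^ Suc n * MM \<phi> v) v)"
    by (rule op_diff[OF LL_bounded PB BS_scale[OF MB]])
  also have "LL (\<lambda>v. complex_of_real A.k ^ Suc n * MM \<phi> v) = (\<lambda>v. 0)"
    unfolding op_D(3)[OF LL_bounded MB] by (simp add: LL_MM)
  also have "LL ((P_op \<mu> s ^^ Suc n) \<phi>) = (\<lambda>v. (P_op \<mu> s ^^ Suc (Suc n)) \<phi> v - complex_of_real A.k * MM ((P_op \<mu> s ^^ Suc n) \<phi>) v)"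
    by (simp add: LL_def)
  finally show ?case unfolding it by (simp add: fun_eq_iff)
qed

lemma P_op_iter:
  assumes \<phi>: "\<phi> \<in> A.CC"
  shows "(P_op \<mu> s ^^ n) \<phi> = (\<lambda>v. complex_of_real ((A.P ^^ n) (\<lambda>v. Re (\<phi> v)) v) + \<i> * complex_of_real ((A.P ^^ n) (\<lambda>v. Im (\<phi> v)) v))"
proof (induction n)
  case 0 show ?case by (simp add: fun_eq_iff complex_eq_iff)
next
  case (Suc n)
  let ?f = "(A.P ^^ n) (\<lambda>v. Re (\<phi> v))" and ?h = "(A.P ^^ n) (\<lambda>v. Im (\<phi> v))"
  have fh: "?f \<in> A.CY" "?h \<in> A.CY" using A.P_iter_CY A.CC_Re[OF \<phi>] A.CC_Im[OF \<phi>] by auto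
  have "(\<lambda>v. complex_of_real (?f v) + \<i> * complex_of_real (?h v)) \<in> A.CC"
    using fh by (auto simp: A.CC_def A.CY_def intro!: continuous_intros)
  from A.P_op_complex[OF this]
  have step: "P_op \<mu> s (\<lambda>v. complex_of_real (?f v) + \<i> * complex_of_real (?h v))
      = (\<lambda>v. complex_of_real (A.P ?f v) + \<i> * complex_of_real (A.P ?h v))" by (intro ext) simp
  have "(P_op \<mu> s ^^ Suc n) \<phi> = P_op \<mu> s ((P_op \<mu> s ^^ n) \<phi>)" by simp
  also have "\<dots> = (\<lambda>v. complex_of_real (A.P ?f v) + \<i> * complex_of_real (A.P ?h v))"
    by (simp only: Suc.IH step)
  finally show ?case by simp
qed

text \<open>On real and imaginary parts \<open>LL ^^ n\<close> acts as the remainder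
  \<open>A.R n\<close>, whence the factor 2; the summand 1 covers \<open>n = 0\<close>, which
  \<open>R_bounds\<close> leaves out.\<close>

lemma LL_iter_bounds:
  assumes \<phi>: "\<phi> \<in> BS" and u: "u \<in> simplex_S" and v: "v \<in> simplex_S"
  shows "cmod ((LL ^^ n) \<phi> v) \<le> (2 * A.CS + 1) * (A.k * A.\<theta>) ^ n * B_norm \<gamma> \<phi>"
    "cmod ((LL ^^ n) \<phi> u - (LL ^^ n) \<phi> v) \<le> (2 * A.CS + 1) * (A.k * A.\<theta>) ^ n * B_norm \<gamma> \<phi> * d_hilbert u v powr \<gamma>"
proof -
  define b where "b = B_norm \<gamma> \<phi>"
  define t where "t = A.k * A.\<theta>"
  have b: "0 \<le> b" using BS_D(5)[OF \<phi>] by (simp add: b_def)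
  have t: "0 < t" using A.k_pos A.\<theta> by (simp add: t_def)
  have le: "2 * (A.CS * b * t ^ n) \<le> (2 * A.CS + 1) * t ^ n * b" using b t by (simp add: algebra_simps)
  have "cmod ((LL ^^ n) \<phi> v) \<le> (2 * A.CS + 1) * t ^ n * b \<and>
    cmod ((LL ^^ n) \<phi> u - (LL ^^ n) \<phi> v) \<le> (2 * A.CS + 1) * t ^ n * b * d_hilbert u v powr \<gamma>"
  proof (cases n)
    case 0
    have 1: "1 * b \<le> (2 * A.CS + 1) * b" using A.CS_nonneg b by (intro mult_right_mono) auto
    then have "1 * b * d_hilbert u v powr \<gamma> \<le> (2 * A.CS + 1) * b * d_hilbert u v powr \<gamma>" by (rule mult_right_mono) auto
    then show ?thesis using 0 1 BS_D(3)[OF \<phi> v] BS_D(4)[OF \<phi> u v] by (simp add: b_def)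
  next
    case (Suc m)
    then have n1: "1 \<le> n" by simp
    have main: "A.R n f \<in> A.CY" "\<And>v. v \<in> simplex_S \<Longrightarrow> \<bar>A.R n f v\<bar> \<le> A.CS * b * t ^ n"
      "\<And>u v. u \<in> simplex_S \<Longrightarrow> v \<in> simplex_S \<Longrightarrow> \<bar>A.R n f u - A.R n f v\<bar> \<le> (A.CS * b * t ^ n) * d_hilbert u v powr \<gamma>"
      if f: "f = (\<lambda>v. Re (\<phi> v)) \<or> f = (\<lambda>v. Im (\<phi> v))" for f
    proof -
      note p = parts_bounds[OF \<phi> f, folded b_def]
      show "A.R n f \<in> A.CY" by (rule A.R_CY[OF p(1)])
      show "\<bar>A.R n f v\<bar> \<le> A.CS * b * t ^ n" if "v \<in> simplex_S" for v
        unfolding t_def by (rule A.R_bounds(1)[OF p(1) b p(2)[OF A.inY] p(3)[OF A.inY A.inY] that that n1])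
      show "\<bar>A.R n f u - A.R n f v\<bar> \<le> (A.CS * b * t ^ n) * d_hilbert u v powr \<gamma>" if "u \<in> simplex_S" "v \<in> simplex_S" for u v
        unfolding t_def by (rule A.R_bounds(2)[OF p(1) b p(2)[OF A.inY] p(3)[OF A.inY A.inY] that n1])
    qed
    note c = combine_BS(3,4)[OF main(1)[of "\<lambda>v. Re (\<phi> v)"] main(1)[of "\<lambda>v. Im (\<phi> v)"]
        main(2)[of "\<lambda>v. Re (\<phi> v)"] main(2)[of "\<lambda>v. Im (\<phi> v)"]
        main(3)[of "\<lambda>v. Re (\<phi> v)"] main(3)[of "\<lambda>v. Im (\<phi> v)"], simplified]
    have nu: "A.nuF f = (\<integral>x. f x \<partial>A.nuM)" if f: "f = (\<lambda>v. Re (\<phi> v)) \<or> f = (\<lambda>v. Im (\<phi> v))" for f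
      using A.nuM_FX parts_bounds(1,4)[OF \<phi> f] by simp
    have "(LL ^^ n) \<phi> = (\<lambda>v. complex_of_real (A.R n (\<lambda>v. Re (\<phi> v)) v) + \<i> * complex_of_real (A.R n (\<lambda>v. Im (\<phi> v)) v))"
      unfolding Suc LL_iter[OF \<phi>] P_op_iter[OF BS_CC[OF \<phi>]]
      by (simp only: A.R_def nu MM_def integral_split(1)[OF BS_CC[OF \<phi>]] simp_thms) (simp add: algebra_simps)
    then have "cmod ((LL ^^ n) \<phi> v) \<le> 2 * (A.CS * b * t ^ n)"
      "cmod ((LL ^^ n) \<phi> u - (LL ^^ n) \<phi> v) \<le> 2 * (A.CS * b * t ^ n) * d_hilbert u v powr \<gamma>"
      using c(1)[OF v] c(2)[OF u v] by simp_all
    moreover have "2 * (A.CS * b * t ^ n) * d_hilbert u v powr \<gamma> \<le> (2 * A.CS + 1) * t ^ n * b * d_hilbert u v powr \<gamma>"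
      using le by (intro mult_right_mono) auto
    ultimately show ?thesis using le by linarith
  qed
  then show "cmod ((LL ^^ n) \<phi> v) \<le> (2 * A.CS + 1) * (A.k * A.\<theta>) ^ n * B_norm \<gamma> \<phi>"
    "cmod ((LL ^^ n) \<phi> u - (LL ^^ n) \<phi> v) \<le> (2 * A.CS + 1) * (A.k * A.\<theta>) ^ n * B_norm \<gamma> \<phi> * d_hilbert u v powr \<gamma>"
    by (auto simp: b_def t_def)
qed

text \<open>This is the continuity for the supremum norm that the Neumann series demands. The factor
  \<open>A.r v\<close> in the constant is replaced by a bound of \<open>A.r\<close> in
  \<open>spec_radius_LL\<close>.\<close>

lemma LL_sup:
  assumes \<phi>: "\<phi> \<in> BS" and b: "\<And>v. v \<in> simplex_S \<Longrightarrow> cmod (\<phi> v) \<le> b" and v: "v \<in> simplex_S"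
  shows "cmod (LL \<phi> v) \<le> (2 * (A.Wbar + A.k * A.r v)) * b"
proof -
  have LLv: "LL \<phi> v = complex_of_real (A.P (\<lambda>v. Re (\<phi> v)) v - A.k * (\<integral>u. Re (\<phi> u) \<partial>A.nuM) * A.r v)
      + \<i> * complex_of_real (A.P (\<lambda>v. Im (\<phi> v)) v - A.k * (\<integral>u. Im (\<phi> u) \<partial>A.nuM) * A.r v)"
    unfolding LL_def MM_def A.P_op_complex[OF BS_CC[OF \<phi>]] integral_split(1)[OF BS_CC[OF \<phi>]]
    by (simp add: algebra_simps)
  have main: "\<bar>A.P f v - A.k * (\<integral>u. f u \<partial>A.nuM) * A.r v\<bar> \<le> (A.Wbar + A.k * A.r v) * b"
    if f: "f = (\<lambda>v. Re (\<phi> v)) \<or> f = (\<lambda>v. Im (\<phi> v))" for f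
  proof -
    have fC: "f \<in> A.CY" using parts_bounds(1)[OF \<phi> f] .
    have fb: "\<bar>f x\<bar> \<le> b" if "x \<in> simplex_S" for x
      using b[OF that] f abs_Re_le_cmod[of "\<phi> x"] abs_Im_le_cmod[of "\<phi> x"] by auto
    have "\<bar>A.P f v\<bar> \<le> A.Wbar * b" by (rule A.P_bound[OF fC fb[OF A.inY] v])
    moreover have "\<bar>A.k * (\<integral>u. f u \<partial>A.nuM) * A.r v\<bar> \<le> A.k * b * A.r v"
    proof -
      have "\<bar>\<integral>u. f u \<partial>A.nuM\<bar> \<le> b" by (rule A.eta_bound[OF A.prob_nuM A.sets_nuM fC fb])
      then have "A.k * \<bar>\<integral>u. f u \<partial>A.nuM\<bar> * A.r v \<le> A.k * b * A.r v"
        using A.k_pos A.r_pos[OF v] by (intro mult_right_mono mult_left_mono) auto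
      then show ?thesis using A.k_pos A.r_pos[OF v] by (simp add: abs_mult)
    qed
    ultimately have "\<bar>A.P f v - A.k * (\<integral>u. f u \<partial>A.nuM) * A.r v\<bar> \<le> A.Wbar * b + A.k * b * A.r v" by linarith
    then show ?thesis by (simp add: algebra_simps)
  qed
  have "cmod (complex_of_real x + \<i> * complex_of_real y) \<le> \<bar>x\<bar> + \<bar>y\<bar>" for x y
    using norm_triangle_ineq[of "complex_of_real x" "\<i> * complex_of_real y"] by (simp add: norm_mult)
  from this[of "A.P (\<lambda>v. Re (\<phi> v)) v - A.k * (\<integral>u. Re (\<phi> u) \<partial>A.nuM) * A.r v"
      "A.P (\<lambda>v. Im (\<phi> v)) v - A.k * (\<integral>u. Im (\<phi> u) \<partial>A.nuM) * A.r v"]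
  have "cmod (complex_of_real (A.P (\<lambda>v. Re (\<phi> v)) v - A.k * (\<integral>u. Re (\<phi> u) \<partial>A.nuM) * A.r v)
      + \<i> * complex_of_real (A.P (\<lambda>v. Im (\<phi> v)) v - A.k * (\<integral>u. Im (\<phi> u) \<partial>A.nuM) * A.r v))
    \<le> \<bar>A.P (\<lambda>v. Re (\<phi> v)) v - A.k * (\<integral>u. Re (\<phi> u) \<partial>A.nuM) * A.r v\<bar>
      + \<bar>A.P (\<lambda>v. Im (\<phi> v)) v - A.k * (\<integral>u. Im (\<phi> u) \<partial>A.nuM) * A.r v\<bar>" .
  also have "\<bar>A.P (\<lambda>v. Re (\<phi> v)) v - A.k * (\<integral>u. Re (\<phi> u) \<partial>A.nuM) * A.r v\<bar>
      + \<bar>A.P (\<lambda>v. Im (\<phi> v)) v - A.k * (\<integral>u. Im (\<phi> u) \<partial>A.nuM) * A.r v\<bar>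
      \<le> (A.Wbar + A.k * A.r v) * b + (A.Wbar + A.k * A.r v) * b"
    by (intro add_mono main) auto
  also have "\<dots> = (2 * (A.Wbar + A.k * A.r v)) * b" by (simp only: mult_2 distrib_right)
  finally show ?thesis unfolding LLv .
qed

text \<open>The sandwich rate \<open>A.\<theta> < 1\<close> survives as the gap between
  \<open>A.k * A.\<theta>\<close> and \<open>A.k\<close>. The eigenfunction \<open>A.r\<close> is
  annihilated by \<open>LL\<close> and serves as the kernel vector.\<close>

lemma spec_radius_LL: "spec_radius \<gamma> LL < A.k"
proof -
  let ?r = "\<lambda>v. complex_of_real (A.r v)"
  obtain B where B: "0 < B" "\<And>v. \<bar>A.r v\<bar> \<le> B" using A.CY_bdd[OF A.r_CY] by auto
  have "spec_radius \<gamma> LL \<le> A.k * A.\<theta>"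
  proof (rule spec_radius_le[OF LL_bounded])
    show "0 \<le> 2 * A.CS + 1" using A.CS_nonneg by simp
    show "0 < A.k * A.\<theta>" using A.k_pos A.\<theta> by simp
    show "cmod (LL \<phi> v) \<le> (2 * (A.Wbar + A.k * B)) * b"
      if \<phi>: "\<phi> \<in> BS" and b: "\<And>v. v \<in> simplex_S \<Longrightarrow> cmod (\<phi> v) \<le> b" and v: "v \<in> simplex_S" for \<phi> b v
    proof -
      have b0: "0 \<le> b" using b[OF v] norm_ge_zero order_trans by blast
      have "A.r v \<le> B" using B(2)[of v] by simp
      then have "2 * (A.Wbar + A.k * A.r v) * b \<le> (2 * (A.Wbar + A.k * B)) * b"
        using A.k_pos b0 by (intro mult_right_mono) auto
      then show ?thesis using LL_sup[OF \<phi> b v] by linarith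
    qed
    show "?r \<in> BS" by (rule r_BS)
    show "?r \<noteq> (\<lambda>v. 0)" using A.r_pos[OF barycenter_in_simplex] by (intro notI) (drule fun_cong[of _ _ barycenter], simp)
    show "LL ?r = (\<lambda>v. 0)" using LL_MM[of ?r] MM_r[of 1] by simp
  qed (use LL_iter_bounds in auto)
  also have "\<dots> < A.k" using A.k_pos A.\<theta> by simp
  finally show ?thesis .
qed

lemma MM_projection: "rank_one_projection \<gamma> MM"
  unfolding rank_one_projection_def
proof (intro conjI)
  let ?r = "\<lambda>v. complex_of_real (A.r v)"
  show "MM \<in> bounded_ops \<gamma>" by (rule MM_bounded)
  show "\<forall>\<phi>\<in>BS. MM (MM \<phi>) = MM \<phi>" by (simp add: MM_MM)
  show "\<exists>\<psi>\<in>BS. \<psi> \<noteq> (\<lambda>v. 0) \<and> MM ` BS = range (\<lambda>c v. c * \<psi> v)"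
  proof (intro bexI[OF _ r_BS] conjI)
    show "?r \<noteq> (\<lambda>v. 0)" using A.r_pos[OF barycenter_in_simplex] by (intro notI) (drule fun_cong[of _ _ barycenter], simp)
    show "MM ` BS = range (\<lambda>c v. c * ?r v)"
    proof
      show "MM ` BS \<subseteq> range (\<lambda>c v. c * ?r v)" unfolding MM_def by blast
      show "range (\<lambda>c v. c * ?r v) \<subseteq> MM ` BS"
      proof (rule image_subsetI)
        fix c show "(\<lambda>v. c * ?r v) \<in> MM ` BS"
        proof (rule image_eqI)
          show "(\<lambda>v. c * ?r v) = MM (\<lambda>v. c * ?r v)" by (rule MM_r[symmetric])
          show "(\<lambda>v. c * ?r v) \<in> BS" by (rule BS_scale[OF r_BS])
        qed
      qed
    qed
  qed
qed

theorem conclusion: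
  "P_op \<mu> s \<in> bounded_ops \<gamma> \<and>
    rank_one_projection \<gamma> (M_op \<mu> A.k s) \<and>
    (\<exists>L \<in> bounded_ops \<gamma>.
       (\<forall>n\<ge>1. \<forall>\<phi>\<in>B_space \<gamma>.
          (P_op \<mu> s ^^ n) \<phi> =
            (\<lambda>v. complex_of_real A.k ^ n * M_op \<mu> A.k s \<phi> v + (L ^^ n) \<phi> v)) \<and>
       (\<forall>\<phi>\<in>B_space \<gamma>.
          M_op \<mu> A.k s (L \<phi>) = (\<lambda>v. 0) \<and> L (M_op \<mu> A.k s \<phi>) = (\<lambda>v. 0)) \<and>
       spec_radius \<gamma> L < A.k)"
proof -
  have M: "M_op \<mu> A.k s = MM" by (rule ext) (simp only: M_op_eq MM_def)
  have "(P_op \<mu> s ^^ n) \<phi> = (\<lambda>v. complex_of_real A.k ^ n * MM \<phi> v + (LL ^^ n) \<phi> v)" if n: "1 \<le> n" and \<phi>: "\<phi> \<in> BS" for n \<phi>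
  proof -
    obtain m where m: "n = Suc m" using n by (cases n) auto
    show ?thesis unfolding m LL_iter[OF \<phi>] by (rule ext) (simp only: add_diff_eq add_diff_cancel_left')
  qed
  note decomposition = this
  show ?thesis
    unfolding M
  proof (intro conjI bexI[OF _ LL_bounded] allI ballI impI)
    fix n :: nat and \<phi> :: "real^'d \<Rightarrow> complex" assume "1 \<le> n" "\<phi> \<in> BS"
    then show "(P_op \<mu> s ^^ n) \<phi> = (\<lambda>v. complex_of_real A.k ^ n * MM \<phi> v + (LL ^^ n) \<phi> v)"
      by (rule decomposition)
  qed (rule P_op_bounded MM_projection spec_radius_LL LL_MM | erule MM_LL)+
qed

end

section \<open>Verification of the hypotheses for comparable matrices\<close>

lemma matrix_transfer_col:
  fixes \<mu> :: "(real^'d^'d) measure"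
  assumes prob: "prob_space \<mu>" "sets \<mu> = sets borel" "integrable \<mu> (\<lambda>g. mnorm g powr s)"
    and s: "s \<noteq> 0" "0 < \<gamma>" "\<gamma> \<le> 1" and \<kappa>: "1 < \<kappa>"
    and good: "AE g in \<mu>. good g" "\<And>g. good g \<Longrightarrow> col_comparable \<kappa> g"
    and C: "\<And>g v. good g \<Longrightarrow> v \<in> simplex_S \<Longrightarrow> vnorm (g *v v) powr s \<le> C * mnorm g powr s"
  shows "\<exists>c L D. matrix_transfer \<mu> (simplex_K \<kappa>) s C \<gamma> c L D good"
proof -
  obtain N where N: "\<bar>s\<bar> \<le> real N" using real_arch_simple by blast
  have d: "1 \<le> real CARD('d)" by (simp add: Suc_leI)
  have kd: "1 \<le> \<kappa> * real CARD('d)" using \<kappa> d mult_mono[of 1 \<kappa> 1 "real CARD('d)"] by simp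
  have pos: "good g \<Longrightarrow> pos_matrix g" for g using good(2) by (auto simp: col_comparable_def)
  have sq: "0 < (1 / (\<kappa> * real CARD('d)))\<^sup>2" "(1 / (\<kappa> * real CARD('d)))\<^sup>2 \<le> 1"
    using kd by (auto simp: power_le_one)
  have "contracting_transfer \<mu> (simplex_K \<kappa>) simplex_S act (\<lambda>g v. vnorm (g *v v) powr s) (\<lambda>g. C * mnorm g powr s)
    (\<lambda>u v. d_hilbert u v powr \<gamma>) ((1 - (1 / (\<kappa> * real CARD('d)))\<^sup>2) powr \<gamma>)
    (2 * real N * (\<kappa> * real CARD('d))) (2 * real CARD('d)) good"
  proof (rule transfer_instance[OF prob s compact_simplex_K _ _ good(1) pos _ C _ _ _ kd _ N])
    show "simplex_K \<kappa> \<subseteq> (simplex_S :: (real^'d) set)" by (auto simp: simplex_K_def)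
    show "simplex_K \<kappa> \<noteq> ({} :: (real^'d) set)" using barycenter_in_simplex_K[of \<kappa>] \<kappa> by auto
  qed (use sq col_comparable_facts[OF good(2) \<kappa>] in auto)
  then show ?thesis using pos prob(2) s
    by (intro exI) (rule matrix_transfer.intro, assumption, rule matrix_transfer_axioms.intro, auto)
qed

lemma matrix_transfer_row:
  fixes \<mu> :: "(real^'d^'d) measure"
  assumes prob: "prob_space \<mu>" "sets \<mu> = sets borel" "integrable \<mu> (\<lambda>g. mnorm g powr s)"
    and s: "s \<noteq> 0" "0 < \<gamma>" "\<gamma> \<le> 1" and \<kappa>: "1 < \<kappa>"
    and good: "AE g in \<mu>. good g" "\<And>g. good g \<Longrightarrow> row_comparable \<kappa> g"
    and C: "\<And>g v. good g \<Longrightarrow> v \<in> simplex_S \<Longrightarrow> vnorm (g *v v) powr s \<le> C * mnorm g powr s"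
  shows "\<exists>c L D. matrix_transfer \<mu> simplex_S s C \<gamma> c L D good"
proof -
  obtain N where N: "\<bar>s\<bar> \<le> real N" using real_arch_simple by blast
  have pos: "good g \<Longrightarrow> pos_matrix g" for g using good(2) by (auto simp: row_comparable_def)
  have sq: "0 < (1 / \<kappa>)\<^sup>2" "(1 / \<kappa>)\<^sup>2 \<le> 1" using \<kappa> by (auto simp: power_le_one)
  have k1: "1 \<le> \<kappa>" using \<kappa> by simp
  have "contracting_transfer \<mu> simplex_S simplex_S act (\<lambda>g v. vnorm (g *v v) powr s) (\<lambda>g. C * mnorm g powr s)
    (\<lambda>u v. d_hilbert u v powr \<gamma>) ((1 - (1 / \<kappa>)\<^sup>2) powr \<gamma>) (2 * real N * \<kappa>) (2 * real CARD('d)) good"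
  proof (rule transfer_instance[OF prob s compact_simplex order_refl _ good(1) pos _ C _ _ _ k1 _ N])
    show "simplex_S \<noteq> ({} :: (real^'d) set)" using barycenter_in_simplex by auto
  qed (use sq row_comparable_facts[OF good(2) \<kappa>] act_in_simplex[OF pos] in auto)
  then show ?thesis using pos prob(2) s
    by (intro exI) (rule matrix_transfer.intro, assumption, rule matrix_transfer_axioms.intro, auto)
qed

lemma inner_simplex_le_1:
  assumes "v \<in> simplex_S" "u \<in> simplex_S" shows "0 \<le> v \<bullet> u" "v \<bullet> u \<le> 1"
proof -
  show "0 \<le> v \<bullet> u" unfolding inner_vec_def using simplex_D(1)[OF assms(1)] simplex_D(1)[OF assms(2)]
    by (auto intro!: sum_nonneg)
  have "v \<bullet> u \<le> (\<Sum>i\<in>UNIV. v $ i)"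
    unfolding inner_vec_def inner_real_def
    by (intro sum_mono mult_left_le simplex_D assms)
  then show "v \<bullet> u \<le> 1" using simplex_D(2)[OF assms(1)] by simp
qed

lemma inner_simplex_K_ge:
  fixes u v :: "real^'d"
  assumes v: "v \<in> simplex_S" and u: "u \<in> simplex_K \<kappa>" and \<kappa>: "0 < \<kappa>"
  shows "1 / (\<kappa> * real CARD('d)) \<le> v \<bullet> u"
proof -
  have "1 / (\<kappa> * real CARD('d)) = (\<Sum>i\<in>UNIV. v $ i * (1 / (\<kappa> * real CARD('d))))"
    using simplex_D(2)[OF v] by (simp flip: sum_distrib_right sum_divide_distrib)
  also have "\<dots> \<le> v \<bullet> u"
    unfolding inner_vec_def inner_real_def
    by (intro sum_mono mult_left_mono simplex_K_ge[OF u \<kappa>] simplex_D(1)[OF v])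
  finally show ?thesis .
qed

lemma borel_measurable_entry [measurable]: "(\<lambda>h :: real^'n^'m. h $ i $ j) \<in> borel_measurable borel"
  by (intro borel_measurable_continuous_onI continuous_intros)

lemma AE_distr_transpose:
  fixes \<mu> :: "(real^'d^'d) measure"
  assumes sets: "sets \<mu> = sets borel" and ae: "AE h in \<mu>. Q (transpose h)"
    and Q: "Measurable.pred borel Q"
  shows "AE h in distr \<mu> borel transpose. Q h"
proof -
  have "transpose \<in> measurable \<mu> borel" by (simp add: measurable_cong_sets[OF sets refl])
  then show ?thesis using ae Q by (subst AE_distr_iff) (auto simp: pred_def)
qed

lemma mnorm_transpose: "mnorm (transpose h) = mnorm h"
  unfolding mnorm_def transpose_def by (simp, rule sum.swap)

theorem corollary2p14:
  fixes \<mu> :: "(real ^ 'd ^ 'd) measure"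
    and W :: "'w measure"
    and g :: "nat \<Rightarrow> 'w \<Rightarrow> real ^ 'd ^ 'd"
    and s \<gamma> :: real
  assumes dim: "CARD('d) \<ge> 2"
    and iid: "iid_with_law W g \<mu>"
    and nonneg: "AE h in \<mu>. h \<in> nonneg_matrices"
    and zero: "0 \<notin> Gamma_mu \<mu>"
    and s: "s \<in> interior (I_plus \<mu>) \<union> interior (I_minus \<mu>)"
    and cases:
      "(s \<in> I_minus \<mu> \<and> (\<exists>\<kappa>\<^sub>0>1. AE h in \<mu>. pos_matrix h \<and>
           Max {h $ i $ j | i j. True} \<le> \<kappa>\<^sub>0 * Min {h $ i $ j | i j. True})) \<or>
       (s \<in> I_plus \<mu> \<and> (\<exists>\<kappa>>1. AE h in \<mu>. pos_matrix h \<and>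
           (\<forall>j. Max {h $ i $ j | i. True} \<le> \<kappa> * Min {h $ i $ j | i. True})))"
    and \<gamma>: "0 < \<gamma>" "\<gamma> \<le> min \<bar>s\<bar> 1"
  shows "P_op \<mu> s \<in> bounded_ops \<gamma> \<and>
    rank_one_projection \<gamma> (M_op \<mu> (kappa W g s) s) \<and>
    (\<exists>L \<in> bounded_ops \<gamma>.
       (\<forall>n\<ge>1. \<forall>\<phi>\<in>B_space \<gamma>.
          (P_op \<mu> s ^^ n) \<phi> =
            (\<lambda>v. complex_of_real (kappa W g s) ^ n * M_op \<mu> (kappa W g s) s \<phi> v + (L ^^ n) \<phi> v)) \<and>
       (\<forall>\<phi>\<in>B_space \<gamma>.
          M_op \<mu> (kappa W g s) s (L \<phi>) = (\<lambda>v. 0) \<and> L (M_op \<mu> (kappa W g s) s \<phi>) = (\<lambda>v. 0)) \<and>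
       spec_radius \<gamma> L < kappa W g s)"
proof -
  let ?\<mu>' = "distr \<mu> borel transpose"
  have s0: "s \<noteq> 0" and \<gamma>1: "\<gamma> \<le> 1" using \<gamma> by auto
  have sets: "sets \<mu> = sets borel" and prob: "prob_space \<mu>"
  proof -
    interpret W: prob_space W using iid by (simp add: iid_with_law_def)
    have law: "distr W borel (g 1) = \<mu>" using iid by (simp add: iid_with_law_def)
    have "g 1 \<in> borel_measurable W" using iid by (auto simp: iid_with_law_def W.indep_vars_def2)
    then show "prob_space \<mu>" unfolding law[symmetric] by (rule W.prob_space_distr)
    show "sets \<mu> = sets borel" unfolding law[symmetric] by simp
  qed
  have tr: "transpose \<in> measurable \<mu> borel" by (simp add: measurable_cong_sets[OF sets refl])
  have prob': "prob_space ?\<mu>'" by (rule prob_space.prob_space_distr[OF prob tr])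
  have mom: "integrable \<mu> (\<lambda>h. mnorm h powr s)"
  proof (rule integrableI_nonneg)
    show "(\<lambda>h. mnorm h powr s) \<in> borel_measurable \<mu>"
      unfolding measurable_cong_sets[OF sets refl] by measurable
    show "(\<integral>\<^sup>+ h. ennreal (mnorm h powr s) \<partial>\<mu>) < \<infinity>" using cases by (auto simp: I_plus_def I_minus_def)
  qed simp
  have mom': "integrable ?\<mu>' (\<lambda>h. mnorm h powr s)"
    by (subst integrable_distr_eq[OF tr]) (use mom in \<open>auto simp: mnorm_transpose\<close>)
  have sets': "sets ?\<mu>' = sets borel" by simp
  from cases show ?thesis
  proof
    assume "s \<in> I_minus \<mu> \<and> (\<exists>\<kappa>\<^sub>0>1. AE h in \<mu>. pos_matrix h \<and>
           Max {h $ i $ j | i j. True} \<le> \<kappa>\<^sub>0 * Min {h $ i $ j | i j. True})"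
    then obtain \<kappa> where sneg: "s < 0" and \<kappa>: "1 < \<kappa>"
      and ae: "AE h in \<mu>. pos_matrix h \<and> Max {h $ i $ j | i j. True} \<le> \<kappa> * Min {h $ i $ j | i j. True}"
      using s0 by (auto simp: I_minus_def)
    define full :: "real^'d^'d \<Rightarrow> bool"
      where "full h \<longleftrightarrow> pos_matrix h \<and> (\<forall>i j i' j'. h $ i $ j \<le> \<kappa> * h $ i' $ j')" for h
    have good: "AE h in \<mu>. full h"
      using ae
    proof eventually_elim
      case (elim h)
      have "{h $ i $ j | i j. True} = range (\<lambda>(i, j). h $ i $ j)" by auto
      then have fin: "finite {h $ i $ j | i j. True}" by simp
      have "h $ i $ j \<le> \<kappa> * h $ i' $ j'" for i j i' j'
      proof -
        have "h $ i $ j \<le> Max {h $ i $ j | i j. True}" using fin by (intro Max_ge) auto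
        also have "\<dots> \<le> \<kappa> * Min {h $ i $ j | i j. True}" using elim by simp
        also have "\<dots> \<le> \<kappa> * h $ i' $ j'" using fin \<kappa> by (intro mult_left_mono Min_le) auto
        finally show ?thesis .
      qed
      then show ?case using elim by (simp add: full_def)
    qed
    \<comment> \<open>Comparability of all entries is invariant under transposition, so under (i)
      both systems are of column type with the same attracting set
      \<open>simplex_K \<kappa>\<close>.\<close>
    have full_tr: "full (transpose h) \<longleftrightarrow> full h" for h
      by (auto simp: full_def pos_matrix_def transpose_def)
    have good': "AE h in ?\<mu>'. full h"
    proof (rule AE_distr_transpose[OF sets])
      show "AE h in \<mu>. full (transpose h)" using good by (simp add: full_tr)
      show "Measurable.pred borel full" unfolding full_def[abs_def] pos_matrix_def by measurable
    qed
    have col: "full h \<Longrightarrow> col_comparable \<kappa> h" for h by (auto simp: full_def col_comparable_def)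
    \<comment> \<open>Raising
      \<open>mnorm h / (\<kappa> * real CARD('d)) \<le> vnorm (h *v v)\<close> to the negative power
      \<open>s\<close> reverses the inequality and turns the factor into \<open>C\<close>.\<close>
    define C where "C = (\<kappa> * real CARD('d)) powr (- s)"
    have kd: "0 < \<kappa> * real CARD('d)" using \<kappa> by simp
    have C: "vnorm (h *v v) powr s \<le> C * mnorm h powr s" if h: "full h" and v: "v \<in> simplex_S" for h v
    proof -
      have p: "pos_matrix h" using h by (simp add: full_def)
      have vp: "0 < vnorm (h *v v)" by (rule pos_matrix_mult_pos(2)[OF p v])
      have m0: "0 < mnorm h" using vnorm_mult_le_mnorm[OF p v] vp by linarith
      have "mnorm h / (\<kappa> * real CARD('d)) \<le> vnorm (h *v v)"
        using mnorm_le_vnorm_mult[OF p _ \<kappa> v] h kd by (simp add: full_def field_simps)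
      then have "vnorm (h *v v) powr s \<le> (mnorm h / (\<kappa> * real CARD('d))) powr s"
        using sneg m0 kd by (intro powr_mono2') auto
      also have "\<dots> = C * mnorm h powr s"
        using m0 kd by (simp add: C_def powr_divide powr_minus field_simps)
      finally show ?thesis .
    qed
    obtain c1 L1 D1 where A: "matrix_transfer \<mu> (simplex_K \<kappa>) s C \<gamma> c1 L1 D1 full"
      using matrix_transfer_col[OF prob sets mom s0 \<gamma>(1) \<gamma>1 \<kappa> good col C] by blast
    obtain c2 L2 D2 where B: "matrix_transfer ?\<mu>' (simplex_K \<kappa>) s C \<gamma> c2 L2 D2 full"
      using matrix_transfer_col[OF prob' sets' mom' s0 \<gamma>(1) \<gamma>1 \<kappa> good' col C] by blast
    have K: "x \<in> simplex_S" if "x \<in> simplex_K \<kappa>" for x :: "real^'d" using that by (simp add: simplex_K_def)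
    \<comment> \<open>As \<open>s < 0\<close>, the kernel is at least 1 because scalar products on
      the simplex are at most 1, and it is bounded above through the lower bound
      \<open>1 / (\<kappa> * real CARD('d))\<close> of the coordinates of \<open>u\<close> in
      \<open>simplex_K \<kappa>\<close>.\<close>
    interpret dual_pair \<mu> s \<gamma> "simplex_K \<kappa>" C c1 L1 D1 full "simplex_K \<kappa>" C c2 L2 D2 full
      "1 / (\<kappa> * real CARD('d))" 1 "(1 / (\<kappa> * real CARD('d))) powr s"
    proof (rule dual_pair.intro[OF A B], rule dual_pair_axioms.intro)
      fix v u :: "real^'d"
      show "1 / (\<kappa> * real CARD('d)) \<le> v \<bullet> u" if "v \<in> simplex_S" "u \<in> simplex_K \<kappa>"
        using inner_simplex_K_ge[OF that] \<kappa> by simp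
      show "(v \<bullet> u) powr s \<le> (1 / (\<kappa> * real CARD('d))) powr s" if "v \<in> simplex_S" "u \<in> simplex_K \<kappa>"
        using inner_simplex_K_ge[OF that] \<kappa> kd sneg by (intro powr_mono2') auto
      show "1 \<le> (v \<bullet> u) powr s" if "v \<in> simplex_K \<kappa>" "u \<in> simplex_K \<kappa>"
      proof -
        have "0 < 1 / (\<kappa> * real CARD('d))" using kd by simp
        then have "0 < v \<bullet> u" using inner_simplex_K_ge[OF K[OF that(1)] that(2)] \<kappa> by linarith
        then have "1 powr s \<le> (v \<bullet> u) powr s"
          using inner_simplex_le_1(2)[OF K[OF that(1)] K[OF that(2)]] sneg by (intro powr_mono2') auto
        then show ?thesis by simp
      qed
    qed (use dim \<gamma>1 kd in auto)
    show ?thesis using conclusion unfolding A.kappa_eq[OF iid] .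
  next
    assume "s \<in> I_plus \<mu> \<and> (\<exists>\<kappa>>1. AE h in \<mu>. pos_matrix h \<and>
           (\<forall>j. Max {h $ i $ j | i. True} \<le> \<kappa> * Min {h $ i $ j | i. True}))"
    then obtain \<kappa> where spos: "0 < s" and \<kappa>: "1 < \<kappa>"
      and ae: "AE h in \<mu>. pos_matrix h \<and> (\<forall>j. Max {h $ i $ j | i. True} \<le> \<kappa> * Min {h $ i $ j | i. True})"
      using s0 by (auto simp: I_plus_def)
    have good: "AE h in \<mu>. col_comparable \<kappa> h"
      using ae
    proof eventually_elim
      case (elim h)
      have "h $ i $ j \<le> \<kappa> * h $ i' $ j" for i i' j
      proof -
        have fin: "finite {h $ i $ j | i. True}" by (simp add: full_SetCompr_eq)
        have "h $ i $ j \<le> Max {h $ i $ j | i. True}" using fin by (intro Max_ge) auto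
        also have "\<dots> \<le> \<kappa> * Min {h $ i $ j | i. True}" using elim by simp
        also have "\<dots> \<le> \<kappa> * h $ i' $ j" using fin \<kappa> by (intro mult_left_mono Min_le) auto
        finally show ?thesis .
      qed
      then show ?case using elim by (simp add: col_comparable_def)
    qed
    \<comment> \<open>Columns become rows under transposition, so under (ii) the dual system is of
      row type, with the whole simplex as \<open>X2\<close>.\<close>
    have tr_row: "row_comparable \<kappa> (transpose h) \<longleftrightarrow> col_comparable \<kappa> h" for h :: "real^'d^'d"
      by (auto simp: row_comparable_def col_comparable_def pos_matrix_def transpose_def)
    have good': "AE h in ?\<mu>'. row_comparable \<kappa> h"
    proof (rule AE_distr_transpose[OF sets])
      show "AE h in \<mu>. row_comparable \<kappa> (transpose h)" using good by (simp add: tr_row)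
      show "Measurable.pred borel (row_comparable \<kappa> :: real^'d^'d \<Rightarrow> bool)"
        unfolding row_comparable_def[abs_def] pos_matrix_def by measurable
    qed
    have C: "vnorm (h *v v) powr s \<le> 1 * mnorm h powr s" if "pos_matrix h" "v \<in> simplex_S" for h and v :: "real^'d"
      using powr_mono2[OF _ vnorm_nonneg vnorm_mult_le_mnorm[OF that], of s] spos by simp
    have Ccol: "vnorm (h *v v) powr s \<le> 1 * mnorm h powr s"
      if "col_comparable \<kappa> h" "v \<in> simplex_S" for h and v :: "real^'d"
      using C that by (simp add: col_comparable_def)
    have Crow: "vnorm (h *v v) powr s \<le> 1 * mnorm h powr s"
      if "row_comparable \<kappa> h" "v \<in> simplex_S" for h and v :: "real^'d"
      using C that by (simp add: row_comparable_def)
    obtain c1 L1 D1 where A: "matrix_transfer \<mu> (simplex_K \<kappa>) s 1 \<gamma> c1 L1 D1 (col_comparable \<kappa>)"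
      using matrix_transfer_col[OF prob sets mom s0 \<gamma>(1) \<gamma>1 \<kappa> good _ Ccol] by blast
    obtain c2 L2 D2 where B: "matrix_transfer ?\<mu>' simplex_S s 1 \<gamma> c2 L2 D2 (row_comparable \<kappa>)"
      using matrix_transfer_row[OF prob' sets' mom' s0 \<gamma>(1) \<gamma>1 \<kappa> good' _ Crow] by blast
    have kd: "0 < \<kappa> * real CARD('d)" using \<kappa> by simp
    \<comment> \<open>As \<open>s > 0\<close>, the kernel has no singularity:
      \<open>\<epsilon> = 0\<close> and \<open>M = 1\<close> will do although \<open>u\<close> may
      lie on the boundary. Positivity of \<open>rs\<close> on \<open>X1\<close> now comes from the
      coordinates of \<open>v\<close>, which are bounded below on
      \<open>simplex_K \<kappa>\<close>.\<close>
    interpret dual_pair \<mu> s \<gamma> "simplex_K \<kappa>" 1 c1 L1 D1 "col_comparable \<kappa>" simplex_S 1 c2 L2 D2 "row_comparable \<kappa>"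
      0 "(1 / (\<kappa> * real CARD('d))) powr s" 1
    proof (rule dual_pair.intro[OF A B], rule dual_pair_axioms.intro)
      fix v u :: "real^'d"
      show "0 \<le> v \<bullet> u" if "v \<in> simplex_S" "u \<in> simplex_S" by (rule inner_simplex_le_1[OF that])
      show "(v \<bullet> u) powr s \<le> 1" if "v \<in> simplex_S" "u \<in> simplex_S"
        using inner_simplex_le_1[OF that] spos by (intro powr_le1) auto
      show "(1 / (\<kappa> * real CARD('d))) powr s \<le> (v \<bullet> u) powr s" if "v \<in> simplex_K \<kappa>" "u \<in> simplex_S"
        using inner_simplex_K_ge[OF that(2,1)] \<kappa> kd spos by (intro powr_mono2) (auto simp: inner_commute)
    qed (use dim \<gamma>1 kd spos in auto)
    show ?thesis using conclusion unfolding A.kappa_eq[OF iid] .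
  qed
qed

end
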